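(* Let $N\geq 3$, let $\Omega\subset\mathbb{R}^N$ be a bounded domain with smooth boundary, and let $p,q:\overline\Omega\to\mathbb{R}$ be continuous functions such that $$1<\min_{x\in\overline\Omega}q(x)<\min_{x\in\overline\Omega}p(x)<\max_{x\in\overline\Omega}q(x),$$ $\max_{x\in\overline\Omega}p(x)<N$, and $q(x)<p^\star(x):=\frac{Np(x)}{N-p(x)}$ for all $x\in\overline\Omega$. Then there exists $\lambda^\star>0$ such that every $\lambda\in(0,\lambda^\star)$ is an eigenvalue of the problem $$-\mathrm{div}\left(|\nabla u|^{p(x)-2}\nabla u\right)=\lambda|u|^{q(x)-2}u\ \text{ in }\Omega,\qquad u=0\ \text{ on }\partial\Omega,$$ that is, for every $\lambda\in(0,\lambda^\star)$ there exists $u\in W_0^{1,p(x)}(\Omega)\setminus\{0\}$ such that $$\int_{\Omega}|\nabla u|^{p(x)-2}\nabla u\cdot\nabla v\,dx-\lambda\int_{\Omega}|u|^{q(x)-2}uv\,dx=0\qquad\text{for all }v\in W_0^{1,p(x)}(\Omega).$$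
   Context: For a continuous function $p:\overline\Omega\to(1,\infty)$, the variable exponent Lebesgue space $L^{p(x)}(\Omega)$ is the set of measurable $u:\Omega\to\mathbb{R}$ (up to a.e. equality) with $\int_\Omega|u(x)|^{p(x)}\,dx<\infty$, equipped with the Luxemburg norm $$|u|_{p(x)}=\inf\left\{\mu>0:\ \int_\Omega\left|\frac{u(x)}{\mu}\right|^{p(x)}dx\leq 1\right\}.$$ The space $W_0^{1,p(x)}(\Omega)$ is the closure of $C_0^\infty(\Omega)$ under the norm $\|u\|=|\nabla u|_{p(x)}$ (the Luxemburg norm of $|\nabla u|$, where $\nabla u$ is the weak gradient). A real number $\lambda$ is called an eigenvalue of the problem if a nonzero $u\in W_0^{1,p(x)}(\Omega)$ satisfying the displayed weak formulation exists. Conventions: $|\xi|^{r-2}\xi=0$ when $\xi=0$, for $r>1$. *)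

theory Defs
  imports "HOL-Analysis.Analysis"
begin

primrec Ck_fun :: "nat \<Rightarrow> ('a::euclidean_space \<Rightarrow> real) \<Rightarrow> bool" where
  "Ck_fun 0 f \<longleftrightarrow> continuous_on UNIV f"
| "Ck_fun (Suc k) f \<longleftrightarrow>
     (\<forall>x. f differentiable (at x)) \<and> (\<forall>v. Ck_fun k (\<lambda>x. frechet_derivative f (at x) v))"

definition smooth_fun :: "('a::euclidean_space \<Rightarrow> real) \<Rightarrow> bool" where
  "smooth_fun f \<longleftrightarrow> (\<forall>k. Ck_fun k f)"

definition gradient :: "('a::euclidean_space \<Rightarrow> real) \<Rightarrow> 'a \<Rightarrow> 'a" where
  "gradient f x = (\<Sum>b\<in>Basis. frechet_derivative f (at x) b *\<^sub>R b)"

lemma GDERIV_gradient: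
  assumes "f differentiable (at x)"
  shows "GDERIV f x :> gradient f x"
proof -
  let ?D = "frechet_derivative f (at x)"
  have D: "(f has_derivative ?D) (at x)"
    using assms by (simp add: frechet_derivative_works)
  then have lin: "linear ?D"
    by (rule has_derivative_linear)
  have "?D = (\<lambda>h. h \<bullet> gradient f x)"
  proof
    fix h
    have "?D h = ?D (\<Sum>b\<in>Basis. (h \<bullet> b) *\<^sub>R b)"
      by (simp add: euclidean_representation)
    also have "\<dots> = (\<Sum>b\<in>Basis. (h \<bullet> b) * ?D b)"
      by (simp add: linear_sum[OF lin] linear_cmul[OF lin])
    finally show "?D h = h \<bullet> gradient f x"
      by (simp add: gradient_def inner_sum_right mult.commute)
  qed
  with D show ?thesis
    by (simp add: gderiv_def)
qed

(* Near each boundary point the set is a strict epigraph in some direction e. The graph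
   function is only evaluated on the hyperplane orthogonal to e; a smooth function on that
   hyperplane always extends to the whole space, by composition with the projection. *)
definition smooth_boundary :: "'a::euclidean_space set \<Rightarrow> bool" where
  "smooth_boundary \<Omega> \<longleftrightarrow>
     (\<forall>x0 \<in> frontier \<Omega>. \<exists>r>0. \<exists>e \<gamma>. norm e = 1 \<and> smooth_fun \<gamma> \<and>
        \<Omega> \<inter> ball x0 r = {x \<in> ball x0 r. x \<bullet> e > \<gamma> (x - (x \<bullet> e) *\<^sub>R e)})"

(* C_0^\<infinity>(\<Omega>), its elements being extended by zero outside \<Omega> *)
definition test_funs :: "'a::euclidean_space set \<Rightarrow> ('a \<Rightarrow> real) set" where
  "test_funs \<Omega> = {\<phi>. smooth_fun \<phi> \<and> compact (closure {x. \<phi> x \<noteq> 0}) \<and> closure {x. \<phi> x \<noteq> 0} \<subseteq> \<Omega>}"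

(* The function spaces below consist of functions rather than of classes modulo a.e. equality;
   values outside \<Omega> are irrelevant. *)

definition modular :: "'a::euclidean_space set \<Rightarrow> ('a \<Rightarrow> real) \<Rightarrow> ('a \<Rightarrow> real) \<Rightarrow> ennreal" where
  "modular \<Omega> p u = (\<integral>\<^sup>+x. ennreal (\<bar>u x\<bar> powr p x) \<partial>lebesgue_on \<Omega>)"

definition Lp_var :: "'a::euclidean_space set \<Rightarrow> ('a \<Rightarrow> real) \<Rightarrow> ('a \<Rightarrow> real) set" where
  "Lp_var \<Omega> p = {u \<in> borel_measurable (lebesgue_on \<Omega>). modular \<Omega> p u < \<infinity>}"

definition luxemburg :: "'a::euclidean_space set \<Rightarrow> ('a \<Rightarrow> real) \<Rightarrow> ('a \<Rightarrow> real) \<Rightarrow> real" where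
  "luxemburg \<Omega> p u = Inf {\<mu>. \<mu> > 0 \<and> modular \<Omega> p (\<lambda>x. u x / \<mu>) \<le> 1}"

definition has_weak_gradient :: "'a::euclidean_space set \<Rightarrow> ('a \<Rightarrow> real) \<Rightarrow> ('a \<Rightarrow> 'a) \<Rightarrow> bool" where
  "has_weak_gradient \<Omega> u G \<longleftrightarrow>
     (\<forall>K. compact K \<and> K \<subseteq> \<Omega> \<longrightarrow> u absolutely_integrable_on K \<and> G absolutely_integrable_on K) \<and>
     (\<forall>\<phi>\<in>test_funs \<Omega>.
        (\<integral>x. u x *\<^sub>R gradient \<phi> x \<partial>lebesgue_on \<Omega>) = - (\<integral>x. \<phi> x *\<^sub>R G x \<partial>lebesgue_on \<Omega>))"

(* determined up to a null subset of \<Omega>, for open \<Omega> *)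
definition weak_grad :: "'a::euclidean_space set \<Rightarrow> ('a \<Rightarrow> real) \<Rightarrow> 'a \<Rightarrow> 'a" where
  "weak_grad \<Omega> u = (SOME G. has_weak_gradient \<Omega> u G)"

definition W1p_var :: "'a::euclidean_space set \<Rightarrow> ('a \<Rightarrow> real) \<Rightarrow> ('a \<Rightarrow> real) set" where
  "W1p_var \<Omega> p = {u \<in> Lp_var \<Omega> p.
     (\<exists>G. has_weak_gradient \<Omega> u G) \<and> (\<lambda>x. norm (weak_grad \<Omega> u x)) \<in> Lp_var \<Omega> p}"

(* On all of W^{1,p(x)} the gradient norm is only a seminorm (it vanishes on constants), so
   closing C_0^\<infinity> there with respect to it alone would not impose zero boundary values. The
   closure is the completion of C_0^\<infinity>, where by Poincare's inequality the gradient norm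
   controls the L^{p(x)} norm; hence the approximants converge in L^{p(x)} as well. *)
definition W01p_var :: "'a::euclidean_space set \<Rightarrow> ('a \<Rightarrow> real) \<Rightarrow> ('a \<Rightarrow> real) set" where
  "W01p_var \<Omega> p = {u \<in> W1p_var \<Omega> p. \<exists>\<phi>::nat \<Rightarrow> 'a \<Rightarrow> real.
     (\<forall>k. \<phi> k \<in> test_funs \<Omega>) \<and>
     (\<lambda>k. luxemburg \<Omega> p (\<lambda>x. norm (gradient (\<phi> k) x - weak_grad \<Omega> u x))) \<longlonglongrightarrow> 0 \<and>
     (\<lambda>k. luxemburg \<Omega> p (\<lambda>x. \<phi> k x - u x)) \<longlonglongrightarrow> 0}"

(* Since 0 powr r = 0 for every r, the factors |\<xi>|^{r-2} \<xi> vanish at \<xi> = 0. Integrability is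
   required explicitly because the integral of a non-integrable function is 0 by convention. *)
definition weak_solution ::
  "'a::euclidean_space set \<Rightarrow> ('a \<Rightarrow> real) \<Rightarrow> ('a \<Rightarrow> real) \<Rightarrow> real \<Rightarrow> ('a \<Rightarrow> real) \<Rightarrow> bool" where
  "weak_solution \<Omega> p q lam u \<longleftrightarrow> u \<in> W01p_var \<Omega> p \<and>
     (\<forall>v \<in> W01p_var \<Omega> p.
        let A = (\<lambda>x. norm (weak_grad \<Omega> u x) powr (p x - 2) * (weak_grad \<Omega> u x \<bullet> weak_grad \<Omega> v x));
            B = (\<lambda>x. \<bar>u x\<bar> powr (q x - 2) * u x * v x)
        in integrable (lebesgue_on \<Omega>) A \<and> integrable (lebesgue_on \<Omega>) B \<and>
           (\<integral>x. A x \<partial>lebesgue_on \<Omega>) - lam * (\<integral>x. B x \<partial>lebesgue_on \<Omega>) = 0)"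

definition is_eigenvalue ::
  "'a::euclidean_space set \<Rightarrow> ('a \<Rightarrow> real) \<Rightarrow> ('a \<Rightarrow> real) \<Rightarrow> real \<Rightarrow> bool" where
  "is_eigenvalue \<Omega> p q lam \<longleftrightarrow>
     (\<exists>u. weak_solution \<Omega> p q lam u \<and> \<not> (AE x in lebesgue_on \<Omega>. u x = 0))"

end

theory Submission
  imports Defs "HOL-Complex_Analysis.Great_Picard" "HOL-Library.Diagonal_Subsequence"
begin

text \<open>On test functions with \<open>\<integral>\<bar>\<nabla>u\<bar>\<^sup>p/p \<le> 1\<close> the subcritical Sobolev inequality bounds
  \<open>\<integral>\<bar>u\<bar>\<^sup>q/q\<close>, so for small \<open>\<lambda>\<close> the energy \<open>J u = \<integral>\<bar>\<nabla>u\<bar>\<^sup>p/p - \<lambda> \<integral>\<bar>u\<bar>\<^sup>q/q\<close> is positive where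
  \<open>\<integral>\<bar>\<nabla>u\<bar>\<^sup>p/p = 1\<close>. It is negative at small multiples of a bump supported where \<open>q < min p\<close>. Hence a
  minimizer satisfies the constraint strictly, is nonzero, and solves the Euler--Lagrange equation.
  No weak compactness is needed for its existence: a minimizing sequence converges strongly in
  \<open>L\<^sup>q\<close> by compactness, and since midpoints are admissible too, the defect in the convexity of
  \<open>\<integral>\<bar>\<nabla>u\<bar>\<^sup>p/p\<close> tends to zero, so uniform convexity makes the gradients a Cauchy sequence.\<close>

section \<open>Pointwise inequalities for powers\<close>

text \<open>At some points q may exceed p, so the energy need not be bounded below on the whole
  space; this is why the minimization is confined to \<open>Phi G \<le> 1\<close>. The Sobolev
  estimate is delicate for exponents that are merely continuous, but strict subcriticality makes it
  local: near each point p and q can be replaced by constants P below p and R above q that are still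
  strictly subcritical, and finitely many such neighbourhoods cover the closure. The local estimate
  comes from comparing a function with its averages over small balls. The analysis uses modulars and
  test functions. Luxemburg norms enter only because convergence to zero means the same for both,
  and minimality passes from test functions to the closure by strong convergence. That passage, like
  the first variation, requires the constraint to hold strictly at the minimizer. The range of
  \<open>lam\<close> is chosen for this: if \<open>Psi \<le> C\<close> under the constraint, a
  negative minimum m gives \<open>Phi G = m + lam * Psi u < lam * (C + 1) < 1\<close>.\<close>

lemma powr_mvt:
  fixes u v p :: real
  assumes "0 \<le> u" "u < v" "0 < p"
  obtains \<xi> where "u < \<xi>" "\<xi> < v" "v powr p - u powr p = (v - u) * (p * \<xi> powr (p - 1))"
proof -
  have "continuous_on {u..v} (\<lambda>t. t powr p)"
    using assms by (intro continuous_on_powr') auto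
  moreover have "((\<lambda>t. t powr p) has_derivative (\<lambda>h. h * (p * t powr (p - 1)))) (at t)"
    if "u < t" "t < v" for t
    using has_real_derivative_powr[of t p] that \<open>0 \<le> u\<close>
    by (simp add: has_field_derivative_def mult_commute_abs)
  ultimately show ?thesis
    using mvt[OF \<open>u < v\<close>, of "\<lambda>t. t powr p" "\<lambda>t h. h * (p * t powr (p - 1))" thesis] that by simp
qed

lemma powr_diff_bound:
  fixes x y p :: real
  assumes "0 \<le> x" "0 \<le> y" "1 \<le> p"
  shows "\<bar>x powr p - y powr p\<bar> \<le> p * \<bar>x - y\<bar> * max x y powr (p - 1)"
proof -
  have *: "\<bar>x powr p - y powr p\<bar> \<le> p * \<bar>x - y\<bar> * max x y powr (p - 1)"
    if yx: "0 \<le> y" "y < x" for x y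
  proof -
    obtain \<xi> where \<xi>: "y < \<xi>" "\<xi> < x"
      "x powr p - y powr p = (x - y) * (p * \<xi> powr (p - 1))"
      by (rule powr_mvt[of y x p]) (use yx assms in auto)
    have "\<xi> powr (p - 1) \<le> x powr (p - 1)"
      using \<xi> yx assms by (intro powr_mono2) auto
    then have "(x - y) * (p * \<xi> powr (p - 1)) \<le> (x - y) * (p * x powr (p - 1))"
      using yx assms by (intro mult_left_mono) auto
    moreover have "0 \<le> (x - y) * (p * \<xi> powr (p - 1))"
      using yx assms by simp
    ultimately show ?thesis
      using \<xi> yx by (simp add: max_def mult_ac)
  qed
  consider "x < y" | "x = y" | "y < x" by linarith
  then show ?thesis
  proof cases
    case 1 then show ?thesis using *[of x y] assms by (simp add: abs_minus_commute max.commute)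
  next
    case 3 then show ?thesis using *[of y x] assms by simp
  qed auto
qed

lemma norm_add_powr_le:
  fixes a b :: "'a::real_normed_vector"
  assumes "0 \<le> p"
  shows "norm (a + b) powr p \<le> 2 powr p * (norm a powr p + norm b powr p)"
proof -
  have "norm (a + b) \<le> 2 * max (norm a) (norm b)"
    using norm_triangle_ineq[of a b] by linarith
  then have "norm (a + b) powr p \<le> (2 * max (norm a) (norm b)) powr p"
    using assms by (intro powr_mono2) auto
  also have "\<dots> = 2 powr p * max (norm a) (norm b) powr p"
    by (simp add: powr_mult)
  also have "\<dots> \<le> 2 powr p * (norm a powr p + norm b powr p)"
    by (simp add: max_def)
  finally show ?thesis .
qed

text \<open>The convergence of powers in L^1 rests on this splitting. If |a - b| \<le> \<eta> |b|,
  the mean value bound gives a small multiple of |b|^p; otherwise both norms are at most (1 +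
  1/\<eta>) |a - b|. The constant has to serve all exponents in [1, hi] at once, because p varies
  with the point.\<close>

lemma norm_powr_diff_eps:
  fixes \<epsilon> hi :: real
  assumes "0 < \<epsilon>"
  obtains C where "0 \<le> C"
    "\<And>p (a::'a::real_normed_vector) b. 1 \<le> p \<Longrightarrow> p \<le> hi \<Longrightarrow>
       \<bar>norm a powr p - norm b powr p\<bar> \<le> \<epsilon> * norm b powr p + C * norm (a - b) powr p"
proof -
  define H where "H = max hi 1"
  \<comment> \<open>Small enough to absorb the factor p 2^(p-1) of the first case, which is at most
    H 2^H.\<close>
  define \<eta> where "\<eta> = min 1 (\<epsilon> / (H * 2 powr H))"
  have H: "1 \<le> H" by (simp add: H_def)
  have \<eta>: "0 < \<eta>" "\<eta> \<le> 1" "\<eta> * (H * 2 powr H) \<le> \<epsilon>"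
    using assms H by (auto simp: \<eta>_def min_def divide_simps mult_ac split: if_splits)
  show ?thesis
  proof (rule that[of "(1 + 1 / \<eta>) powr H"])
    fix p and a b :: 'a
    assume p: "1 \<le> p" "p \<le> hi"
    then have pH: "p \<le> H" by (simp add: H_def)
    have tri: "norm a \<le> norm b + norm (a - b)"
      by (metis add_diff_cancel_left' diff_add_cancel norm_triangle_ineq)
    show "\<bar>norm a powr p - norm b powr p\<bar>
      \<le> \<epsilon> * norm b powr p + (1 + 1 / \<eta>) powr H * norm (a - b) powr p"
    proof (cases "norm (a - b) \<le> \<eta> * norm b")
      case True
      then have m: "max (norm a) (norm b) \<le> 2 * norm b"
        using tri mult_right_mono[OF \<eta>(2), of "norm b"] by force
      have "\<bar>norm a powr p - norm b powr p\<bar>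
        \<le> p * \<bar>norm a - norm b\<bar> * max (norm a) (norm b) powr (p - 1)"
        using p by (intro powr_diff_bound) auto
      also have "\<dots> \<le> H * (\<eta> * norm b) * (2 * norm b) powr (p - 1)"
        using True p pH m norm_triangle_ineq3[of a b] \<eta>
        by (intro mult_mono powr_mono2) (auto simp: le_max_iff_disj)
      also have "\<dots> = \<eta> * (H * 2 powr (p - 1)) * (norm b * norm b powr (p - 1))"
        by (simp add: powr_mult)
      also have "norm b * norm b powr (p - 1) = norm b powr p"
        using powr_add[of "norm b" 1 "p - 1"] by (cases "b = 0") auto
      also have "\<eta> * (H * 2 powr (p - 1)) * norm b powr p \<le> \<eta> * (H * 2 powr H) * norm b powr p"
        using \<eta> H pH by (intro mult_right_mono mult_left_mono powr_mono) auto
      also have "\<dots> \<le> \<epsilon> * norm b powr p"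
        using \<eta> by (intro mult_right_mono) auto
      finally show ?thesis by (simp add: add_increasing2)
    next
      case False
      then have "norm b \<le> norm (a - b) / \<eta>"
        using \<eta> by (simp add: pos_le_divide_eq mult.commute)
      then have b: "norm b \<le> (1 + 1 / \<eta>) * norm (a - b)"
           and a: "norm a \<le> (1 + 1 / \<eta>) * norm (a - b)"
        using tri by (auto simp: algebra_simps intro: order_trans)
      have *: "t powr p \<le> (1 + 1 / \<eta>) powr H * norm (a - b) powr p"
        if "0 \<le> t" "t \<le> (1 + 1 / \<eta>) * norm (a - b)" for t
      proof -
        have "t powr p \<le> ((1 + 1 / \<eta>) * norm (a - b)) powr p"
          using that p by (intro powr_mono2) auto
        also have "\<dots> = (1 + 1 / \<eta>) powr p * norm (a - b) powr p"
          using \<eta> by (simp add: powr_mult)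
        also have "\<dots> \<le> (1 + 1 / \<eta>) powr H * norm (a - b) powr p"
          using \<eta> pH by (intro mult_right_mono powr_mono) auto
        finally show ?thesis .
      qed
      have "0 \<le> \<epsilon> * norm b powr p" using assms by simp
      moreover have "0 \<le> norm a powr p" "0 \<le> norm b powr p" by auto
      ultimately show ?thesis
        using *[OF _ a] *[OF _ b] norm_ge_zero[of a] norm_ge_zero[of b] by linarith
    qed
  qed simp
qed

section \<open>Strict and uniform convexity of powers of a norm\<close>

lemma powr_midpoint_less:
  fixes x y p :: real
  assumes "0 \<le> x" "0 \<le> y" "x \<noteq> y" "1 < p"
  shows "((x + y) / 2) powr p < (x powr p + y powr p) / 2"
proof -
  have *: "((x + y) / 2) powr p < (x powr p + y powr p) / 2" if xy: "0 \<le> x" "x < y" for x y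
  proof -
    define m where "m = (x + y) / 2"
    have m: "x < m" "m < y" using that by (auto simp: m_def)
    obtain \<xi> where \<xi>: "x < \<xi>" "\<xi> < m" "m powr p - x powr p = (m - x) * (p * \<xi> powr (p - 1))"
      by (rule powr_mvt[of x m p]) (use m xy assms in auto)
    obtain \<zeta> where \<zeta>: "m < \<zeta>" "\<zeta> < y" "y powr p - m powr p = (y - m) * (p * \<zeta> powr (p - 1))"
      by (rule powr_mvt[of m y p]) (use m xy assms in auto)
    \<comment> \<open>The two halves of the interval have equal length, so the strictly increasing
      derivative makes the increment over the upper half the larger one.\<close>
    have "\<xi> powr (p - 1) < \<zeta> powr (p - 1)"
      using \<xi> \<zeta> xy assms by (intro powr_less_mono2) auto
    moreover have "y - m = m - x" by (simp add: m_def field_simps)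
    ultimately have "m powr p - x powr p < y powr p - m powr p"
      using \<xi> \<zeta> m assms by simp
    then show ?thesis by (simp add: m_def)
  qed
  show ?thesis
    using *[of x y] *[of y x] assms by (cases "x < y") (auto simp: add.commute)
qed

lemma powr_midpoint_le:
  fixes x y p :: real
  assumes "0 \<le> x" "0 \<le> y" "1 < p"
  shows "((x + y) / 2) powr p \<le> (x powr p + y powr p) / 2"
  using powr_midpoint_less[OF assms(1,2) _ assms(3)] by (cases "x = y") auto

lemma norm_midpoint_powr_le:
  fixes a b :: "'a::real_normed_vector"
  assumes "1 < p"
  shows "norm ((1/2) *\<^sub>R (a + b)) powr p \<le> (norm a powr p + norm b powr p) / 2"
proof -
  have "norm ((1/2) *\<^sub>R (a + b)) \<le> (norm a + norm b) / 2"
    using norm_triangle_ineq[of a b] by simp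
  then have "norm ((1/2) *\<^sub>R (a + b)) powr p \<le> ((norm a + norm b) / 2) powr p"
    using assms by (intro powr_mono2) auto
  also have "\<dots> \<le> (norm a powr p + norm b powr p) / 2"
    using assms by (intro powr_midpoint_le) auto
  finally show ?thesis .
qed

text \<open>Strictness has two sources. If the norms differ, the scalar power is strictly convex; if
  they agree, the vectors are not positively parallel and the triangle inequality of the inner
  product norm is strict.\<close>

lemma norm_midpoint_powr_less:
  fixes a b :: "'a::real_inner"
  assumes "1 < p" "a \<noteq> b"
  shows "norm ((1/2) *\<^sub>R (a + b)) powr p < (norm a powr p + norm b powr p) / 2"
proof -
  have le: "norm ((1/2) *\<^sub>R (a + b)) \<le> (norm a + norm b) / 2"
    using norm_triangle_ineq[of a b] by simp
  show ?thesis
  proof (cases "norm a = norm b")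
    case False
    have "norm ((1/2) *\<^sub>R (a + b)) powr p \<le> ((norm a + norm b) / 2) powr p"
      using assms le by (intro powr_mono2) auto
    also have "\<dots> < (norm a powr p + norm b powr p) / 2"
      using assms False by (intro powr_midpoint_less) auto
    finally show ?thesis .
  next
    case True
    have "norm (a + b) \<noteq> norm a + norm b"
      using assms(2) True by (metis norm_triangle_eq norm_eq_zero real_vector.scale_left_imp_eq)
    then have "norm (a + b) < norm a + norm b"
      using norm_triangle_ineq[of a b] by simp
    then have "norm ((1/2) *\<^sub>R (a + b)) < norm b"
      using True by simp
    then show ?thesis
      using assms True by (simp add: powr_less_mono2)
  qed
qed

text \<open>By homogeneity the convexity defect only has to be bounded below on a compact set.\<close>

lemma norm_powr_uniformly_convex:
  fixes \<epsilon> lo hi :: real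
  assumes "1 < lo" "0 < \<epsilon>"
  obtains C where "0 \<le> C"
    "\<And>p (a::'a::euclidean_space) b. lo \<le> p \<Longrightarrow> p \<le> hi \<Longrightarrow> norm (a - b) powr p \<le>
       \<epsilon> * (norm a powr p + norm b powr p)
       + C * ((norm a powr p + norm b powr p) / 2 - norm ((1/2) *\<^sub>R (a + b)) powr p)"
proof -
  define \<eta> where "\<eta> = min 1 (\<epsilon> / 2 powr hi)"
  have \<eta>: "0 < \<eta>" "\<eta> \<le> 1" "\<eta> * 2 powr hi \<le> \<epsilon>"
    using assms by (auto simp: \<eta>_def min_def divide_simps mult_ac split: if_splits)
  \<comment> \<open>The exponent is a coordinate of the compact set, so the lower bound for the
    defect is uniform in p. Nearly equal pairs are cut out because the defect vanishes on the
    diagonal; the \<epsilon> term pays for them.\<close>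
  define S where "S = {z :: ('a \<times> 'a) \<times> real. norm (fst (fst z)) + norm (snd (fst z)) = 1
    \<and> \<eta> \<le> norm (fst (fst z) - snd (fst z))} \<inter> (UNIV \<times> {lo..hi})"
  define F where "F z = (norm (fst (fst z)) powr snd z + norm (snd (fst z)) powr snd z) / 2
     - norm ((1/2) *\<^sub>R (fst (fst z) + snd (fst z))) powr snd z" for z :: "('a \<times> 'a) \<times> real"
  have "compact S"
  proof -
    have "S = ((cball 0 1 \<times> cball 0 1) \<times> {lo..hi}) \<inter>
        {z. norm (fst (fst z)) + norm (snd (fst z)) = 1 \<and> \<eta> \<le> norm (fst (fst z) - snd (fst z))}"
      using norm_ge_zero by (auto simp: S_def) (smt (verit) norm_ge_zero)+
    moreover have "closed {z::('a \<times> 'a) \<times> real. norm (fst (fst z)) + norm (snd (fst z)) = 1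
         \<and> \<eta> \<le> norm (fst (fst z) - snd (fst z))}"
      by (intro closed_Collect_conj closed_Collect_eq closed_Collect_le continuous_intros)
    ultimately show ?thesis
      by (auto intro!: compact_Int_closed compact_Times)
  qed
  moreover have "continuous_on S F"
    unfolding F_def using assms
    by (intro continuous_on_diff continuous_on_divide continuous_on_add continuous_on_powr'
        continuous_intros) (auto simp: S_def)
  moreover have Fpos: "0 < F z" if "z \<in> S" for z
  proof -
    have "fst (fst z) \<noteq> snd (fst z)" "1 < snd z" using that \<eta> assms by (auto simp: S_def)
    then show ?thesis
      using norm_midpoint_powr_less[of "snd z" "fst (fst z)" "snd (fst z)"] by (simp add: F_def)
  qed
  \<comment> \<open>\<open>S\<close> can be empty, and then any positive number serves as
    \<delta>.\<close>
  ultimately obtain \<delta> where \<delta>: "0 < \<delta>" "\<And>z. z \<in> S \<Longrightarrow> \<delta> \<le> F z"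
    using continuous_attains_inf[of S F] by (cases "S = {}") (blast intro: that[of 1] zero_less_one, metis)
  show ?thesis
  proof (rule that[of "1 / \<delta>"])
    show "0 \<le> 1 / \<delta>" using \<delta> by simp
    fix p and a b :: 'a
    assume p: "lo \<le> p" "p \<le> hi"
    let ?D = "(norm a powr p + norm b powr p) / 2 - norm ((1/2) *\<^sub>R (a + b)) powr p"
    have D0: "0 \<le> ?D" using norm_midpoint_powr_le[of p a b] p assms by simp
    show "norm (a - b) powr p \<le> \<epsilon> * (norm a powr p + norm b powr p) + 1 / \<delta> * ?D"
    proof (cases "norm (a - b) < \<eta> * (norm a + norm b)")
      case True
      have "norm (a - b) powr p \<le> (\<eta> * (norm a + norm b)) powr p"
        using True p assms by (intro powr_mono2) auto
      also have "\<dots> = \<eta> powr p * (norm a + norm b) powr p"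
        using \<eta> by (simp add: powr_mult)
      also have "\<dots> \<le> \<eta> powr 1 * (2 powr p * (norm a powr p + norm b powr p))"
        using \<eta> p assms norm_add_powr_le[of p "norm a" "norm b"]
        by (intro mult_mono powr_mono') auto
      also have "\<dots> \<le> \<eta> * (2 powr hi * (norm a powr p + norm b powr p))"
        using \<eta> p by (auto intro!: mult_left_mono mult_right_mono powr_mono)
      also have "\<dots> \<le> \<epsilon> * (norm a powr p + norm b powr p)"
        using \<eta> mult_right_mono[OF \<eta>(3), of "norm a powr p + norm b powr p"] by (simp add: mult_ac)
      finally show ?thesis using D0 \<delta> by (simp add: add_increasing2)
    next
      case False
      \<comment> \<open>Division by s moves the pair into \<open>S\<close>, and the defect is
        homogeneous of degree p.\<close>
      define s where "s = norm a + norm b"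
      show ?thesis
      proof (cases "s = 0")
        case True
        then have "a = 0" "b = 0" unfolding s_def
          by (metis add_nonneg_eq_0_iff norm_eq_zero norm_ge_zero)+
        then show ?thesis by simp
      next
        case s: False
        then have s: "0 < s" by (simp add: s_def less_le add_nonneg_nonneg)
        define z where "z = ((a /\<^sub>R s, b /\<^sub>R s), p)"
        have "norm (a /\<^sub>R s - b /\<^sub>R s) = norm (a - b) / s"
          using s by (simp flip: scaleR_diff_right add: divide_inverse mult.commute)
        moreover have "norm (a /\<^sub>R s) + norm (b /\<^sub>R s) = 1"
          using s by (simp add: s_def flip: distrib_left)
        ultimately have "z \<in> S"
          using False s p by (simp add: S_def z_def s_def pos_le_divide_eq)
        then have "\<delta> \<le> F z" by (rule \<delta>)
        also have "F z = ?D / s powr p"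
        proof -
          have "norm (c /\<^sub>R s) powr p = norm c powr p / s powr p" for c :: 'a
          proof -
            have "norm (c /\<^sub>R s) = norm c / s" using s by (simp add: divide_inverse mult.commute)
            then show ?thesis using s by (simp add: powr_divide)
          qed
          moreover have "(1/2) *\<^sub>R (a /\<^sub>R s + b /\<^sub>R s) = ((1/2) *\<^sub>R (a + b)) /\<^sub>R s"
            by (simp add: scaleR_add_right mult.commute)
          ultimately show ?thesis
            unfolding F_def z_def fst_conv snd_conv
            by (simp only: diff_divide_distrib add_divide_distrib) simp
        qed
        finally have "\<delta> * s powr p \<le> ?D" using s by (simp add: pos_le_divide_eq)
        moreover have "norm (a - b) powr p \<le> s powr p"
          using p assms norm_triangle_ineq4[of a b] by (intro powr_mono2) (auto simp: s_def)
        ultimately have "norm (a - b) powr p \<le> 1 / \<delta> * ?D"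
          using \<delta> order_trans[OF mult_left_mono[of "norm (a - b) powr p" "s powr p" \<delta>]]
          by (simp add: pos_le_divide_eq mult.commute del: scaleR_add_right)
        then show ?thesis using assms by (simp add: add_increasing)
      qed
    qed
  qed
qed

text \<open>This is the derivative of |a + t b|^p / p at t = 0. For a \<noteq> 0 it is the chain
  rule for (v \<bullet> v)^(p/2). At a = 0 the quotient is of size |h|^(p-1), which tends to 0
  because p > 1, and the right-hand side is 0 as well.\<close>

lemma norm_powr_quotient_tendsto:
  fixes a b :: "'a::real_inner"
  assumes p: "1 < p" and h: "h \<longlonglongrightarrow> 0" "\<And>n. h n \<noteq> 0"
  shows "(\<lambda>n. (norm (a + h n *\<^sub>R b) powr p - norm a powr p) / (p * h n))
    \<longlonglongrightarrow> norm a powr (p - 2) * (a \<bullet> b)"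
proof (cases "a = 0")
  case True
  have "(\<lambda>n. \<bar>h n\<bar> powr (p - 1) * (norm b powr p / p)) \<longlonglongrightarrow> 0 * (norm b powr p / p)"
    using p h(1) by (intro tendsto_mult tendsto_zero_powrI[of _ _ _ "p - 1"] tendsto_rabs_zero) auto
  moreover have "\<bar>h n\<bar> powr (p - 1) * (norm b powr p / p) =
      norm ((norm (a + h n *\<^sub>R b) powr p - norm a powr p) / (p * h n))" for n
    using True p h(2)[of n] powr_diff[of "\<bar>h n\<bar>" p 1]
    by (simp add: powr_mult abs_mult field_simps)
  ultimately have "(\<lambda>n. norm ((norm (a + h n *\<^sub>R b) powr p - norm a powr p) / (p * h n))) \<longlonglongrightarrow> 0"
    by simp
  then have "(\<lambda>n. (norm (a + h n *\<^sub>R b) powr p - norm a powr p) / (p * h n)) \<longlonglongrightarrow> 0"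
    by (rule tendsto_norm_zero_cancel)
  then show ?thesis using True by simp
next
  case False
  let ?f = "\<lambda>t. ((a + t *\<^sub>R b) \<bullet> (a + t *\<^sub>R b)) powr (p / 2)"
  have sq: "(v \<bullet> v) powr r = norm v powr (2 * r)" for v :: 'a and r
    by (cases "v = 0") (simp_all add: dot_square_norm powr_powr flip: powr_numeral)
  have feq: "?f t = norm (a + t *\<^sub>R b) powr p" for t
    by (simp add: sq)
  have "(a + 0 *\<^sub>R b) \<bullet> (a + 0 *\<^sub>R b) > 0" using False by simp
  moreover have "((\<lambda>t. a \<bullet> a + 2 * t * (a \<bullet> b) + t * t * (b \<bullet> b)) has_real_derivative 2 * (a \<bullet> b)) (at 0)"
    by (auto intro!: derivative_eq_intros)
  then have "((\<lambda>t. (a + t *\<^sub>R b) \<bullet> (a + t *\<^sub>R b)) has_real_derivative 2 * (a \<bullet> b)) (at 0)"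
    by (simp add: inner_simps inner_commute algebra_simps)
  ultimately have "(?f has_real_derivative
      (p/2) * ((a + 0 *\<^sub>R b) \<bullet> (a + 0 *\<^sub>R b)) powr (p/2 - 1) * (2 * (a \<bullet> b))) (at 0)"
    using has_real_derivative_powr[of "(a + 0 *\<^sub>R b) \<bullet> (a + 0 *\<^sub>R b)" "p/2"]
    by (intro DERIV_chain2[where f="\<lambda>x. x powr (p/2)" and g="\<lambda>t. (a + t *\<^sub>R b) \<bullet> (a + t *\<^sub>R b)"])
  moreover have "(p/2) * ((a + 0 *\<^sub>R b) \<bullet> (a + 0 *\<^sub>R b)) powr (p/2 - 1) * (2 * (a \<bullet> b))
       = p * (norm a powr (p - 2) * (a \<bullet> b))"
    by (simp add: sq right_diff_distrib)
  ultimately have "(?f has_real_derivative p * (norm a powr (p - 2) * (a \<bullet> b))) (at 0)"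
    by metis
  then have "(\<lambda>t. (?f t - ?f 0) / t) \<midarrow>0\<rightarrow> p * (norm a powr (p - 2) * (a \<bullet> b))"
    by (simp add: has_field_derivative_iff)
  then have "(\<lambda>n. (?f (h n) - ?f 0) / h n) \<longlonglongrightarrow> p * (norm a powr (p - 2) * (a \<bullet> b))"
    by (rule tendsto_compose_eventually[OF _ h(1)]) (simp add: h(2))
  then have "(\<lambda>n. (?f (h n) - ?f 0) / h n / p) \<longlonglongrightarrow> p * (norm a powr (p - 2) * (a \<bullet> b)) / p"
    using p by (intro tendsto_divide) auto
  then show ?thesis using p feq[of 0] by (simp add: feq mult.commute)
qed

text \<open>The majorant for dominated convergence, independent of t: in the mean value bound both
  norms are at most s = |a| + |b|, and the factor |t| of the increment cancels the divisor.\<close>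

lemma norm_powr_quotient_bound:
  fixes a b :: "'a::real_inner"
  assumes p: "1 < p" and t: "\<bar>t\<bar> \<le> 1"
  shows "\<bar>(norm (a + t *\<^sub>R b) powr p - norm a powr p) / (p * t)\<bar> \<le> 2 powr p * (norm a powr p + norm b powr p)"
proof (cases "t = 0")
  case False
  define s where "s = norm a + norm b"
  have "norm (a + t *\<^sub>R b) \<le> norm a + \<bar>t\<bar> * norm b"
    using norm_triangle_ineq[of a "t *\<^sub>R b"] by simp
  moreover have "\<bar>t\<bar> * norm b \<le> norm b" using t by (simp add: mult_left_le_one_le)
  ultimately have m: "max (norm (a + t *\<^sub>R b)) (norm a) \<le> s" by (simp add: s_def)
  have "\<bar>norm (a + t *\<^sub>R b) - norm a\<bar> \<le> \<bar>t\<bar> * norm b"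
    using norm_triangle_ineq3[of "a + t *\<^sub>R b" a] by simp
  moreover have "\<bar>t\<bar> * norm b \<le> \<bar>t\<bar> * s" by (simp add: s_def mult_left_mono)
  ultimately have d: "\<bar>norm (a + t *\<^sub>R b) - norm a\<bar> \<le> \<bar>t\<bar> * s" by linarith
  have "\<bar>norm (a + t *\<^sub>R b) powr p - norm a powr p\<bar> \<le>
     p * \<bar>norm (a + t *\<^sub>R b) - norm a\<bar> * max (norm (a + t *\<^sub>R b)) (norm a) powr (p - 1)"
    using p by (intro powr_diff_bound) auto
  also have "\<dots> \<le> p * (\<bar>t\<bar> * s) * s powr (p - 1)"
    using p m d by (intro mult_mono powr_mono2) (auto simp: s_def le_max_iff_disj)
  also have "\<dots> = p * \<bar>t\<bar> * s powr p"
    using powr_add[of s 1 "p - 1"] by (cases "s = 0") (auto simp: s_def)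
  also have "s powr p \<le> 2 powr p * (norm a powr p + norm b powr p)"
    using norm_add_powr_le[of p "norm a" "norm b"] p by (simp add: s_def)
  finally have "\<bar>norm (a + t *\<^sub>R b) powr p - norm a powr p\<bar> \<le>
     p * \<bar>t\<bar> * (2 powr p * (norm a powr p + norm b powr p))" using p by (simp add: mult_left_mono)
  then show ?thesis using p False by (simp add: abs_mult divide_le_eq mult_ac)
qed simp

section \<open>Modulars with variable exponent\<close>

text \<open>One locale carries both exponents of the problem. The constants \<open>lo\<close> and
  \<open>hi\<close> will be the minimum and the maximum of the exponent; they turn pointwise powers
  into powers with a constant exponent when functions are rescaled.\<close>

locale variable_exponent = finite_measure M for M :: "'a measure" +
  fixes e :: "'a \<Rightarrow> real" and lo hi :: real
  assumes exponent_measurable [measurable]: "e \<in> borel_measurable M"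
    and lo_gt_1: "1 < lo"
    and exponent_bounds: "x \<in> space M \<Longrightarrow> lo \<le> e x" "x \<in> space M \<Longrightarrow> e x \<le> hi"
    and lo_le_hi: "lo \<le> hi"
begin

text \<open>Values lie in an arbitrary Euclidean space, so that a function and its gradient are
  covered by the same lemmas.\<close>

definition Lvar :: "('a \<Rightarrow> 'b::euclidean_space) \<Rightarrow> bool" where
  "Lvar F \<longleftrightarrow> F \<in> borel_measurable M \<and> integrable M (\<lambda>x. norm (F x) powr e x)"

text \<open>The modular replaces the norm throughout. It is not homogeneous and its triangle
  inequality costs a factor 2^hi, but it is a plain integral, to which convexity and the limit
  theorems apply directly.\<close>

definition rho :: "('a \<Rightarrow> 'b::euclidean_space) \<Rightarrow> real" where
  "rho F = (\<integral>x. norm (F x) powr e x \<partial>M)"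

lemma Lvar_measurable: "Lvar F \<Longrightarrow> F \<in> borel_measurable M"
  by (simp add: Lvar_def)

lemma Lvar_integrable: "Lvar F \<Longrightarrow> integrable M (\<lambda>x. norm (F x) powr e x)"
  by (simp add: Lvar_def)

lemma rho_nonneg: "0 \<le> rho F"
  by (simp add: rho_def)

lemma LvarI:
  assumes "F \<in> borel_measurable M" "integrable M g" "AE x in M. norm (F x) powr e x \<le> g x"
  shows "Lvar F"
  unfolding Lvar_def
proof
  show "integrable M (\<lambda>x. norm (F x) powr e x)"
  proof (rule Bochner_Integration.integrable_bound[OF assms(2)])
    show "AE x in M. norm (norm (F x) powr e x) \<le> norm (g x)"
      using assms(3) by eventually_elim auto
    show "(\<lambda>x. norm (F x) powr e x) \<in> borel_measurable M" using assms(1) by measurable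
  qed
qed fact

lemma Lvar_bounded:
  assumes "F \<in> borel_measurable M" "\<And>x. x \<in> space M \<Longrightarrow> norm (F x) \<le> B"
  shows "Lvar F"
proof (rule LvarI)
  show "integrable M (\<lambda>x. max B 1 powr hi)" by simp
  show "AE x in M. norm (F x) powr e x \<le> max B 1 powr hi"
  proof (rule AE_I2)
    fix x assume x: "x \<in> space M"
    have "norm (F x) powr e x \<le> max B 1 powr e x"
      using assms(2)[OF x] exponent_bounds[OF x] lo_gt_1 by (intro powr_mono2) auto
    also have "\<dots> \<le> max B 1 powr hi" using exponent_bounds[OF x] by (intro powr_mono) auto
    finally show "norm (F x) powr e x \<le> max B 1 powr hi" .
  qed
qed fact

lemma powr_exponent_add_le:
  assumes "x \<in> space M"
  shows "norm (u + v) powr e x \<le> 2 powr hi * (norm u powr e x + norm v powr e x)"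
proof -
  have "norm (u + v) powr e x \<le> 2 powr e x * (norm u powr e x + norm v powr e x)"
    using exponent_bounds[OF assms] lo_gt_1 by (intro norm_add_powr_le) auto
  also have "\<dots> \<le> 2 powr hi * (norm u powr e x + norm v powr e x)"
    using exponent_bounds[OF assms] by (intro mult_right_mono powr_mono) auto
  finally show ?thesis .
qed

lemma Lvar_add:
  assumes "Lvar F" "Lvar G" shows "Lvar (\<lambda>x. F x + G x)"
  using assms
  by (intro LvarI[where g="\<lambda>x. 2 powr hi * (norm (F x) powr e x + norm (G x) powr e x)"])
    (auto simp: Lvar_def intro!: powr_exponent_add_le)

lemma rho_add_le:
  assumes "Lvar F" "Lvar G" shows "rho (\<lambda>x. F x + G x) \<le> 2 powr hi * (rho F + rho G)"
proof -
  have "rho (\<lambda>x. F x + G x) \<le> (\<integral>x. 2 powr hi * (norm (F x) powr e x + norm (G x) powr e x) \<partial>M)"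
    unfolding rho_def using assms Lvar_add[OF assms]
    by (intro integral_mono) (auto simp: Lvar_def intro!: powr_exponent_add_le)
  then show ?thesis using assms by (simp add: rho_def Lvar_def)
qed

lemma powr_exponent_scale_le:
  assumes "x \<in> space M" "\<bar>c\<bar> \<le> C" "1 \<le> C"
  shows "norm (c *\<^sub>R u) powr e x \<le> C powr hi * norm u powr e x"
proof -
  have "norm (c *\<^sub>R u) powr e x = \<bar>c\<bar> powr e x * norm u powr e x"
    by (simp add: powr_mult)
  also have "\<dots> \<le> C powr e x * norm u powr e x"
    using assms exponent_bounds[OF assms(1)] lo_gt_1
    by (intro mult_right_mono powr_mono2) auto
  also have "\<dots> \<le> C powr hi * norm u powr e x"
    using assms exponent_bounds[OF assms(1)] by (intro mult_right_mono powr_mono) auto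
  finally show ?thesis .
qed

lemma Lvar_scaleR:
  assumes "Lvar F" shows "Lvar (\<lambda>x. c *\<^sub>R F x)"
  using assms
  by (intro LvarI[where g="\<lambda>x. max \<bar>c\<bar> 1 powr hi * norm (F x) powr e x"])
    (auto simp: Lvar_def intro!: powr_exponent_scale_le[where C="max \<bar>c\<bar> 1", simplified])

lemma Lvar_minus: "Lvar F \<Longrightarrow> Lvar (\<lambda>x. - F x)"
  by (simp add: Lvar_def)

lemma Lvar_diff:
  assumes "Lvar F" "Lvar G" shows "Lvar (\<lambda>x. F x - G x)"
  using Lvar_add[OF assms(1) Lvar_minus[OF assms(2)]] by simp

lemma rho_minus [simp]: "rho (\<lambda>x. - F x) = rho F"
  by (simp add: rho_def)

lemma rho_diff_le:
  assumes "Lvar F" "Lvar G" shows "rho (\<lambda>x. F x - G x) \<le> 2 powr hi * (rho F + rho G)"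
  using rho_add_le[OF assms(1) Lvar_minus[OF assms(2)]] by simp

lemma rho_scaleR_le:
  assumes "Lvar F" "\<bar>c\<bar> \<le> C" "1 \<le> C"
  shows "rho (\<lambda>x. c *\<^sub>R F x) \<le> C powr hi * rho F"
proof -
  have "rho (\<lambda>x. c *\<^sub>R F x) \<le> (\<integral>x. C powr hi * norm (F x) powr e x \<partial>M)"
    unfolding rho_def using assms Lvar_scaleR[OF assms(1), of c]
    by (intro integral_mono) (auto simp del: norm_scaleR simp: Lvar_def intro!: powr_exponent_scale_le)
  then show ?thesis using assms by (simp add: rho_def Lvar_def)
qed

text \<open>For a factor at most 1 the lowest exponent gives the weakest decay. The rate matters:
  \<open>negative_energy\<close> compares t^lo with t^s for some s < lo.\<close>

lemma rho_scaleR_le_small: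
  assumes "Lvar F" "\<bar>c\<bar> \<le> 1"
  shows "rho (\<lambda>x. c *\<^sub>R F x) \<le> \<bar>c\<bar> powr lo * rho F"
proof -
  have "rho (\<lambda>x. c *\<^sub>R F x) \<le> (\<integral>x. \<bar>c\<bar> powr lo * norm (F x) powr e x \<partial>M)"
    unfolding rho_def
  proof (rule integral_mono)
    show "integrable M (\<lambda>x. norm (c *\<^sub>R F x) powr e x)"
      using Lvar_scaleR[OF assms(1), of c] by (simp add: Lvar_def)
    fix x assume x: "x \<in> space M"
    have "norm (c *\<^sub>R F x) powr e x = \<bar>c\<bar> powr e x * norm (F x) powr e x"
      by (simp add: powr_mult)
    also have "\<dots> \<le> \<bar>c\<bar> powr lo * norm (F x) powr e x"
      using assms exponent_bounds[OF x] lo_gt_1 by (intro mult_right_mono powr_mono') auto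
    finally show "norm (c *\<^sub>R F x) powr e x \<le> \<bar>c\<bar> powr lo * norm (F x) powr e x" .
  qed (use assms in \<open>simp add: Lvar_def\<close>)
  then show ?thesis using assms by (simp add: rho_def Lvar_def)
qed

text \<open>A substitute for Hoelder's inequality on a finite measure space. Values up to t are
  bounded by t; larger ones satisfy (|u|/t)^(e-1) \<ge> 1, hence |u| \<le> t^(1-e) |u|^e. With t
  chosen first, a small modular forces a small L^1 norm.\<close>

lemma powr_exponent_split:
  assumes "x \<in> space M" "0 < t" "t \<le> 1"
  shows "norm u \<le> t + t powr (1 - hi) * norm u powr e x"
proof (cases "norm u \<le> t")
  case False
  have e: "1 < e x" "e x \<le> hi" using exponent_bounds[OF assms(1)] lo_gt_1 by auto
  have "norm u = t powr (1 - e x) * t powr (e x - 1) * norm u"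
    using assms by (simp flip: powr_add)
  also have "\<dots> \<le> t powr (1 - hi) * norm u powr (e x - 1) * norm u"
    using assms e False by (intro mult_right_mono mult_mono powr_mono2 powr_mono') auto
  also have "\<dots> = t powr (1 - hi) * norm u powr e x"
    using powr_add[of "norm u" "e x - 1" 1] False assms by simp
  finally show ?thesis using assms by linarith
qed (use assms in \<open>auto intro: add_increasing2\<close>)

lemma Lvar_imp_integrable:
  assumes "Lvar F" shows "integrable M F"
proof (rule Bochner_Integration.integrable_bound)
  show "integrable M (\<lambda>x. 1 + 1 powr (1 - hi) * norm (F x) powr e x)"
    using assms by (simp add: Lvar_def)
  show "AE x in M. norm (F x) \<le> norm (1 + 1 powr (1 - hi) * norm (F x) powr e x)"
    using powr_exponent_split[of _ 1] by (intro AE_I2) fastforce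
qed (use assms in \<open>simp add: Lvar_def\<close>)

lemma integral_norm_le_rho:
  assumes "Lvar F" "0 < t" "t \<le> 1"
  shows "(\<integral>x. norm (F x) \<partial>M) \<le> t * measure M (space M) + t powr (1 - hi) * rho F"
proof -
  have "(\<integral>x. norm (F x) \<partial>M) \<le> (\<integral>x. t + t powr (1 - hi) * norm (F x) powr e x \<partial>M)"
    using assms Lvar_imp_integrable[OF assms(1)] powr_exponent_split[OF _ assms(2,3)]
    by (intro integral_mono) (auto simp: Lvar_def)
  also have "\<dots> = t * measure M (space M) + t powr (1 - hi) * rho F"
    using assms by (simp add: rho_def Lvar_def)
  finally show ?thesis .
qed

lemma rho_small_imp_L1_small:
  assumes \<epsilon>: "0 < \<epsilon>"
  obtains \<delta> where "0 < \<delta>"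
    "\<And>F :: 'a \<Rightarrow> 'b::euclidean_space. Lvar F \<Longrightarrow> rho F \<le> \<delta> \<Longrightarrow> (\<integral>x. norm (F x) \<partial>M) < \<epsilon>"
proof -
  define m where "m = measure M (space M)"
  have m: "0 \<le> m" by (simp add: m_def)
  define t where "t = min 1 (\<epsilon> / (2 * (m + 1)))"
  have t: "0 < t" "t \<le> 1" using \<epsilon> m by (auto simp: t_def)
  have "t * m \<le> \<epsilon> / (2 * (m + 1)) * m" using m by (intro mult_right_mono) (auto simp: t_def)
  also have "\<dots> < \<epsilon> / 2" using m \<epsilon> by (simp add: field_simps)
  finally have tm: "t * m < \<epsilon> / 2" .
  show ?thesis
  proof (rule that[of "\<epsilon> / (2 * t powr (1 - hi))"])
    show "0 < \<epsilon> / (2 * t powr (1 - hi))" using t \<epsilon> by simp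
    fix F :: "'a \<Rightarrow> 'b" assume F: "Lvar F" and le: "rho F \<le> \<epsilon> / (2 * t powr (1 - hi))"
    have "(\<integral>x. norm (F x) \<partial>M) \<le> t * m + t powr (1 - hi) * rho F"
      unfolding m_def by (rule integral_norm_le_rho[OF F t])
    also have "\<dots> \<le> t * m + t powr (1 - hi) * (\<epsilon> / (2 * t powr (1 - hi)))"
      using le by (intro add_left_mono mult_left_mono) auto
    also have "\<dots> < \<epsilon>" using tm t by simp
    finally show "(\<integral>x. norm (F x) \<partial>M) < \<epsilon>" .
  qed
qed

lemma rho_tendsto_0_imp_L1:
  fixes F :: "nat \<Rightarrow> 'a \<Rightarrow> 'b::euclidean_space"
  assumes L: "\<And>n. Lvar (F n)" and lim: "(\<lambda>n. rho (F n)) \<longlonglongrightarrow> 0"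
  shows "(\<lambda>n. \<integral>x. norm (F n x) \<partial>M) \<longlonglongrightarrow> 0"
proof (rule tendstoI)
  fix \<epsilon> :: real assume \<epsilon>: "0 < \<epsilon>"
  obtain \<delta> where \<delta>: "0 < \<delta>" "\<And>F :: 'a \<Rightarrow> 'b. Lvar F \<Longrightarrow> rho F \<le> \<delta> \<Longrightarrow> (\<integral>x. norm (F x) \<partial>M) < \<epsilon>"
    using rho_small_imp_L1_small[OF \<epsilon>] by blast
  have "\<forall>\<^sub>F n in sequentially. rho (F n) < \<delta>" by (rule order_tendstoD(2)[OF lim \<delta>(1)])
  then show "\<forall>\<^sub>F n in sequentially. dist (\<integral>x. norm (F n x) \<partial>M) 0 < \<epsilon>"
    by eventually_elim (simp add: \<delta>(2)[OF L])
qed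

lemma integrable_powr_diff:
  assumes "Lvar F" "Lvar G"
  shows "integrable M (\<lambda>x. \<bar>norm (F x) powr e x - norm (G x) powr e x\<bar>)"
  using assms by (simp add: Lvar_def)

text \<open>\<open>norm_powr_diff_eps\<close> is integrated with \<eta> small relative to the fixed
  number \<open>rho G\<close>; the term with the large constant disappears in the limit.\<close>

lemma rho_tendsto_0_imp_powr_L1:
  fixes F :: "nat \<Rightarrow> 'a \<Rightarrow> 'b::euclidean_space"
  assumes L: "\<And>n. Lvar (F n)" "Lvar G" and lim: "(\<lambda>n. rho (\<lambda>x. F n x - G x)) \<longlonglongrightarrow> 0"
  shows "(\<lambda>n. \<integral>x. \<bar>norm (F n x) powr e x - norm (G x) powr e x\<bar> \<partial>M) \<longlonglongrightarrow> 0"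
proof (rule tendstoI)
  fix \<epsilon> :: real assume \<epsilon>: "0 < \<epsilon>"
  define \<eta> where "\<eta> = \<epsilon> / (2 * (rho G + 1))"
  have \<eta>: "0 < \<eta>" "\<eta> * rho G \<le> \<epsilon> / 2"
    using \<epsilon> rho_nonneg[of G] by (auto simp: \<eta>_def field_simps)
  obtain C where C: "0 \<le> C" "\<And>p (a::'b) b. 1 \<le> p \<Longrightarrow> p \<le> hi \<Longrightarrow>
       \<bar>norm a powr p - norm b powr p\<bar> \<le> \<eta> * norm b powr p + C * norm (a - b) powr p"
    using norm_powr_diff_eps[OF \<eta>(1), of hi] by blast
  have D: "Lvar (\<lambda>x. F n x - G x)" for n using L by (intro Lvar_diff) auto
  have le: "(\<integral>x. \<bar>norm (F n x) powr e x - norm (G x) powr e x\<bar> \<partial>M)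
      \<le> \<eta> * rho G + C * rho (\<lambda>x. F n x - G x)" for n
  proof -
    have "(\<integral>x. \<bar>norm (F n x) powr e x - norm (G x) powr e x\<bar> \<partial>M)
      \<le> (\<integral>x. \<eta> * norm (G x) powr e x + C * norm (F n x - G x) powr e x \<partial>M)"
    proof (intro integral_mono integrable_powr_diff L Bochner_Integration.integrable_add
          integrable_mult_right Lvar_integrable D C)
      show "1 \<le> e x" "e x \<le> hi" if "x \<in> space M" for x
        using exponent_bounds[OF that] lo_gt_1 by auto
    qed
    then show ?thesis using D L by (simp add: rho_def Lvar_def)
  qed
  have "(\<lambda>n. C * rho (\<lambda>x. F n x - G x)) \<longlonglongrightarrow> C * 0" by (intro tendsto_intros lim)
  then have "\<forall>\<^sub>F n in sequentially. C * rho (\<lambda>x. F n x - G x) < \<epsilon> / 2"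
    using \<epsilon> by (intro order_tendstoD(2)[where a="\<epsilon>/2"]) auto
  then show "\<forall>\<^sub>F n in sequentially.
     dist (\<integral>x. \<bar>norm (F n x) powr e x - norm (G x) powr e x\<bar> \<partial>M) 0 < \<epsilon>"
  proof eventually_elim
    case (elim n)
    then show ?case using le[of n] \<eta> by (simp add: dist_norm)
  qed
qed

text \<open>Dividing by the exponent cancels the factor that differentiation brings down, so that
  the first variation of the energy is the weak form of the equation.\<close>

definition energy :: "('a \<Rightarrow> 'b::euclidean_space) \<Rightarrow> real" where
  "energy F = (\<integral>x. norm (F x) powr e x / e x \<partial>M)"

lemma divide_exponent_bounds:
  assumes "x \<in> space M" "0 \<le> c"
  shows "0 \<le> c / e x" "c / e x \<le> c" "c \<le> hi * (c / e x)"
proof -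
  have e: "1 < e x" "e x \<le> hi" using exponent_bounds[OF assms(1)] lo_gt_1 by auto
  show "0 \<le> c / e x" using e assms(2) by simp
  have "c * 1 \<le> c * e x" using e assms(2) by (intro mult_left_mono) auto
  then show "c / e x \<le> c" using e by (simp add: divide_le_eq)
  have "c * e x \<le> c * hi" using e assms(2) by (intro mult_left_mono) auto
  then show "c \<le> hi * (c / e x)" using e by (simp add: le_divide_eq mult.commute)
qed

lemma energy_integrable:
  assumes "Lvar F" shows "integrable M (\<lambda>x. norm (F x) powr e x / e x)"
proof (rule Bochner_Integration.integrable_bound[OF Lvar_integrable[OF assms]])
  show "(\<lambda>x. norm (F x) powr e x / e x) \<in> borel_measurable M"
    using Lvar_measurable[OF assms] by measurable
  show "AE x in M. norm (norm (F x) powr e x / e x) \<le> norm (norm (F x) powr e x)"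
    using divide_exponent_bounds(1,2)[OF _ powr_ge_zero]
    by (intro AE_I2) (simp only: real_norm_def abs_of_nonneg powr_ge_zero)
qed

lemma energy_nonneg: "0 \<le> energy F"
  unfolding energy_def
proof (rule Bochner_Integration.integral_nonneg)
  show "0 \<le> norm (F x) powr e x / e x" if "x \<in> space M" for x
    using exponent_bounds(1)[OF that] lo_gt_1 by simp
qed

lemma energy_le_rho:
  assumes "Lvar F" shows "energy F \<le> rho F"
  unfolding energy_def rho_def
proof (rule integral_mono[OF energy_integrable[OF assms] Lvar_integrable[OF assms]])
  show "norm (F x) powr e x / e x \<le> norm (F x) powr e x" if "x \<in> space M" for x
    using divide_exponent_bounds(2)[OF that] by simp
qed

lemma rho_le_energy:
  assumes "Lvar F" shows "rho F \<le> hi * energy F"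
proof -
  have "rho F \<le> (\<integral>x. hi * (norm (F x) powr e x / e x) \<partial>M)"
    unfolding rho_def
  proof (rule integral_mono[OF Lvar_integrable[OF assms]])
    show "integrable M (\<lambda>x. hi * (norm (F x) powr e x / e x))"
      by (intro integrable_mult_right energy_integrable assms)
    show "norm (F x) powr e x \<le> hi * (norm (F x) powr e x / e x)" if "x \<in> space M" for x
      using divide_exponent_bounds(3)[OF that] by simp
  qed
  then show ?thesis unfolding energy_def by (simp only: integral_mult_right_zero)
qed

lemma energy_tendsto:
  fixes F :: "nat \<Rightarrow> 'a \<Rightarrow> 'b::euclidean_space"
  assumes L: "\<And>n. Lvar (F n)" "Lvar G" and lim: "(\<lambda>n. rho (\<lambda>x. F n x - G x)) \<longlonglongrightarrow> 0"
  shows "(\<lambda>n. energy (F n)) \<longlonglongrightarrow> energy G"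
proof (rule Lim_transform2[OF tendsto_const], rule Lim_null_comparison)
  show "(\<lambda>n. \<integral>x. \<bar>norm (F n x) powr e x - norm (G x) powr e x\<bar> \<partial>M) \<longlonglongrightarrow> 0"
    by (rule rho_tendsto_0_imp_powr_L1) fact+
  show "\<forall>\<^sub>F n in sequentially. norm (energy G - energy (F n)) \<le>
     (\<integral>x. \<bar>norm (F n x) powr e x - norm (G x) powr e x\<bar> \<partial>M)"
  proof (rule always_eventually, rule allI)
    fix n
    have "norm (energy G - energy (F n)) =
       norm (\<integral>x. norm (G x) powr e x / e x - norm (F n x) powr e x / e x \<partial>M)"
      unfolding energy_def using L
      by (subst Bochner_Integration.integral_diff) (simp_all add: energy_integrable)
    also have "\<dots> \<le> (\<integral>x. \<bar>norm (F n x) powr e x - norm (G x) powr e x\<bar> \<partial>M)"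
    proof (rule order_trans[OF integral_norm_bound integral_mono])
      show "integrable M (\<lambda>x. norm (norm (G x) powr e x / e x - norm (F n x) powr e x / e x))"
        using L by (simp add: energy_integrable)
      show "integrable M (\<lambda>x. \<bar>norm (F n x) powr e x - norm (G x) powr e x\<bar>)"
        by (intro integrable_powr_diff L)
      show "norm (norm (G x) powr e x / e x - norm (F n x) powr e x / e x) \<le>
         \<bar>norm (F n x) powr e x - norm (G x) powr e x\<bar>" if "x \<in> space M" for x
        using divide_exponent_bounds(2)[OF that abs_ge_zero] exponent_bounds(1)[OF that] lo_gt_1
        by (simp flip: diff_divide_distrib add: abs_minus_commute)
    qed
    finally show "norm (energy G - energy (F n)) \<le>
     (\<integral>x. \<bar>norm (F n x) powr e x - norm (G x) powr e x\<bar> \<partial>M)" .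
  qed
qed

lemma energy_midpoint_le:
  assumes "Lvar F" "Lvar G"
  shows "energy (\<lambda>x. (1/2) *\<^sub>R (F x + G x)) \<le> (energy F + energy G) / 2"
proof -
  have "energy (\<lambda>x. (1/2) *\<^sub>R (F x + G x)) \<le>
     (\<integral>x. (norm (F x) powr e x / e x + norm (G x) powr e x / e x) / 2 \<partial>M)"
    unfolding energy_def[of "\<lambda>x. (1/2) *\<^sub>R (F x + G x)"]
  proof (intro integral_mono energy_integrable Lvar_scaleR Lvar_add assms)
    show "integrable M (\<lambda>x. (norm (F x) powr e x / e x + norm (G x) powr e x / e x) / 2)"
      using assms by (simp add: energy_integrable)
    fix x assume x: "x \<in> space M"
    have "norm ((1/2) *\<^sub>R (F x + G x)) powr e x / e x \<le> (norm (F x) powr e x + norm (G x) powr e x) / 2 / e x"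
      using exponent_bounds(1)[OF x] lo_gt_1 by (intro divide_right_mono norm_midpoint_powr_le) auto
    then show "norm ((1/2) *\<^sub>R (F x + G x)) powr e x / e x
       \<le> (norm (F x) powr e x / e x + norm (G x) powr e x / e x) / 2"
      by (simp add: add_divide_distrib mult.commute)
  qed
  also have "\<dots> = (energy F + energy G) / 2"
    using assms by (simp add: energy_def energy_integrable)
  finally show ?thesis .
qed

lemma energy_uniformly_convex:
  assumes "0 < \<epsilon>"
  obtains C where "0 \<le> C"
    "\<And>F G :: 'a \<Rightarrow> 'b::euclidean_space. Lvar F \<Longrightarrow> Lvar G \<Longrightarrow> rho (\<lambda>x. F x - G x) \<le>
       \<epsilon> * (rho F + rho G) + C * ((energy F + energy G) / 2 - energy (\<lambda>x. (1/2) *\<^sub>R (F x + G x)))"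
proof -
  obtain C where C: "0 \<le> C"
    "\<And>p (a::'b) b. lo \<le> p \<Longrightarrow> p \<le> hi \<Longrightarrow> norm (a - b) powr p \<le>
       \<epsilon> * (norm a powr p + norm b powr p)
       + C * ((norm a powr p + norm b powr p) / 2 - norm ((1/2) *\<^sub>R (a + b)) powr p)"
    using norm_powr_uniformly_convex[OF lo_gt_1 assms, of hi] by blast
  show ?thesis
  \<comment> \<open>The pointwise defect belongs to |F|^e, the energy to |F|^e / e. The defect is
    nonnegative, so passing from one to the other costs at most the factor
    \<open>hi\<close>.\<close>
  proof (rule that[of "C * hi"])
    show "0 \<le> C * hi" using C lo_gt_1 lo_le_hi by simp
    fix F G :: "'a \<Rightarrow> 'b" assume L: "Lvar F" "Lvar G"
    let ?m = "\<lambda>x. (1/2) *\<^sub>R (F x + G x)"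
    have Lm: "Lvar ?m" by (intro Lvar_scaleR Lvar_add L)
    let ?d = "\<lambda>x. (norm (F x) powr e x / e x + norm (G x) powr e x / e x) / 2 - norm (?m x) powr e x / e x"
    have id: "integrable M ?d" using L Lm by (simp only: energy_integrable Bochner_Integration.integrable_diff Bochner_Integration.integrable_add integrable_divide_zero)
    have "rho (\<lambda>x. F x - G x) \<le>
      (\<integral>x. \<epsilon> * (norm (F x) powr e x + norm (G x) powr e x) + C * hi * ?d x \<partial>M)"
      unfolding rho_def
    proof (rule integral_mono)
      show "integrable M (\<lambda>x. norm (F x - G x) powr e x)"
        by (intro Lvar_integrable Lvar_diff L)
      show "integrable M (\<lambda>x. \<epsilon> * (norm (F x) powr e x + norm (G x) powr e x) + C * hi * ?d x)"
        using L by (intro Bochner_Integration.integrable_add integrable_mult_right id Lvar_integrable)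
      fix x assume x: "x \<in> space M"
      have ex: "1 < e x" "e x \<le> hi" "lo \<le> e x" using exponent_bounds[OF x] lo_gt_1 by auto
      let ?D = "(norm (F x) powr e x + norm (G x) powr e x) / 2 - norm (?m x) powr e x"
      have D: "0 \<le> ?D" using norm_midpoint_powr_le[OF ex(1), of "F x" "G x"] by simp
      have "?D \<le> hi * (?D / e x)" using divide_exponent_bounds(3)[OF x D] .
      also have "?D / e x = ?d x" by (simp add: diff_divide_distrib add_divide_distrib mult.commute)
      finally have "C * ?D \<le> C * (hi * ?d x)" using C(1) by (rule mult_left_mono)
      then show "norm (F x - G x) powr e x \<le> \<epsilon> * (norm (F x) powr e x + norm (G x) powr e x) + C * hi * ?d x"
        using C(2)[OF ex(3,2), of "F x" "G x"] by (simp only: mult.assoc)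
    qed
    also have "\<dots> = \<epsilon> * (rho F + rho G) + C * hi * (\<integral>x. ?d x \<partial>M)"
      using L by (subst Bochner_Integration.integral_add)
         (simp_all only: rho_def Lvar_integrable Bochner_Integration.integrable_add
           integrable_mult_right id integral_mult_right_zero Bochner_Integration.integral_add)
    also have "(\<integral>x. ?d x \<partial>M) = (energy F + energy G) / 2 - energy ?m"
      using L Lm energy_integrable by (subst Bochner_Integration.integral_diff)
         (simp_all only: energy_def energy_integrable Bochner_Integration.integrable_add
           integrable_divide_zero integral_divide_zero Bochner_Integration.integral_add)
    finally show "rho (\<lambda>x. F x - G x) \<le>
       \<epsilon> * (rho F + rho G) + C * hi * ((energy F + energy G) / 2 - energy ?m)" .
  qed
qed

text \<open>Dominated convergence yields the limit of the difference quotients and, together with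
  it, the integrability that the weak formulation demands. The sequence may have either sign, since
  the variation is tested in both directions.\<close>

lemma energy_quotient_tendsto:
  assumes L: "Lvar F" "Lvar G" and h: "h \<longlonglongrightarrow> 0" "\<And>n. h n \<noteq> 0" "\<And>n. \<bar>h n\<bar> \<le> 1"
  shows "integrable M (\<lambda>x. norm (F x) powr (e x - 2) * (F x \<bullet> G x))"
    and "(\<lambda>n. (energy (\<lambda>x. F x + h n *\<^sub>R G x) - energy F) / h n)
      \<longlonglongrightarrow> (\<integral>x. norm (F x) powr (e x - 2) * (F x \<bullet> G x) \<partial>M)"
proof -
  have [measurable]: "F \<in> borel_measurable M" "G \<in> borel_measurable M"
    using L by (auto simp: Lvar_def)
  let ?s = "\<lambda>n x. (norm (F x + h n *\<^sub>R G x) powr e x - norm (F x) powr e x) / (e x * h n)"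
  let ?w = "\<lambda>x. 2 powr hi * (norm (F x) powr e x + norm (G x) powr e x)"
  have lim: "AE x in M. (\<lambda>n. ?s n x) \<longlonglongrightarrow> norm (F x) powr (e x - 2) * (F x \<bullet> G x)"
    using exponent_bounds lo_gt_1 h by (intro AE_I2 norm_powr_quotient_tendsto) force+
  have bound: "AE x in M. norm (?s n x) \<le> ?w x" for n
  proof (rule AE_I2)
    fix x assume x: "x \<in> space M"
    have "norm (?s n x) \<le> 2 powr e x * (norm (F x) powr e x + norm (G x) powr e x)"
      using norm_powr_quotient_bound[of "e x" "h n" "F x" "G x"] exponent_bounds[OF x] lo_gt_1 h(3) by simp
    also have "\<dots> \<le> ?w x"
      using exponent_bounds[OF x] by (intro mult_right_mono powr_mono) auto
    finally show "norm (?s n x) \<le> ?w x" .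
  qed
  have w: "integrable M ?w" using L by (simp add: Lvar_def)
  have m: "(\<lambda>x. norm (F x) powr (e x - 2) * (F x \<bullet> G x)) \<in> borel_measurable M"
          "\<And>n. ?s n \<in> borel_measurable M" by measurable
  show "integrable M (\<lambda>x. norm (F x) powr (e x - 2) * (F x \<bullet> G x))"
    by (rule integrable_dominated_convergence[OF m w lim bound])
  have "(\<lambda>n. \<integral>x. ?s n x \<partial>M) \<longlonglongrightarrow> (\<integral>x. norm (F x) powr (e x - 2) * (F x \<bullet> G x) \<partial>M)"
    by (rule integral_dominated_convergence[OF m w lim bound])
  moreover have "(\<integral>x. ?s n x \<partial>M) = (energy (\<lambda>x. F x + h n *\<^sub>R G x) - energy F) / h n" for n
  proof -
    have "(\<integral>x. ?s n x \<partial>M) = (\<integral>x. (norm (F x + h n *\<^sub>R G x) powr e x / e x - norm (F x) powr e x / e x) / h n \<partial>M)"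
      by (simp add: diff_divide_distrib)
    also have "\<dots> = (energy (\<lambda>x. F x + h n *\<^sub>R G x) - energy F) / h n"
      using L by (subst integral_divide_zero, subst Bochner_Integration.integral_diff)
        (auto simp: energy_def intro!: energy_integrable Lvar_add Lvar_scaleR)
    finally show ?thesis .
  qed
  ultimately show "(\<lambda>n. (energy (\<lambda>x. F x + h n *\<^sub>R G x) - energy F) / h n)
      \<longlonglongrightarrow> (\<integral>x. norm (F x) powr (e x - 2) * (F x \<bullet> G x) \<partial>M)" by simp
qed

text \<open>Lower semicontinuity of the modular under a.e. convergence, together with membership of
  the limit. The bound is asked for only eventually because it is applied to tails of Cauchy
  sequences.\<close>

lemma Fatou_rho:
  fixes F :: "nat \<Rightarrow> 'a \<Rightarrow> 'b::euclidean_space"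
  assumes L: "\<And>n. Lvar (F n)" and G: "G \<in> borel_measurable M"
    and lim: "AE x in M. (\<lambda>n. F n x) \<longlonglongrightarrow> G x" and bd: "\<forall>\<^sub>F n in sequentially. rho (F n) \<le> B"
  shows "Lvar G" "rho G \<le> B"
proof -
  have [measurable]: "F n \<in> borel_measurable M" "G \<in> borel_measurable M" for n
    using L G by (auto simp: Lvar_def)
  have B: "0 \<le> B"
    using eventually_happens[OF bd] rho_nonneg order_trans by auto
  have nn: "(\<integral>\<^sup>+x. ennreal (norm (F n x) powr e x) \<partial>M) = ennreal (rho (F n))" for n
    unfolding rho_def by (rule nn_integral_eq_integral) (auto intro!: Lvar_integrable L)
  have "(\<integral>\<^sup>+x. ennreal (norm (G x) powr e x) \<partial>M)
      = (\<integral>\<^sup>+x. liminf (\<lambda>n. ennreal (norm (F n x) powr e x)) \<partial>M)"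
  proof (rule nn_integral_cong_AE, use lim AE_space in eventually_elim)
    case (elim x)
    then have "(\<lambda>n. ennreal (norm (F n x) powr e x)) \<longlonglongrightarrow> ennreal (norm (G x) powr e x)"
      using exponent_bounds(1)[of x] lo_gt_1
      by (intro tendsto_ennrealI tendsto_powr2 tendsto_norm tendsto_const) auto
    then show ?case by (metis lim_imp_Liminf trivial_limit_sequentially)
  qed
  also have "\<dots> \<le> liminf (\<lambda>n. \<integral>\<^sup>+x. ennreal (norm (F n x) powr e x) \<partial>M)"
    by (rule nn_integral_liminf) measurable
  also have "\<dots> \<le> ennreal B"
    unfolding nn
    by (rule Liminf_le) (use bd in \<open>auto elim!: eventually_mono intro: ennreal_leI\<close>)
  finally have le: "(\<integral>\<^sup>+x. ennreal (norm (G x) powr e x) \<partial>M) \<le> ennreal B" .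
  then have "integrable M (\<lambda>x. norm (G x) powr e x)"
    by (intro integrableI_bounded) (auto intro: le_less_trans)
  then show "Lvar G" by (simp add: Lvar_def)
  then have "ennreal (rho G) \<le> ennreal B"
    using le nn_integral_eq_integral[OF Lvar_integrable, of G] by (simp add: rho_def)
  then show "rho G \<le> B" using B by simp
qed

text \<open>The candidate G is supplied from outside as an L^1 limit, so that one and the same
  function can be recognized as limit in the p-modular and in the q-modular. An a.e. convergent
  subsequence and Fatou's lemma for F m - F (r n), with n tending to infinity, give the
  estimate.\<close>

lemma Lvar_Cauchy_limit:
  fixes F :: "nat \<Rightarrow> 'a \<Rightarrow> 'b::euclidean_space"
  assumes L: "\<And>n. Lvar (F n)"
    and C: "\<And>\<epsilon>. 0 < \<epsilon> \<Longrightarrow> \<exists>N. \<forall>m\<ge>N. \<forall>n\<ge>N. rho (\<lambda>x. F m x - F n x) < \<epsilon>"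
    and G: "integrable M G" and lim: "(\<lambda>n. \<integral>x. norm (F n x - G x) \<partial>M) \<longlonglongrightarrow> 0"
  shows "Lvar G" "(\<lambda>n. rho (\<lambda>x. F n x - G x)) \<longlonglongrightarrow> 0"
proof -
  have "\<And>n. integrable M (\<lambda>x. F n x - G x)"
    using L G by (simp add: Lvar_imp_integrable)
  then obtain r where r: "strict_mono r" and "AE x in M. (\<lambda>n. F (r n) x - G x) \<longlonglongrightarrow> 0"
    using tendsto_L1_AE_subseq[of M "\<lambda>n x. F n x - G x"] lim by auto
  then have ae: "AE x in M. (\<lambda>n. F (r n) x) \<longlonglongrightarrow> G x"
    by (auto elim!: eventually_mono dest: LIM_zero_cancel)
  have *: "\<exists>N. \<forall>m\<ge>N. Lvar (\<lambda>x. F m x - G x) \<and> rho (\<lambda>x. F m x - G x) \<le> \<epsilon>" if pos: "0 < \<epsilon>" for \<epsilon>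
  proof -
    obtain N where N: "\<And>m n. m \<ge> N \<Longrightarrow> n \<ge> N \<Longrightarrow> rho (\<lambda>x. F m x - F n x) < \<epsilon>"
      using C[OF pos] by blast
    have "Lvar (\<lambda>x. F m x - G x) \<and> rho (\<lambda>x. F m x - G x) \<le> \<epsilon>" if m: "m \<ge> N" for m
    proof -
      have "\<forall>\<^sub>F n in sequentially. rho (\<lambda>x. F m x - F (r n) x) \<le> \<epsilon>"
        using eventually_ge_at_top[of N]
      proof eventually_elim
        case (elim n)
        then have "N \<le> r n" using seq_suble[OF r, of n] by simp
        then show ?case using N[OF m] by (simp add: less_imp_le)
      qed
      moreover have "AE x in M. (\<lambda>n. F m x - F (r n) x) \<longlonglongrightarrow> F m x - G x"
        using ae by eventually_elim (intro tendsto_intros)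
      moreover have "(\<lambda>x. F m x - G x) \<in> borel_measurable M"
        using Lvar_measurable[OF L[of m]] G by measurable
      ultimately show ?thesis
        using Fatou_rho[of "\<lambda>n x. F m x - F (r n) x" "\<lambda>x. F m x - G x" \<epsilon>] L
        by (simp add: Lvar_diff)
    qed
    then show ?thesis by blast
  qed
  obtain N where "Lvar (\<lambda>x. F N x - G x)" using *[OF zero_less_one] by blast
  from Lvar_diff[OF L[of N] this] show "Lvar G" by (simp add: algebra_simps)
  show "(\<lambda>n. rho (\<lambda>x. F n x - G x)) \<longlonglongrightarrow> 0"
  proof (rule LIMSEQ_I)
    fix \<epsilon> :: real assume "0 < \<epsilon>"
    then obtain N where "\<forall>m\<ge>N. rho (\<lambda>x. F m x - G x) \<le> \<epsilon> / 2"
      using *[OF half_gt_zero] by blast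
    with \<open>0 < \<epsilon>\<close> show "\<exists>no. \<forall>n\<ge>no. norm (rho (\<lambda>x. F n x - G x) - 0) < \<epsilon>"
      by (intro exI[of _ N]) (auto simp: rho_nonneg intro: le_less_trans)
  qed
qed

text \<open>Completeness of L^1 for vector values: a subsequence is a.e. Cauchy and has a pointwise
  limit, and Fatou's lemma transfers the Cauchy estimate to it.\<close>

lemma L1_limit:
  fixes F :: "nat \<Rightarrow> 'a \<Rightarrow> 'b::euclidean_space"
  assumes i: "\<And>n. integrable M (F n)"
    and C: "\<And>\<epsilon>. 0 < \<epsilon> \<Longrightarrow> \<exists>N. \<forall>m\<ge>N. \<forall>n\<ge>N. (\<integral>x. norm (F m x - F n x) \<partial>M) < \<epsilon>"
  obtains G where "integrable M G" "(\<lambda>n. \<integral>x. norm (F n x - G x) \<partial>M) \<longlonglongrightarrow> 0"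
proof -
  have [measurable]: "F n \<in> borel_measurable M" for n using i by auto
  obtain r where r: "strict_mono r" and ae: "AE x in M. Cauchy (\<lambda>i. F (r i) x)"
    using cauchy_L1_AE_cauchy_subseq[of M F] i C by blast
  define G where "G x = lim (\<lambda>i. F (r i) x)" for x
  have Gm [measurable]: "G \<in> borel_measurable M"
    unfolding G_def by measurable
  have lim: "AE x in M. (\<lambda>i. F (r i) x) \<longlonglongrightarrow> G x"
    using ae by eventually_elim (simp add: G_def Cauchy_convergent convergent_LIMSEQ_iff[symmetric])
  have *: "\<exists>N. \<forall>m\<ge>N. integrable M (\<lambda>x. F m x - G x) \<and> (\<integral>x. norm (F m x - G x) \<partial>M) \<le> \<epsilon>"
    if pos: "0 < \<epsilon>" for \<epsilon>
  proof -
    obtain N where N: "\<And>m n. m \<ge> N \<Longrightarrow> n \<ge> N \<Longrightarrow> (\<integral>x. norm (F m x - F n x) \<partial>M) < \<epsilon>"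
      using C[OF pos] by blast
    have "integrable M (\<lambda>x. F m x - G x) \<and> (\<integral>x. norm (F m x - G x) \<partial>M) \<le> \<epsilon>" if m: "m \<ge> N" for m
    proof -
      have "(\<integral>\<^sup>+x. norm (F m x - G x) \<partial>M) = (\<integral>\<^sup>+x. liminf (\<lambda>n. ennreal (norm (F m x - F (r n) x))) \<partial>M)"
      proof (rule nn_integral_cong_AE, use lim in eventually_elim)
        case (elim x)
        then have "(\<lambda>n. ennreal (norm (F m x - F (r n) x))) \<longlonglongrightarrow> ennreal (norm (F m x - G x))"
          by (intro tendsto_ennrealI tendsto_intros)
        then show ?case by (metis lim_imp_Liminf trivial_limit_sequentially)
      qed
      also have "\<dots> \<le> liminf (\<lambda>n. \<integral>\<^sup>+x. norm (F m x - F (r n) x) \<partial>M)"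
        by (rule nn_integral_liminf) measurable
      also have "\<dots> \<le> ennreal \<epsilon>"
      proof (rule Liminf_le)
        have "\<forall>\<^sub>F n in sequentially. N \<le> n" by (rule eventually_ge_at_top)
        then show "\<forall>\<^sub>F n in sequentially. (\<integral>\<^sup>+x. norm (F m x - F (r n) x) \<partial>M) \<le> ennreal \<epsilon>"
        proof eventually_elim
          case (elim n)
          then have "N \<le> r n" using seq_suble[OF r, of n] by simp
          moreover have "(\<integral>\<^sup>+x. norm (F m x - F (r n) x) \<partial>M) = (\<integral>x. norm (F m x - F (r n) x) \<partial>M)"
            using i by (intro nn_integral_eq_integral) auto
          ultimately show ?case using N[OF m] by (simp add: less_imp_le ennreal_leI)
        qed
      qed simp
      finally have le: "(\<integral>\<^sup>+x. norm (F m x - G x) \<partial>M) \<le> ennreal \<epsilon>" .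
      then have int: "integrable M (\<lambda>x. F m x - G x)"
        by (intro integrableI_bounded) (auto intro: le_less_trans)
      then show ?thesis using le pos nn_integral_eq_integral[of M "\<lambda>x. norm (F m x - G x)"] by simp
    qed
    then show ?thesis by blast
  qed
  show ?thesis
  proof (rule that)
    obtain N where "integrable M (\<lambda>x. F N x - G x)" using *[OF zero_less_one] by blast
    from Bochner_Integration.integrable_diff[OF i[of N] this] show "integrable M G" by simp
    show "(\<lambda>n. \<integral>x. norm (F n x - G x) \<partial>M) \<longlonglongrightarrow> 0"
    proof (rule LIMSEQ_I)
      fix \<epsilon> :: real assume "0 < \<epsilon>"
      then obtain N where "\<forall>m\<ge>N. (\<integral>x. norm (F m x - G x) \<partial>M) \<le> \<epsilon> / 2"
        using *[OF half_gt_zero] by blast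
      with \<open>0 < \<epsilon>\<close> show "\<exists>no. \<forall>n\<ge>no. norm ((\<integral>x. norm (F n x - G x) \<partial>M) - 0) < \<epsilon>"
        by (intro exI[of _ N]) (auto intro: le_less_trans)
    qed
  qed
qed

end

section \<open>Averages over balls and compactness in \<open>L\<^sup>1\<close>\<close>

text \<open>The gradient is an argument, so that sums, multiples and products are described without
  \<open>frechet_derivative\<close>. Both functions live on the whole space and vanish off S, which
  makes translations and integrals over the whole space available.\<close>

definition C1_supported :: "'a::euclidean_space set \<Rightarrow> ('a \<Rightarrow> real) \<Rightarrow> ('a \<Rightarrow> 'a) \<Rightarrow> bool" where
  "C1_supported S u g \<longleftrightarrow> (\<forall>x. (u has_derivative (\<lambda>h. g x \<bullet> h)) (at x)) \<and> continuous_on UNIV g \<and>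
     (\<forall>x. x \<notin> S \<longrightarrow> u x = 0 \<and> g x = 0)"

lemma C1_supported_measurable:
  assumes "C1_supported S u g"
  shows "u \<in> borel_measurable borel" "g \<in> borel_measurable borel"
proof -
  have "continuous_on UNIV u"
    using assms has_derivative_continuous
    by (fastforce simp: C1_supported_def intro: continuous_at_imp_continuous_on)
  then show "u \<in> borel_measurable borel" by (rule borel_measurable_continuous_onI)
  show "g \<in> borel_measurable borel"
    using assms by (intro borel_measurable_continuous_onI) (simp add: C1_supported_def)
qed

lemma C1_supported_continuous:
  assumes "C1_supported S u g"
  shows "continuous_on A u" "continuous_on A g"
proof -
  have "continuous_on UNIV u"
    using assms has_derivative_continuous
    by (fastforce simp: C1_supported_def intro: continuous_at_imp_continuous_on)
  then show "continuous_on A u" by (rule continuous_on_subset) simp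
  have "continuous_on UNIV g" using assms by (simp add: C1_supported_def)
  then show "continuous_on A g" by (rule continuous_on_subset) simp
qed

section \<open>Translation estimates and the Poincare inequality in L^1\<close>

lemma nn_integral_lborel_shift:
  fixes f :: "'a::euclidean_space \<Rightarrow> ennreal"
  assumes [measurable]: "f \<in> borel_measurable borel"
  shows "(\<integral>\<^sup>+x. f (x + c) \<partial>lborel) = (\<integral>\<^sup>+x. f x \<partial>lborel)"
proof -
  have "(\<integral>\<^sup>+x. f x \<partial>lborel) = (\<integral>\<^sup>+x. f x \<partial>distr lborel borel ((+) c))"
    by (simp add: lborel_distr_plus)
  also have "\<dots> = (\<integral>\<^sup>+x. f (c + x) \<partial>lborel)" by (subst nn_integral_distr) auto
  finally show ?thesis by (simp add: add.commute)
qed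

lemma nn_integral_lborel_scale:
  fixes f :: "'a::euclidean_space \<Rightarrow> ennreal"
  assumes [measurable]: "f \<in> borel_measurable borel" and l: "0 < l"
  shows "(\<integral>\<^sup>+y. f (x + l *\<^sub>R y) \<partial>lborel) = ennreal (l powr - real DIM('a)) * (\<integral>\<^sup>+x. f x \<partial>lborel)"
proof -
  have "(\<integral>\<^sup>+x. f x \<partial>lborel) = ennreal (\<bar>l\<bar> ^ DIM('a)) * (\<integral>\<^sup>+y. f (x + l *\<^sub>R y) \<partial>lborel)"
    using l by (subst lborel_affine[of l x])
      (simp_all add: nn_integral_density nn_integral_distr nn_integral_cmult)
  moreover have "ennreal (l powr - real DIM('a)) * ennreal (\<bar>l\<bar> ^ DIM('a)) = 1"
    using l by (simp add: powr_minus powr_realpow flip: ennreal_mult)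
  ultimately show ?thesis by (simp flip: mult.assoc)
qed

lemma measurable_fst_lborel [measurable]: "fst \<in> measurable (lborel \<Otimes>\<^sub>M M) borel"
  using measurable_fst[of lborel M] by simp

lemma measurable_snd_lborel [measurable]: "snd \<in> measurable (M \<Otimes>\<^sub>M lborel) borel"
  using measurable_snd[of M lborel] by simp

lemma cball_in_borel [measurable]: "cball (x::'a::euclidean_space) r \<in> sets borel"
  by simp

text \<open>The fundamental theorem of calculus on the segment from z to z + h, followed by
  Cauchy-Schwarz. The nonnegative integral prepares the exchange of integrals that comes
  next.\<close>

lemma C1_increment_le:
  assumes C1: "C1_supported S u g"
  shows "ennreal \<bar>u (z + h) - u z\<bar> \<le>
     (\<integral>\<^sup>+t. indicator {0..1} t * ennreal (norm (g (z + t *\<^sub>R h)) * norm h) \<partial>lborel)"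
proof -
  let ?f = "\<lambda>t. g (z + t *\<^sub>R h) \<bullet> h"
  have cont: "continuous_on {0..1} ?f"
    by (intro continuous_intros continuous_on_compose2[OF C1_supported_continuous(2)[OF C1, of UNIV]]) auto
  have der: "((\<lambda>t. u (z + t *\<^sub>R h)) has_vector_derivative ?f t) (at t within {0..1})" for t
  proof -
    have u: "(u has_derivative (\<lambda>k. g (z + t *\<^sub>R h) \<bullet> k)) (at (z + t *\<^sub>R h))"
      using C1 by (simp add: C1_supported_def)
    have "((\<lambda>t. z + t *\<^sub>R h) has_derivative (\<lambda>s. s *\<^sub>R h)) (at t within {0..1})"
      by (auto intro!: derivative_eq_intros)
    from has_derivative_compose[OF this u]
    have "((\<lambda>t. u (z + t *\<^sub>R h)) has_derivative (\<lambda>s. g (z + t *\<^sub>R h) \<bullet> (s *\<^sub>R h))) (at t within {0..1})" .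
    then show ?thesis by (simp add: has_vector_derivative_def)
  qed
  have "(\<integral>t. indicator {0..1} t *\<^sub>R ?f t \<partial>lborel) = u (z + 1 *\<^sub>R h) - u (z + 0 *\<^sub>R h)"
    by (rule integral_FTC_atLeastAtMost[OF _ der cont]) simp
  then have "ennreal \<bar>u (z + h) - u z\<bar> = ennreal (norm (\<integral>t. indicator {0..1} t *\<^sub>R ?f t \<partial>lborel))"
    by simp
  also have "\<dots> \<le> (\<integral>\<^sup>+t. norm (indicator {0..1} t *\<^sub>R ?f t) \<partial>lborel)"
    by (intro integral_norm_bound_ennreal borel_integrable_compact cont compact_Icc)
  also have "\<dots> \<le> (\<integral>\<^sup>+t. indicator {0..1} t * ennreal (norm (g (z + t *\<^sub>R h)) * norm h) \<partial>lborel)"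
    by (intro nn_integral_mono)
      (auto simp: indicator_def Cauchy_Schwarz_ineq2 intro!: ennreal_leI)
  finally show ?thesis .
qed

text \<open>After the integrals over t and z are exchanged, translation invariance makes the inner
  integral independent of t.\<close>

lemma C1_translation_L1:
  fixes u :: "'a::euclidean_space \<Rightarrow> real"
  assumes C1: "C1_supported S u g"
  shows "(\<integral>\<^sup>+z. ennreal \<bar>u (z + h) - u z\<bar> \<partial>lborel) \<le> ennreal (norm h) * (\<integral>\<^sup>+z. ennreal (norm (g z)) \<partial>lborel)"
proof -
  note [measurable] = C1_supported_measurable[OF C1]
  have "(\<integral>\<^sup>+z. ennreal \<bar>u (z + h) - u z\<bar> \<partial>lborel)
    \<le> (\<integral>\<^sup>+z. \<integral>\<^sup>+t. indicator {0..1} t * ennreal (norm (g (z + t *\<^sub>R h)) * norm h) \<partial>lborel \<partial>lborel)"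
    by (intro nn_integral_mono C1_increment_le[OF C1])
  also have "\<dots> = (\<integral>\<^sup>+t. \<integral>\<^sup>+z. indicator {0..1} t * ennreal (norm (g (z + t *\<^sub>R h)) * norm h) \<partial>lborel \<partial>lborel)"
    by (subst lborel_pair.Fubini') (auto simp: case_prod_unfold)
  also have "\<dots> = (\<integral>\<^sup>+(t::real). indicator {0..1} t * (ennreal (norm h) * (\<integral>\<^sup>+z. ennreal (norm (g z)) \<partial>lborel)) \<partial>lborel)"
  proof (intro nn_integral_cong)
    fix t :: real
    have "(\<integral>\<^sup>+z. indicator {0..1} t * ennreal (norm (g (z + t *\<^sub>R h)) * norm h) \<partial>lborel)
       = indicator {0..1} t * (ennreal (norm h) * (\<integral>\<^sup>+z. ennreal (norm (g (z + t *\<^sub>R h))) \<partial>lborel))"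
      by (simp add: nn_integral_cmult ennreal_mult' mult.commute)
    then show "(\<integral>\<^sup>+z. indicator {0..1} t * ennreal (norm (g (z + t *\<^sub>R h)) * norm h) \<partial>lborel)
       = indicator {0..1} t * (ennreal (norm h) * (\<integral>\<^sup>+z. ennreal (norm (g z)) \<partial>lborel))"
      using nn_integral_lborel_shift[of "\<lambda>z. ennreal (norm (g z))" "t *\<^sub>R h"] by simp
  qed
  also have "\<dots> = ennreal (norm h) * (\<integral>\<^sup>+z. ennreal (norm (g z)) \<partial>lborel)"
    by (simp add: nn_integral_multc)
  finally show ?thesis .
qed

text \<open>A translation that carries S off itself turns the increment u (z + h) - u z into - u z
  on S, so the translation estimate bounds u itself. Two points of S are at most 2 B apart, hence
  length 3 B is enough.\<close>

lemma poincare_L1: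
  fixes S :: "'a::euclidean_space set"
  assumes "bounded S"
  obtains C where "0 < C" "\<And>u g. C1_supported S u g \<Longrightarrow>
    (\<integral>\<^sup>+z. ennreal \<bar>u z\<bar> \<partial>lborel) \<le> ennreal C * (\<integral>\<^sup>+z. ennreal (norm (g z)) \<partial>lborel)"
proof -
  obtain B where B: "0 < B" "\<And>x. x \<in> S \<Longrightarrow> norm x \<le> B"
    using assms bounded_pos by metis
  obtain b :: 'a where b: "b \<in> Basis" using nonempty_Basis by blast
  define h where "h = (3 * B) *\<^sub>R b"
  have h: "norm h = 3 * B" using b B by (simp add: h_def)
  show ?thesis
  proof (rule that[of "norm h"])
    show "0 < norm h" using h B by simp
    fix u :: "'a \<Rightarrow> real" and g assume C1: "C1_supported S u g"
    have "\<bar>u z\<bar> \<le> \<bar>u (z + h) - u z\<bar>" for z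
    proof (cases "z \<in> S")
      case True
      have "norm h \<le> norm (z + h) + norm z" by (metis add_diff_cancel_left' norm_triangle_ineq4)
      then have "z + h \<notin> S"
        using B(2)[of "z + h"] B(2)[OF True] B(1) h by auto
      then show ?thesis using C1 by (simp add: C1_supported_def)
    qed (use C1 in \<open>simp add: C1_supported_def\<close>)
    then have "(\<integral>\<^sup>+z. ennreal \<bar>u z\<bar> \<partial>lborel) \<le> (\<integral>\<^sup>+z. ennreal \<bar>u (z + h) - u z\<bar> \<partial>lborel)"
      by (intro nn_integral_mono ennreal_leI)
    also have "\<dots> \<le> ennreal (norm h) * (\<integral>\<^sup>+z. ennreal (norm (g z)) \<partial>lborel)"
      by (rule C1_translation_L1[OF C1])
    finally show "(\<integral>\<^sup>+z. ennreal \<bar>u z\<bar> \<partial>lborel) \<le> ennreal (norm h) * (\<integral>\<^sup>+z. ennreal (norm (g z)) \<partial>lborel)" .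
  qed
qed

section \<open>Averages over balls\<close>

lemma unit_ball_vol_DIM_pos: "0 < unit_ball_vol (real DIM('a::euclidean_space))"
  by simp

lemma unit_ball_vol_DIM_neq_0 [simp]: "unit_ball_vol (real DIM('a::euclidean_space)) \<noteq> 0"
  by (metis less_irrefl unit_ball_vol_DIM_pos)

lemma emeasure_unit_ball:
  "emeasure lborel (cball (0::'a::euclidean_space) 1) = ennreal (unit_ball_vol (real DIM('a)))"
  by (simp add: emeasure_cball)

text \<open>The mean of u over the closed ball of radius l around x, written as an integral over the
  unit ball. In this form l = 0 makes sense and returns u itself.\<close>

definition ball_avg :: "real \<Rightarrow> ('a::euclidean_space \<Rightarrow> real) \<Rightarrow> 'a \<Rightarrow> real" where
  "ball_avg l u x = (\<integral>y. indicator (cball 0 1) y *\<^sub>R u (x + l *\<^sub>R y) \<partial>lborel) / unit_ball_vol (real DIM('a))"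

lemma ball_avg_integrable:
  assumes "continuous_on UNIV u"
  shows "integrable lborel (\<lambda>y. indicator (cball 0 1) y *\<^sub>R u (x + l *\<^sub>R y) :: real)"
  by (intro borel_integrable_compact compact_cball continuous_on_compose2[OF assms] continuous_intros) auto

lemma ball_avg_measurable:
  assumes [measurable]: "u \<in> borel_measurable borel"
  shows "ball_avg l u \<in> borel_measurable borel"
  unfolding ball_avg_def by measurable

text \<open>General enough for two comparisons: u with its own average, as radius 0 against radius
  l, and the averages of two functions at the same radius.\<close>

lemma ball_avg_diff_le:
  fixes u v :: "'a::euclidean_space \<Rightarrow> real"
  assumes u: "continuous_on UNIV u" and v: "continuous_on UNIV v"
  shows "ennreal \<bar>ball_avg l u x - ball_avg k v z\<bar> \<le> ennreal (1 / unit_ball_vol (real DIM('a))) *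
    (\<integral>\<^sup>+y. indicator (cball 0 1) y * ennreal \<bar>u (x + l *\<^sub>R y) - v (z + k *\<^sub>R y)\<bar> \<partial>lborel)"
proof -
  let ?\<omega> = "unit_ball_vol (real DIM('a))"
  let ?f = "\<lambda>y. indicator (cball 0 1) y *\<^sub>R u (x + l *\<^sub>R y) - indicator (cball 0 1) y *\<^sub>R v (z + k *\<^sub>R y) :: real"
  have "ball_avg l u x - ball_avg k v z = (\<integral>y. ?f y \<partial>lborel) / ?\<omega>"
    unfolding ball_avg_def
    by (subst Bochner_Integration.integral_diff[OF ball_avg_integrable[OF u] ball_avg_integrable[OF v]])
       (simp add: diff_divide_distrib)
  then have eq: "ennreal \<bar>ball_avg l u x - ball_avg k v z\<bar> = ennreal (1 / ?\<omega>) * ennreal (norm (\<integral>y. ?f y \<partial>lborel))"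
    using unit_ball_vol_DIM_pos[where 'a='a] by (simp add: abs_divide flip: ennreal_mult)
  have "ennreal (norm (\<integral>y. ?f y \<partial>lborel)) \<le> (\<integral>\<^sup>+y. norm (?f y) \<partial>lborel)"
    by (intro integral_norm_bound_ennreal Bochner_Integration.integrable_diff ball_avg_integrable u v)
  also have "\<dots> = (\<integral>\<^sup>+y. indicator (cball 0 1) y * ennreal \<bar>u (x + l *\<^sub>R y) - v (z + k *\<^sub>R y)\<bar> \<partial>lborel)"
    by (intro nn_integral_cong) (auto simp: indicator_def)
  finally show ?thesis unfolding eq by (rule mult_left_mono) simp
qed

lemma ball_avg_0 [simp]: "ball_avg 0 u x = u x" for x :: "'a::euclidean_space"
proof -
  have "measure lborel (cball (0::'a) 1) = unit_ball_vol (real DIM('a))"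
    by (simp add: Sigma_Algebra.measure_def emeasure_unit_ball less_imp_le[OF unit_ball_vol_DIM_pos])
  then have "(\<integral>y. indicator (cball (0::'a) 1) y *\<^sub>R u x \<partial>lborel) = unit_ball_vol (real DIM('a)) * u x"
    by simp
  then show ?thesis unfolding ball_avg_def scaleR_zero_left add_0_right by auto
qed

lemma ball_avg_zero_fun: "ball_avg l (\<lambda>_. 0) x = 0"
  by (simp add: ball_avg_def)

text \<open>A pointwise bound by an L^1 norm, paid for by the factor l^(-N) of the change of
  variables. At a fixed radius it makes averages uniformly bounded.\<close>

lemma ball_avg_le_L1:
  fixes u v :: "'a::euclidean_space \<Rightarrow> real"
  assumes u: "continuous_on UNIV u" and v: "continuous_on UNIV v" and l: "0 < l"
  shows "ennreal \<bar>ball_avg l u x - ball_avg l v x\<bar> \<le>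
     ennreal (l powr - real DIM('a) / unit_ball_vol (real DIM('a))) * (\<integral>\<^sup>+z. ennreal \<bar>u z - v z\<bar> \<partial>lborel)"
proof -
  have [measurable]: "u \<in> borel_measurable borel" "v \<in> borel_measurable borel"
    using u v by (auto intro: borel_measurable_continuous_onI)
  let ?\<omega> = "unit_ball_vol (real DIM('a))"
  have "ennreal \<bar>ball_avg l u x - ball_avg l v x\<bar> \<le> ennreal (1 / ?\<omega>) *
    (\<integral>\<^sup>+y. indicator (cball 0 1) y * ennreal \<bar>u (x + l *\<^sub>R y) - v (x + l *\<^sub>R y)\<bar> \<partial>lborel)"
    by (rule ball_avg_diff_le[OF u v])
  also have "\<dots> \<le> ennreal (1 / ?\<omega>) * (\<integral>\<^sup>+y. ennreal \<bar>u (x + l *\<^sub>R y) - v (x + l *\<^sub>R y)\<bar> \<partial>lborel)"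
    by (intro mult_left_mono nn_integral_mono) (auto simp: indicator_def)
  also have "\<dots> = ennreal (1 / ?\<omega>) * (ennreal (l powr - real DIM('a)) * (\<integral>\<^sup>+z. ennreal \<bar>u z - v z\<bar> \<partial>lborel))"
    by (subst nn_integral_lborel_scale[of "\<lambda>z. ennreal \<bar>u z - v z\<bar>" l x]) (use l in auto)
  also have "\<dots> = ennreal (l powr - real DIM('a) / ?\<omega>) * (\<integral>\<^sup>+z. ennreal \<bar>u z - v z\<bar> \<partial>lborel)"
    using unit_ball_vol_DIM_pos[where 'a='a] by (simp flip: mult.assoc ennreal_mult)
  finally show ?thesis .
qed

text \<open>Moving the centre amounts to translating u, so the previous bound meets the translation
  estimate. The constant depends on u only through K, which is the equicontinuity for
  Arzela-Ascoli.\<close>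

lemma ball_avg_lipschitz:
  fixes u :: "'a::euclidean_space \<Rightarrow> real"
  assumes C1: "C1_supported S u g" and l: "0 < l" and K: "(\<integral>\<^sup>+z. ennreal (norm (g z)) \<partial>lborel) \<le> ennreal K" "0 \<le> K"
  shows "\<bar>ball_avg l u x - ball_avg l u z\<bar> \<le> l powr - real DIM('a) / unit_ball_vol (real DIM('a)) * (norm (x - z) * K)"
proof -
  note u = C1_supported_continuous(1)[OF C1, of UNIV]
  let ?\<omega> = "unit_ball_vol (real DIM('a))"
  define v where "v y = u (y + (z - x))" for y
  have v: "continuous_on UNIV v"
    unfolding v_def by (intro continuous_on_compose2[OF u] continuous_intros) auto
  have "ball_avg l u z = ball_avg l v x"
    by (simp add: ball_avg_def v_def algebra_simps)
  then have le: "ennreal \<bar>ball_avg l u x - ball_avg l u z\<bar> \<le> ennreal (l powr - real DIM('a) / ?\<omega>) * (\<integral>\<^sup>+y. ennreal \<bar>u y - v y\<bar> \<partial>lborel)"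
    using ball_avg_le_L1[OF u v l, of x] by simp
  moreover have "(\<integral>\<^sup>+y. ennreal \<bar>u y - v y\<bar> \<partial>lborel) \<le> ennreal (norm (x - z)) * ennreal K"
  proof -
    have "(\<integral>\<^sup>+y. ennreal \<bar>u y - v y\<bar> \<partial>lborel) \<le> ennreal (norm (z - x)) * (\<integral>\<^sup>+z. ennreal (norm (g z)) \<partial>lborel)"
      using C1_translation_L1[OF C1, of "z - x"] by (simp add: v_def abs_minus_commute)
    also have "\<dots> \<le> ennreal (norm (x - z)) * ennreal K"
      using K by (subst norm_minus_commute) (rule mult_left_mono, auto)
    finally show ?thesis .
  qed
  ultimately have "ennreal \<bar>ball_avg l u x - ball_avg l u z\<bar> \<le>
      ennreal (l powr - real DIM('a) / ?\<omega>) * (ennreal (norm (x - z)) * ennreal K)"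
    by (meson mult_left_mono order_trans zero_le)
  also have "\<dots> = ennreal (l powr - real DIM('a) / ?\<omega> * (norm (x - z) * K))"
    using unit_ball_vol_DIM_pos[where 'a='a] K by (simp add: ennreal_mult del: times_divide_eq_left)
  finally have "ennreal \<bar>ball_avg l u x - ball_avg l u z\<bar> \<le> ennreal (l powr - real DIM('a) / ?\<omega> * (norm (x - z) * K))" .
  moreover have "0 \<le> l powr - real DIM('a) / ?\<omega> * (norm (x - z) * K)"
    using unit_ball_vol_DIM_pos[where 'a='a] K by simp
  ultimately show ?thesis using ennreal_le_iff by blast
qed

text \<open>The error is a mean of the increments u (x + l y) - u x over the unit ball, and each of
  these translations costs at most l K in L^1. The rate is the same for all u with the same
  K.\<close>

lemma ball_avg_approx_L1:
  fixes u :: "'a::euclidean_space \<Rightarrow> real"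
  assumes C1: "C1_supported S u g" and l: "0 < l" and K: "(\<integral>\<^sup>+z. ennreal (norm (g z)) \<partial>lborel) \<le> ennreal K" "0 \<le> K"
  shows "(\<integral>\<^sup>+x. ennreal \<bar>u x - ball_avg l u x\<bar> \<partial>lborel) \<le> ennreal (l * K)"
proof -
  note u = C1_supported_continuous(1)[OF C1, of UNIV]
  note [measurable] = C1_supported_measurable[OF C1]
  let ?\<omega> = "unit_ball_vol (real DIM('a))"
  have *: "(\<integral>\<^sup>+x. ennreal \<bar>u x - ball_avg l u x\<bar> \<partial>lborel) \<le>
     (\<integral>\<^sup>+x. ennreal (1 / ?\<omega>) * (\<integral>\<^sup>+y. indicator (cball 0 1) y * ennreal \<bar>u (x + l *\<^sub>R y) - u x\<bar> \<partial>lborel) \<partial>lborel)"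
    using ball_avg_diff_le[OF u u, where l=0 and k=l]
    by (intro nn_integral_mono) (simp add: abs_minus_commute)
  have **: "(\<integral>\<^sup>+x. ennreal (1 / ?\<omega>) * (\<integral>\<^sup>+y. indicator (cball 0 1) y * ennreal \<bar>u (x + l *\<^sub>R y) - u x\<bar> \<partial>lborel) \<partial>lborel)
    = ennreal (1 / ?\<omega>) * (\<integral>\<^sup>+x. \<integral>\<^sup>+y. indicator (cball 0 1) y * ennreal \<bar>u (x + l *\<^sub>R y) - u x\<bar> \<partial>lborel \<partial>lborel)"
    by (rule nn_integral_cmult) measurable
  have "(\<integral>\<^sup>+x. \<integral>\<^sup>+y. indicator (cball 0 1) y * ennreal \<bar>u (x + l *\<^sub>R y) - u x\<bar> \<partial>lborel \<partial>lborel)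
      = (\<integral>\<^sup>+y. \<integral>\<^sup>+x. indicator (cball 0 1) y * ennreal \<bar>u (x + l *\<^sub>R y) - u x\<bar> \<partial>lborel \<partial>lborel)"
    by (subst lborel_pair.Fubini') (auto simp: case_prod_unfold)
  also have "\<dots> \<le> (\<integral>\<^sup>+(y::'a). indicator (cball 0 1) y * ennreal (l * K) \<partial>lborel)"
  proof (intro nn_integral_mono)
    fix y :: 'a
    have "(\<integral>\<^sup>+x. ennreal \<bar>u (x + l *\<^sub>R y) - u x\<bar> \<partial>lborel) \<le> ennreal (l * K)" if "norm y \<le> 1"
    proof -
      have "(\<integral>\<^sup>+x. ennreal \<bar>u (x + l *\<^sub>R y) - u x\<bar> \<partial>lborel) \<le> ennreal (norm (l *\<^sub>R y)) * ennreal K"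
        using C1_translation_L1[OF C1, of "l *\<^sub>R y"] K by (meson mult_left_mono order_trans zero_le)
      also have "\<dots> \<le> ennreal l * ennreal K"
        using that l by (intro mult_right_mono ennreal_leI) (auto simp: mult_left_le)
      finally show ?thesis using l K by (simp add: ennreal_mult)
    qed
    then show "(\<integral>\<^sup>+x. indicator (cball 0 1) y * ennreal \<bar>u (x + l *\<^sub>R y) - u x\<bar> \<partial>lborel)
      \<le> indicator (cball 0 1) y * ennreal (l * K)"
      by (cases "norm y \<le> 1") auto
  qed
  also have "\<dots> = ennreal ?\<omega> * ennreal (l * K)"
    by (simp add: nn_integral_multc emeasure_unit_ball)
  finally have "(\<integral>\<^sup>+x. ennreal \<bar>u x - ball_avg l u x\<bar> \<partial>lborel) \<le> ennreal (1 / ?\<omega>) * (ennreal ?\<omega> * ennreal (l * K))"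
    by (intro order_trans[OF order_trans[OF * eq_refl[OF **]]] mult_left_mono) simp_all
  also have "ennreal (1 / ?\<omega>) * (ennreal ?\<omega> * ennreal (l * K)) = ennreal (l * K)"
    using unit_ball_vol_DIM_pos[where 'a='a] l K by (simp flip: mult.assoc ennreal_mult)
  finally show ?thesis .
qed

text \<open>Arzela-Ascoli at a fixed radius: \<open>poincare_L1\<close> and
  \<open>ball_avg_le_L1\<close> give the uniform bound, \<open>ball_avg_lipschitz\<close> the
  equicontinuity.\<close>

lemma ball_avg_subseq_uniform:
  fixes u :: "nat \<Rightarrow> 'a::euclidean_space \<Rightarrow> real"
  assumes S: "bounded S" and C1: "\<And>n. C1_supported S (u n) (g n)"
    and K: "\<And>n. (\<integral>\<^sup>+z. ennreal (norm (g n z)) \<partial>lborel) \<le> ennreal K" "0 \<le> K" and l: "0 < l"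
  obtains r where "strict_mono (r :: nat \<Rightarrow> nat)"
    "\<forall>\<epsilon>>0. \<exists>N. \<forall>m\<ge>N. \<forall>n\<ge>N. \<forall>x\<in>S. \<bar>ball_avg l (u (r m)) x - ball_avg l (u (r n)) x\<bar> < \<epsilon>"
proof -
  obtain C where C: "0 < C" "\<And>u g. C1_supported S u g \<Longrightarrow>
    (\<integral>\<^sup>+z. ennreal \<bar>u z\<bar> \<partial>lborel) \<le> ennreal C * (\<integral>\<^sup>+z. ennreal (norm (g z)) \<partial>lborel)"
    using poincare_L1[OF S] by blast
  define c where "c = l powr - real DIM('a) / unit_ball_vol (real DIM('a))"
  have c: "0 < c" using l unit_ball_vol_DIM_pos[where 'a='a] by (simp add: c_def)
  have bd: "norm (ball_avg l (u n) x) \<le> c * (C * K)" for n x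
  proof -
    have "(\<integral>\<^sup>+z. ennreal \<bar>u n z\<bar> \<partial>lborel) \<le> ennreal C * ennreal K"
      by (rule order_trans[OF C(2)[OF C1]]) (intro mult_left_mono K(1), simp)
    moreover have "ennreal \<bar>ball_avg l (u n) x\<bar> \<le> ennreal c * (\<integral>\<^sup>+z. ennreal \<bar>u n z\<bar> \<partial>lborel)"
      using ball_avg_le_L1[OF C1_supported_continuous(1)[OF C1[of n]] continuous_on_const[of _ 0] l, of x]
      by (simp add: ball_avg_zero_fun c_def)
    ultimately have "ennreal \<bar>ball_avg l (u n) x\<bar> \<le> ennreal c * (ennreal C * ennreal K)"
      by (meson mult_left_mono order_trans zero_le)
    also have "\<dots> = ennreal (c * (C * K))" using c C K by (simp add: ennreal_mult)
    finally show ?thesis using c C K by (simp add: ennreal_le_iff)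
  qed
  have equi: "\<exists>d>0. \<forall>n y. y \<in> closure S \<and> norm (x - y) < d \<longrightarrow>
      norm (ball_avg l (u n) x - ball_avg l (u n) y) < e" if e: "0 < e" for x e
  proof (intro exI[of _ "e / (c * K + 1)"] conjI allI impI)
    have cK: "0 < c * K + 1" using c K by (simp add: add_nonneg_pos)
    then show "0 < e / (c * K + 1)" using e by simp
    fix n y assume y: "y \<in> closure S \<and> norm (x - y) < e / (c * K + 1)"
    have "norm (ball_avg l (u n) x - ball_avg l (u n) y) \<le> c * (norm (x - y) * K)"
      using ball_avg_lipschitz[OF C1[of n] l K(1)[of n] K(2), of x y] by (simp add: c_def)
    also have "\<dots> \<le> norm (x - y) * (c * K + 1)" by (simp add: algebra_simps)
    also have "\<dots> < e" using y cK by (simp add: pos_less_divide_eq)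
    finally show "norm (ball_avg l (u n) x - ball_avg l (u n) y) < e" .
  qed
  have "compact (closure S)" using S by (simp add: compact_closure)
  then have "\<exists>f r. strict_mono (r :: nat \<Rightarrow> nat) \<and>
     (\<forall>e>0. \<exists>N. \<forall>n x. n \<ge> N \<and> x \<in> closure S \<longrightarrow> norm (ball_avg l (u (r n)) x - f x) < e)"
    by (rule Arzela_Ascoli[of "closure S" "\<lambda>n. ball_avg l (u n)" "c * (C * K)"])
      (rule bd, rule equi, assumption, blast)
  then obtain f r where r: "strict_mono (r :: nat \<Rightarrow> nat)" and
    f: "\<forall>e>0. \<exists>N. \<forall>n x. n \<ge> N \<and> x \<in> closure S \<longrightarrow> norm (ball_avg l (u (r n)) x - f x) < e"
    by blast
  show ?thesis
  proof (rule that[OF r])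
    show "\<forall>\<epsilon>>0. \<exists>N. \<forall>m\<ge>N. \<forall>n\<ge>N. \<forall>x\<in>S. \<bar>ball_avg l (u (r m)) x - ball_avg l (u (r n)) x\<bar> < \<epsilon>"
    proof (intro allI impI)
      fix \<epsilon> :: real assume "0 < \<epsilon>"
      then have "0 < \<epsilon> / 2" by simp
      with f obtain N where N: "\<And>n x. n \<ge> N \<Longrightarrow> x \<in> closure S \<Longrightarrow> norm (ball_avg l (u (r n)) x - f x) < \<epsilon> / 2"
        by blast
      show "\<exists>N. \<forall>m\<ge>N. \<forall>n\<ge>N. \<forall>x\<in>S. \<bar>ball_avg l (u (r m)) x - ball_avg l (u (r n)) x\<bar> < \<epsilon>"
      proof (intro exI[of _ N] allI impI ballI)
        fix m n x assume "N \<le> m" "N \<le> n" "x \<in> S"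
        then have "norm (ball_avg l (u (r m)) x - f x) < \<epsilon> / 2" "norm (ball_avg l (u (r n)) x - f x) < \<epsilon> / 2"
          using N closure_subset by blast+
        then show "\<bar>ball_avg l (u (r m)) x - ball_avg l (u (r n)) x\<bar> < \<epsilon>"
          unfolding real_norm_def by linarith
      qed
    qed
  qed
qed

text \<open>Three terms of size \<epsilon>/3: two approximation errors, small by the choice of l,
  and the difference of the averages, which is uniformly small on S and is integrated over its
  finite measure. The subsequence still depends on \<epsilon>.\<close>

lemma rellich_step:
  fixes u :: "nat \<Rightarrow> 'a::euclidean_space \<Rightarrow> real"
  assumes S: "bounded S" "S \<in> sets borel" and C1: "\<And>n. C1_supported S (u n) (g n)"
    and K: "\<And>n. (\<integral>\<^sup>+z. ennreal (norm (g n z)) \<partial>lborel) \<le> ennreal K" "0 \<le> K" and \<epsilon>: "0 < \<epsilon>"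
  obtains r N where "strict_mono (r :: nat \<Rightarrow> nat)"
    "\<forall>m\<ge>N. \<forall>n\<ge>N. (\<integral>\<^sup>+x. ennreal \<bar>u (r m) x - u (r n) x\<bar> \<partial>lborel) \<le> ennreal \<epsilon>"
proof -
  define l where "l = \<epsilon> / (3 * (K + 1))"
  have l: "0 < l" "l * K \<le> \<epsilon> / 3" using K \<epsilon> by (auto simp: l_def field_simps)
  define m where "m = measure lborel S"
  have m: "emeasure lborel S = ennreal m"
    using emeasure_bounded_finite[OF S(1)] by (simp add: m_def emeasure_eq_ennreal_measure less_top[symmetric])
  have m0: "0 \<le> m" by (simp add: m_def)
  obtain r where r: "strict_mono (r :: nat \<Rightarrow> nat)" and
    r': "\<forall>\<epsilon>>0. \<exists>N. \<forall>m\<ge>N. \<forall>n\<ge>N. \<forall>x\<in>S. \<bar>ball_avg l (u (r m)) x - ball_avg l (u (r n)) x\<bar> < \<epsilon>"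
    by (rule ball_avg_subseq_uniform[of S u g K l]) (use S C1 K l in auto)
  have d: "0 < \<epsilon> / (3 * (m + 1))" using m0 \<epsilon> by simp
  obtain N where N: "\<forall>i\<ge>N. \<forall>j\<ge>N. \<forall>x\<in>S. \<bar>ball_avg l (u (r i)) x - ball_avg l (u (r j)) x\<bar> < \<epsilon> / (3 * (m + 1))"
    using r' d by blast
  show ?thesis
  proof (rule that[OF r], intro allI impI)
    fix i j assume ij: "N \<le> i" "N \<le> j"
    note [measurable] = C1_supported_measurable(1)[OF C1[of "r i"]] C1_supported_measurable(1)[OF C1[of "r j"]]
      S(2) ball_avg_measurable[OF C1_supported_measurable(1)[OF C1[of "r i"]], of l]
      ball_avg_measurable[OF C1_supported_measurable(1)[OF C1[of "r j"]], of l]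
    have "(\<integral>\<^sup>+x. ennreal \<bar>u (r i) x - u (r j) x\<bar> \<partial>lborel) \<le>
      (\<integral>\<^sup>+x. ennreal \<bar>u (r i) x - ball_avg l (u (r i)) x\<bar> + (ennreal \<bar>u (r j) x - ball_avg l (u (r j)) x\<bar>
         + ennreal (\<epsilon> / (3 * (m + 1))) * indicator S x) \<partial>lborel)"
    proof (rule nn_integral_mono)
      fix x
      show "ennreal \<bar>u (r i) x - u (r j) x\<bar> \<le> ennreal \<bar>u (r i) x - ball_avg l (u (r i)) x\<bar>
        + (ennreal \<bar>u (r j) x - ball_avg l (u (r j)) x\<bar> + ennreal (\<epsilon> / (3 * (m + 1))) * indicator S x)"
      proof (cases "x \<in> S")
        case True
        then have "\<bar>ball_avg l (u (r i)) x - ball_avg l (u (r j)) x\<bar> < \<epsilon> / (3 * (m + 1))"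
          using N ij by blast
        then have "\<bar>u (r i) x - u (r j) x\<bar> \<le> \<bar>u (r i) x - ball_avg l (u (r i)) x\<bar>
          + (\<bar>u (r j) x - ball_avg l (u (r j)) x\<bar> + \<epsilon> / (3 * (m + 1)))" by linarith
        then show ?thesis using True d by (simp flip: ennreal_plus add: ennreal_leI del: abs_diff_less_iff)
      qed (use C1[of "r i"] C1[of "r j"] in \<open>simp add: C1_supported_def\<close>)
    qed
    also have "\<dots> = (\<integral>\<^sup>+x. ennreal \<bar>u (r i) x - ball_avg l (u (r i)) x\<bar> \<partial>lborel) +
       ((\<integral>\<^sup>+x. ennreal \<bar>u (r j) x - ball_avg l (u (r j)) x\<bar> \<partial>lborel) + ennreal (\<epsilon> / (3 * (m + 1))) * ennreal m)"
      by (subst nn_integral_add, measurable, subst nn_integral_add, measurable)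
         (simp add: nn_integral_cmult_indicator m)
    also have "\<dots> \<le> ennreal (l * K) + (ennreal (l * K) + ennreal (\<epsilon> / (3 * (m + 1))) * ennreal m)"
      by (intro add_mono ball_avg_approx_L1[OF C1 l(1) K] order_refl)
    also have "\<dots> \<le> ennreal \<epsilon>"
    proof -
      have "\<epsilon> / (3 * (m + 1)) * m \<le> \<epsilon> / 3" using m0 \<epsilon> by (simp add: field_simps)
      then have "l * K + (l * K + \<epsilon> / (3 * (m + 1)) * m) \<le> \<epsilon>" using l by linarith
      moreover have "ennreal (l * K) + (ennreal (l * K) + ennreal A * ennreal m) \<le> ennreal \<epsilon>"
        if "0 \<le> A" "l * K + (l * K + A * m) \<le> \<epsilon>" for A
        using that l K m0 by (simp flip: ennreal_plus ennreal_mult add: ennreal_leI)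
      ultimately show ?thesis using d by (blast intro: less_imp_le)
    qed
    finally show "(\<integral>\<^sup>+x. ennreal \<bar>u (r i) x - u (r j) x\<bar> \<partial>lborel) \<le> ennreal \<epsilon>" .
  qed
qed

lemma rellich_L1:
  fixes u :: "nat \<Rightarrow> 'a::euclidean_space \<Rightarrow> real"
  assumes S: "bounded S" "S \<in> sets borel" and C1: "\<And>n. C1_supported S (u n) (g n)"
    and K: "\<And>n. (\<integral>\<^sup>+z. ennreal (norm (g n z)) \<partial>lborel) \<le> ennreal K" "0 \<le> K"
  obtains r where "strict_mono (r :: nat \<Rightarrow> nat)"
    "\<forall>\<epsilon>>0. \<exists>N. \<forall>m\<ge>N. \<forall>n\<ge>N. (\<integral>\<^sup>+x. ennreal \<bar>u (r m) x - u (r n) x\<bar> \<partial>lborel) \<le> ennreal \<epsilon>"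
proof -
  \<comment> \<open>Property j asks for eventual closeness 1/(j+1). It is inherited by further
    subsequences, so the diagonal sequence enjoys all of them.\<close>
  define P where "P j s \<longleftrightarrow> (\<exists>N. \<forall>m\<ge>N. \<forall>n\<ge>N.
     (\<integral>\<^sup>+x. ennreal \<bar>u (s m) x - u (s n) x\<bar> \<partial>lborel) \<le> ennreal (1 / real (Suc j)))" for j :: nat and s :: "nat \<Rightarrow> nat"
  interpret subseqs P
  proof
    fix j and s :: "nat \<Rightarrow> nat"
    obtain r N where r: "strict_mono (r :: nat \<Rightarrow> nat)"
      "\<forall>m\<ge>N. \<forall>n\<ge>N. (\<integral>\<^sup>+x. ennreal \<bar>u (s (r m)) x - u (s (r n)) x\<bar> \<partial>lborel) \<le> ennreal (1 / real (Suc j))"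
      by (rule rellich_step[OF S, of "\<lambda>n. u (s n)" "\<lambda>n. g (s n)" K "1 / real (Suc j)"]) (use C1 K in auto)
    then show "\<exists>r'. strict_mono r' \<and> P j (s \<circ> r')" by (auto simp: P_def o_def)
  qed
  have P: "P k (diagseq \<circ> (+) (Suc k))" for k
  proof (rule diagseq_holds)
    fix r s :: "nat \<Rightarrow> nat" and n assume r: "strict_mono r" and "P n s"
    then show "P n (s \<circ> r)"
      unfolding P_def o_def by (meson order_trans seq_suble)
  qed
  show ?thesis
  proof (rule that[OF subseq_diagseq], intro allI impI)
    fix \<epsilon> :: real assume "0 < \<epsilon>"
    then obtain k where k: "1 / real (Suc k) < \<epsilon>" using nat_approx_posE by blast
    obtain N where N: "\<And>m n. m \<ge> N \<Longrightarrow> n \<ge> N \<Longrightarrow>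
      (\<integral>\<^sup>+x. ennreal \<bar>u (diagseq (Suc k + m)) x - u (diagseq (Suc k + n)) x\<bar> \<partial>lborel) \<le> ennreal (1 / real (Suc k))"
      using P[of k] unfolding P_def o_def by blast
    show "\<exists>N. \<forall>m\<ge>N. \<forall>n\<ge>N. (\<integral>\<^sup>+x. ennreal \<bar>u (diagseq m) x - u (diagseq n) x\<bar> \<partial>lborel) \<le> ennreal \<epsilon>"
    proof (intro exI[of _ "Suc k + N"] allI impI)
      fix m n assume "Suc k + N \<le> m" "Suc k + N \<le> n"
      then have "(\<integral>\<^sup>+x. ennreal \<bar>u (diagseq m) x - u (diagseq n) x\<bar> \<partial>lborel) \<le> ennreal (1 / real (Suc k))"
        using N[of "m - Suc k" "n - Suc k"] by simp
      also have "\<dots> \<le> ennreal \<epsilon>" using k by (intro ennreal_leI) simp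
      finally show "(\<integral>\<^sup>+x. ennreal \<bar>u (diagseq m) x - u (diagseq n) x\<bar> \<partial>lborel) \<le> ennreal \<epsilon>" .
    qed
  qed
qed

section \<open>Subcritical Sobolev estimates\<close>

text \<open>Convexity: the graph lies above its tangent at c. Taken at a mean value, it is the
  source of Jensen's inequality below.\<close>

lemma powr_tangent_le:
  fixes x c R :: real
  assumes "0 \<le> x" "0 < c" "1 \<le> R"
  shows "c powr R + R * c powr (R - 1) * (x - c) \<le> x powr R"
proof -
  consider "c < x" | "x = c" | "x < c" by linarith
  then show ?thesis
  proof cases
    case 1
    obtain \<xi> where \<xi>: "c < \<xi>" "\<xi> < x" "x powr R - c powr R = (x - c) * (R * \<xi> powr (R - 1))"
      by (rule powr_mvt[of c x R]) (use 1 assms in auto)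
    have "(x - c) * (R * c powr (R - 1)) \<le> (x - c) * (R * \<xi> powr (R - 1))"
      using \<xi> 1 assms by (intro mult_left_mono powr_mono2) auto
    then show ?thesis using \<xi>(3) by (simp add: mult_ac)
  next
    case 3
    obtain \<xi> where \<xi>: "x < \<xi>" "\<xi> < c" "c powr R - x powr R = (c - x) * (R * \<xi> powr (R - 1))"
      by (rule powr_mvt[of x c R]) (use 3 assms in auto)
    have "(c - x) * (R * \<xi> powr (R - 1)) \<le> (c - x) * (R * c powr (R - 1))"
      using \<xi> 3 assms by (intro mult_left_mono powr_mono2) auto
    then show ?thesis using \<xi>(3) by (simp add: algebra_simps)
  qed simp
qed

text \<open>Jensen's inequality for a/w with respect to the measure of density w. The integral on
  the right may be infinite; the tangent argument treats the finite case.\<close>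

lemma weighted_power_mean:
  fixes a w :: "'a \<Rightarrow> real"
  assumes a: "integrable M a" "AE x in M. 0 \<le> a x" and w: "integrable M w" "AE x in M. 0 < w x" and R: "1 \<le> R"
  shows "ennreal ((\<integral>x. a x \<partial>M) powr R) \<le>
    ennreal ((\<integral>x. w x \<partial>M) powr (R - 1)) * (\<integral>\<^sup>+x. ennreal (a x powr R * w x powr (1 - R)) \<partial>M)"
proof -
  have [measurable]: "a \<in> borel_measurable M" "w \<in> borel_measurable M" using a w by auto
  define I where "I = (\<integral>x. a x \<partial>M)"
  define W where "W = (\<integral>x. w x \<partial>M)"
  define f where "f x = a x powr R * w x powr (1 - R)" for x
  have [measurable]: "f \<in> borel_measurable M" unfolding f_def by measurable
  have W0: "0 \<le> W" unfolding W_def using w(2) by (intro integral_nonneg_AE) (auto elim: eventually_mono)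
  have I0: "0 \<le> I" unfolding I_def using a(2) by (rule integral_nonneg_AE)
  show ?thesis
  proof (cases "I = 0")
    case True
    then show ?thesis by (simp add: I_def[symmetric])
  next
    case False
    then have I: "0 < I" using I0 by simp
    have "W \<noteq> 0"
    proof
      assume "W = 0"
      then have "AE x in M. w x = 0"
        using integral_nonneg_eq_0_iff_AE[OF w(1) eventually_mono[OF w(2) less_imp_le]] by (simp add: W_def)
      with w(2) have "AE x in M. a x = 0" by eventually_elim simp
      then have "I = 0" unfolding I_def by (rule integral_eq_zero_AE)
      with False show False by simp
    qed
    then have W: "0 < W" using W0 by simp
    \<comment> \<open>The mean of a/w with weight w: for this c the linear term of the tangent
      integrates to a multiple of I - c W = 0.\<close>
    define c where "c = I / W"
    have c: "0 < c" "c * W = I" using I W by (auto simp: c_def)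
    show ?thesis
    proof (cases "integrable M f")
      case True
      have "AE x in M. c powr R * w x + R * c powr (R - 1) * (a x - c * w x) \<le> f x"
        using a(2) w(2)
      proof eventually_elim
        case (elim x)
        have "w x * (c powr R + R * c powr (R - 1) * (a x / w x - c)) \<le> w x * (a x / w x) powr R"
          using elim c R by (intro mult_left_mono powr_tangent_le) auto
        also have "\<dots> = f x"
          using elim powr_diff[of "w x" 1 R] by (simp add: f_def powr_divide)
        finally show ?case using elim by (simp add: algebra_simps)
      qed
      then have "(\<integral>x. c powr R * w x + R * c powr (R - 1) * (a x - c * w x) \<partial>M) \<le> (\<integral>x. f x \<partial>M)"
        using a w True by (intro integral_mono_AE) auto
      also have "(\<integral>x. c powr R * w x + R * c powr (R - 1) * (a x - c * w x) \<partial>M)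
        = c powr R * W + R * c powr (R - 1) * (I - c * W)"
        using a w by (simp add: I_def W_def)
      finally have J: "c powr R * W \<le> (\<integral>x. f x \<partial>M)" using c by simp
      have "I powr R = W powr (R - 1) * (c powr R * W)"
        using W c(1) powr_diff[of W R 1] unfolding c(2)[symmetric] by (simp add: powr_mult)
      also have "\<dots> \<le> W powr (R - 1) * (\<integral>x. f x \<partial>M)"
        using J by (intro mult_left_mono) auto
      finally have "ennreal (I powr R) \<le> ennreal (W powr (R - 1)) * ennreal (\<integral>x. f x \<partial>M)"
        by (simp add: ennreal_leI flip: ennreal_mult')
      also have "ennreal (\<integral>x. f x \<partial>M) = (\<integral>\<^sup>+x. f x \<partial>M)"
        by (rule nn_integral_eq_integral[symmetric, OF True]) (simp add: f_def)
      finally show ?thesis by (simp add: I_def W_def f_def)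
    next
      case False
      have "(\<integral>\<^sup>+x. ennreal (f x) \<partial>M) = \<infinity>"
      proof (rule ccontr)
        assume "(\<integral>\<^sup>+x. ennreal (f x) \<partial>M) \<noteq> \<infinity>"
        then have "integrable M f"
          by (intro integrableI_bounded) (auto simp: f_def less_top)
        with False show False ..
      qed
      moreover have "0 < W powr (R - 1)" using W by simp
      ultimately show ?thesis by (simp add: W_def f_def ennreal_mult_top)
    qed
  qed
qed

lemma nn_integral_powr_0_1:
  assumes "-1 < (\<beta>::real)"
  shows "(\<integral>\<^sup>+s. indicator {0..1} s * ennreal (s powr \<beta>) \<partial>lborel) = ennreal (1 / (\<beta> + 1))"
proof -
  have "((\<lambda>s. s powr \<beta>) has_integral (1 powr (\<beta> + 1) / (\<beta> + 1))) {0..1}"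
    by (rule has_integral_powr_from_0) (use assms in auto)
  then have "((\<lambda>s. if s \<in> {0..1} then s powr \<beta> else 0) has_integral (1 / (\<beta> + 1))) UNIV"
    by (subst has_integral_restrict_UNIV) simp
  then have "(\<integral>\<^sup>+s. ennreal (if s \<in> {0..1} then s powr \<beta> else 0) \<partial>lborel) = ennreal (1 / (\<beta> + 1))"
    by (intro nn_integral_has_integral_lborel) auto
  moreover have "(\<integral>\<^sup>+s. indicator {0..1} s * ennreal (s powr \<beta>) \<partial>lborel) =
     (\<integral>\<^sup>+s. ennreal (if s \<in> {0..1} then s powr \<beta> else 0) \<partial>lborel)"
    by (intro nn_integral_cong) (auto simp: indicator_def)
  ultimately show ?thesis by simp
qed

text \<open>This plays the role of a Riesz potential estimate. The increments along the segments
  from x to x + l y are integrated over y, and exchanging the integrals leaves, for each s, the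
  gradient averaged over the ball of radius s l.\<close>

lemma ball_avg_pointwise:
  fixes u :: "'a::euclidean_space \<Rightarrow> real"
  assumes C1: "C1_supported S u g" and l: "0 < l"
  shows "ennreal \<bar>u x - ball_avg l u x\<bar> \<le> ennreal (l / unit_ball_vol (real DIM('a))) *
    (\<integral>\<^sup>+s. indicator {0..1} s * (\<integral>\<^sup>+y. indicator (cball 0 1) y * ennreal (norm (g (x + (s * l) *\<^sub>R y))) \<partial>lborel) \<partial>lborel)"
proof -
  note u = C1_supported_continuous(1)[OF C1, of UNIV]
  note [measurable] = C1_supported_measurable[OF C1]
  let ?\<omega> = "unit_ball_vol (real DIM('a))"
  have "ennreal \<bar>u x - ball_avg l u x\<bar> \<le>
     ennreal (1 / ?\<omega>) * (\<integral>\<^sup>+y. indicator (cball 0 1) y * ennreal \<bar>u (x + l *\<^sub>R y) - u x\<bar> \<partial>lborel)"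
    using ball_avg_diff_le[OF u u, where l=0 and k=l] by (simp add: abs_minus_commute)
  also have "\<dots> \<le> ennreal (1 / ?\<omega>) * (\<integral>\<^sup>+y. \<integral>\<^sup>+s. indicator (cball 0 1) y *
      (indicator {0..1} s * (ennreal l * ennreal (norm (g (x + (s * l) *\<^sub>R y))))) \<partial>lborel \<partial>lborel)"
  proof (intro mult_left_mono nn_integral_mono)
    fix y :: 'a
    have "ennreal \<bar>u (x + l *\<^sub>R y) - u x\<bar> \<le>
      (\<integral>\<^sup>+s. indicator {0..1} s * (ennreal l * ennreal (norm (g (x + (s * l) *\<^sub>R y)))) \<partial>lborel)" if "norm y \<le> 1"
    proof (rule order_trans[OF C1_increment_le[OF C1]], rule nn_integral_mono)
      fix s :: real
      have "norm (g (x + (s * l) *\<^sub>R y)) * (l * norm y) \<le> norm (g (x + (s * l) *\<^sub>R y)) * (l * 1)"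
        using that l by (intro mult_left_mono) auto
      then have "ennreal (norm (g (x + s *\<^sub>R l *\<^sub>R y)) * norm (l *\<^sub>R y)) \<le> ennreal l * ennreal (norm (g (x + (s * l) *\<^sub>R y)))"
        using l by (simp flip: ennreal_mult add: ennreal_leI mult.commute)
      then show "indicator {0..1} s * ennreal (norm (g (x + s *\<^sub>R l *\<^sub>R y)) * norm (l *\<^sub>R y))
         \<le> indicator {0..1} s * (ennreal l * ennreal (norm (g (x + (s * l) *\<^sub>R y))))"
        by (rule mult_left_mono) simp
    qed
    then show "indicator (cball 0 1) y * ennreal \<bar>u (x + l *\<^sub>R y) - u x\<bar> \<le> (\<integral>\<^sup>+s. indicator (cball 0 1) y *
      (indicator {0..1} s * (ennreal l * ennreal (norm (g (x + (s * l) *\<^sub>R y))))) \<partial>lborel)"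
      by (cases "norm y \<le> 1") auto
  qed simp
  also have "(\<integral>\<^sup>+y. \<integral>\<^sup>+s. indicator (cball 0 1) y *
      (indicator {0..1} s * (ennreal l * ennreal (norm (g (x + (s * l) *\<^sub>R y))))) \<partial>lborel \<partial>lborel)
    = (\<integral>\<^sup>+s. \<integral>\<^sup>+y. indicator (cball 0 1) y *
      (indicator {0..1} s * (ennreal l * ennreal (norm (g (x + (s * l) *\<^sub>R y))))) \<partial>lborel \<partial>lborel)"
    by (subst lborel_pair.Fubini') (auto simp: case_prod_unfold)
  also have "\<dots> = (\<integral>\<^sup>+s. ennreal l * (indicator {0..1} s *
      (\<integral>\<^sup>+y. indicator (cball 0 1) y * ennreal (norm (g (x + (s * l) *\<^sub>R y))) \<partial>lborel)) \<partial>lborel)"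
    by (intro nn_integral_cong) (simp flip: nn_integral_cmult add: mult_ac)
  also have "\<dots> = ennreal l * (\<integral>\<^sup>+s. indicator {0..1} s *
      (\<integral>\<^sup>+y. indicator (cball 0 1) y * ennreal (norm (g (x + (s * l) *\<^sub>R y))) \<partial>lborel) \<partial>lborel)"
    by (rule nn_integral_cmult) measurable
  also have "ennreal (1 / ?\<omega>) * (ennreal l * (\<integral>\<^sup>+s. indicator {0..1} s *
      (\<integral>\<^sup>+y. indicator (cball 0 1) y * ennreal (norm (g (x + (s * l) *\<^sub>R y))) \<partial>lborel) \<partial>lborel)) =
    ennreal (l / ?\<omega>) * (\<integral>\<^sup>+s. indicator {0..1} s *
      (\<integral>\<^sup>+y. indicator (cball 0 1) y * ennreal (norm (g (x + (s * l) *\<^sub>R y))) \<partial>lborel) \<partial>lborel)"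
    using l unit_ball_vol_DIM_pos[where 'a='a]
    by (simp flip: mult.assoc ennreal_mult' add: less_imp_le)
  finally show ?thesis .
qed

text \<open>The weight \<open>s powr - \<alpha>\<close> in the power mean over \<open>s\<close> is what makes the remaining integral in \<open>s\<close>
  converge in the whole subcritical range of \<open>R\<close>.\<close>

lemma ball_avg_pointwise_powr:
  fixes u :: "'a::euclidean_space \<Rightarrow> real"
  defines "\<omega> \<equiv> unit_ball_vol (real DIM('a))"
  assumes C1: "C1_supported S u g" and l: "0 < l" and PR: "1 \<le> P" "P \<le> R"
    and E: "\<And>z. norm z \<le> l \<Longrightarrow> x + z \<in> E" "E \<in> sets borel"
    and K: "(\<integral>\<^sup>+z. indicator E z * ennreal (norm (g z) powr P) \<partial>lborel) \<le> ennreal K" "0 \<le> K"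
    and \<alpha>: "0 < \<alpha>" "\<alpha> < 1"
  defines "c \<equiv> l powr R * (1 / (1 - \<alpha>)) powr (R - 1) * (l powr - real DIM('a) * K / \<omega>) powr (R / P - 1) / \<omega>"
  shows "ennreal (\<bar>u x - ball_avg l u x\<bar> powr R) \<le> ennreal c *
    (\<integral>\<^sup>+s. indicator {0..1} s * ennreal (s powr (\<alpha> * (R - 1) - real DIM('a) * (R / P - 1))) *
       (\<integral>\<^sup>+y. indicator (cball 0 1) y * ennreal (norm (g (x + (s * l) *\<^sub>R y)) powr P) \<partial>lborel) \<partial>lborel)"
proof -
  note g = C1_supported_continuous(2)[OF C1, of UNIV]
  note [measurable] = C1_supported_measurable[OF C1] E(2)
  let ?N = "real DIM('a)"
  have \<omega>: "0 < \<omega>" by (simp add: \<omega>_def)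
  let ?B = "restrict_space lborel (cball (0::'a) 1)"
  let ?I = "restrict_space lborel {0..1::real}"
  have cont: "continuous_on UNIV (\<lambda>y. norm (g (x + (s * l) *\<^sub>R y)))" for s
    by (intro continuous_intros continuous_on_compose2[OF g]) auto
  have contP: "continuous_on UNIV (\<lambda>y. norm (g (x + (s * l) *\<^sub>R y)) powr P)" for s
    using PR by (intro continuous_on_powr' cont continuous_intros) auto
  \<comment> \<open>a s is the mean of |g| over the ball of radius s l, and b s is \<omega> times
    the mean of |g|^P there.\<close>
  define a where "a s = (\<integral>y. norm (g (x + (s * l) *\<^sub>R y)) \<partial>?B) / \<omega>" for s
  define b where "b s = (\<integral>\<^sup>+y. indicator (cball 0 1) y * ennreal (norm (g (x + (s * l) *\<^sub>R y)) powr P) \<partial>lborel)" for s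
  have iB: "integrable ?B (\<lambda>y. norm (g (x + (s * l) *\<^sub>R y)))" for s
    by (rule integrable_restrict_space[THEN iffD2], simp, rule borel_integrable_compact, simp,
        rule continuous_on_subset[OF cont], simp)
  have iconst: "integrable ?B (\<lambda>y. k :: real)" for k
    by (rule integrable_restrict_space[THEN iffD2], simp, rule borel_integrable_compact, simp, simp)
  have a_nn: "(\<integral>\<^sup>+y. indicator (cball 0 1) y * ennreal (norm (g (x + (s * l) *\<^sub>R y))) \<partial>lborel) = ennreal (\<omega> * a s)" for s
  proof -
    have "(\<integral>\<^sup>+y. indicator (cball 0 1) y * ennreal (norm (g (x + (s * l) *\<^sub>R y))) \<partial>lborel)
      = (\<integral>\<^sup>+y. norm (g (x + (s * l) *\<^sub>R y)) \<partial>?B)"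
      by (subst nn_integral_restrict_space) (auto simp: mult.commute)
    also have "\<dots> = ennreal (\<integral>y. norm (g (x + (s * l) *\<^sub>R y)) \<partial>?B)"
      by (intro nn_integral_eq_integral iB) auto
    finally show ?thesis using \<omega> by (simp add: a_def)
  qed
  have a0: "0 \<le> a s" for s using \<omega> by (simp add: a_def)
  have [measurable]: "a \<in> borel_measurable borel"
  proof -
    have "a = (\<lambda>s. enn2real (\<integral>\<^sup>+y. indicator (cball 0 1) y * ennreal (norm (g (x + (s * l) *\<^sub>R y))) \<partial>lborel) / \<omega>)"
      using \<omega> a0 by (simp add: a_nn)
    also have "\<dots> \<in> borel_measurable borel" by measurable
    finally show ?thesis .
  qed
  \<comment> \<open>The crude bound by the whole mass K, whose factor s^(-N) blows up as the ball
    shrinks.\<close>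
  have bK: "b s \<le> ennreal ((s * l) powr - ?N * K)" if s: "0 < s" "s \<le> 1" for s
  proof -
    have "b s \<le> (\<integral>\<^sup>+y. indicator E (x + (s * l) *\<^sub>R y) * ennreal (norm (g (x + (s * l) *\<^sub>R y)) powr P) \<partial>lborel)"
      unfolding b_def
    proof (intro nn_integral_mono)
      fix y :: 'a
      have "x + (s * l) *\<^sub>R y \<in> E" if "norm y \<le> 1"
        using s l that mult_mono[of s 1 "l * norm y" l] by (intro E(1)) (auto simp: mult.assoc mult_left_le)
      then show "indicator (cball 0 1) y * ennreal (norm (g (x + (s * l) *\<^sub>R y)) powr P)
         \<le> indicator E (x + (s * l) *\<^sub>R y) * ennreal (norm (g (x + (s * l) *\<^sub>R y)) powr P)"
        by (auto simp: indicator_def)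
    qed
    also have "\<dots> = ennreal ((s * l) powr - ?N) * (\<integral>\<^sup>+z. indicator E z * ennreal (norm (g z) powr P) \<partial>lborel)"
      using s l by (intro nn_integral_lborel_scale) auto
    also have "\<dots> \<le> ennreal ((s * l) powr - ?N) * ennreal K" by (intro mult_left_mono K) simp
    finally show ?thesis using K by (simp add: ennreal_mult)
  qed
  have aP: "ennreal (\<omega> * a s powr P) \<le> b s" for s
  proof -
    have "ennreal ((\<integral>y. norm (g (x + (s * l) *\<^sub>R y)) \<partial>?B) powr P) \<le>
      ennreal ((\<integral>y. 1 \<partial>?B) powr (P - 1)) * (\<integral>\<^sup>+y. ennreal (norm (g (x + (s * l) *\<^sub>R y)) powr P * 1 powr (1 - P)) \<partial>?B)"
      by (rule weighted_power_mean[OF iB _ iconst _ PR(1)]) simp_all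
    also have "(\<integral>y. 1 \<partial>?B) = \<omega>"
      using content_cball[of 1 "0::'a"] by (simp add: \<omega>_def measure_restrict_space)
    also have "(\<integral>\<^sup>+y. ennreal (norm (g (x + (s * l) *\<^sub>R y)) powr P * 1 powr (1 - P)) \<partial>?B) = b s"
      unfolding b_def by (subst nn_integral_restrict_space) (auto simp: mult.commute)
    finally have "ennreal ((\<omega> * a s) powr P) \<le> ennreal (\<omega> powr (P - 1)) * b s"
      using \<omega> by (simp add: a_def)
    then have "ennreal (\<omega> powr (1 - P)) * ennreal ((\<omega> * a s) powr P) \<le> ennreal (\<omega> powr (1 - P)) * (ennreal (\<omega> powr (P - 1)) * b s)"
      by (rule mult_left_mono) simp
    moreover have "ennreal (\<omega> powr (1 - P)) * (ennreal (\<omega> powr (P - 1)) * b s) = b s"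
      using \<omega> by (simp flip: mult.assoc ennreal_mult powr_add)
    moreover have "ennreal (\<omega> powr (1 - P)) * ennreal ((\<omega> * a s) powr P) = ennreal (\<omega> * a s powr P)"
      using \<omega> a0[of s] by (simp add: powr_mult flip: ennreal_mult mult.assoc powr_add)
    ultimately show ?thesis by simp
  qed
  define \<beta> where "\<beta> = \<alpha> * (R - 1) - ?N * (R / P - 1)"
  define d where "d = (l powr - ?N * K / \<omega>) powr (R / P - 1)"
  \<comment> \<open>In a^R = a^P (a^P)^(R/P - 1) only the last factor is estimated crudely by K. The
    factor a^P is kept as b s, to be integrated over x later. The powers of s collected here,
    including the weight, add up to \<beta>.\<close>
  have aR: "ennreal (a s powr R * (s powr - \<alpha>) powr (1 - R)) \<le> ennreal (d / \<omega>) * (ennreal (s powr \<beta>) * b s)"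
    if s: "0 < s" "s \<le> 1" for s
  proof -
    have "ennreal (\<omega> * a s powr P) \<le> ennreal ((s * l) powr - ?N * K)"
      using aP[of s] bK[OF s] by (rule order_trans)
    then have "\<omega> * a s powr P \<le> (s * l) powr - ?N * K"
      using K by (simp add: ennreal_le_iff)
    then have "a s powr P \<le> s powr - ?N * (l powr - ?N * K / \<omega>)"
      using \<omega> s l by (simp add: powr_mult field_simps)
    then have "(a s powr P) powr (R / P - 1) \<le> (s powr - ?N * (l powr - ?N * K / \<omega>)) powr (R / P - 1)"
      using PR by (intro powr_mono2) auto
    also have "\<dots> = s powr (- ?N * (R / P - 1)) * d"
      unfolding d_def by (subst powr_mult) (simp only: powr_powr)
    finally have 1: "(a s powr P) powr (R / P - 1) \<le> s powr (- ?N * (R / P - 1)) * d" .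
    have "a s powr R = a s powr P * (a s powr P) powr (R / P - 1)"
      using PR by (simp add: powr_powr algebra_simps flip: powr_add)
    also have "\<dots> \<le> a s powr P * (s powr (- ?N * (R / P - 1)) * d)"
      using 1 by (intro mult_left_mono) auto
    finally have "a s powr R * (s powr - \<alpha>) powr (1 - R) \<le>
       a s powr P * (s powr (- ?N * (R / P - 1)) * d) * (s powr - \<alpha>) powr (1 - R)"
      by (rule mult_right_mono) simp
    also have "\<dots> = d / \<omega> * s powr \<beta> * (\<omega> * a s powr P)"
      using \<omega> s by (simp add: powr_powr \<beta>_def field_simps flip: powr_add)
    finally have "ennreal (a s powr R * (s powr - \<alpha>) powr (1 - R)) \<le> ennreal (d / \<omega> * s powr \<beta> * (\<omega> * a s powr P))"
      by (rule ennreal_leI)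
    also have "\<dots> = ennreal (d / \<omega> * s powr \<beta>) * ennreal (\<omega> * a s powr P)"
      using \<omega> by (intro ennreal_mult) (auto simp: d_def)
    also have "\<dots> \<le> ennreal (d / \<omega> * s powr \<beta>) * b s" by (intro mult_left_mono aP) simp
    also have "\<dots> = ennreal (d / \<omega>) * (ennreal (s powr \<beta>) * b s)"
      using \<omega> by (subst ennreal_mult) (auto simp: d_def mult.assoc)
    finally show ?thesis .
  qed
  have wI: "integrable ?I (\<lambda>s. s powr - \<alpha>)" "(\<integral>s. s powr - \<alpha> \<partial>?I) = 1 / (1 - \<alpha>)"
  proof -
    have nn: "(\<integral>\<^sup>+s. ennreal (s powr - \<alpha>) \<partial>?I) = ennreal (1 / (1 - \<alpha>))"
      using nn_integral_powr_0_1[of "- \<alpha>"] \<alpha>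
      by (subst nn_integral_restrict_space) (auto simp: mult.commute)
    show "integrable ?I (\<lambda>s. s powr - \<alpha>)"
      by (rule integrableI_nn_integral_finite[OF _ _ nn])
        (use \<alpha> in \<open>auto intro!: measurable_restrict_space1\<close>)
    show "(\<integral>s. s powr - \<alpha> \<partial>?I) = 1 / (1 - \<alpha>)"
      by (rule integral_eq_nn_integral[THEN trans]) (use \<alpha> nn in \<open>auto intro!: measurable_restrict_space1\<close>)
  qed
  have AE0: "AE s in ?I. 0 < s"
  proof -
    have "AE s in lborel. s \<noteq> (0::real)" by (rule AE_lborel_singleton)
    then show ?thesis by (subst AE_restrict_space_iff) (auto elim!: eventually_mono)
  qed
  \<comment> \<open>a is bounded, because g is continuous on the compact ball of radius l around
    x.\<close>
  have aI: "integrable ?I a"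
  proof -
    have "compact (cball x l)" by simp
    then have "bounded (g ` cball x l)"
      by (intro compact_imp_bounded compact_continuous_image continuous_on_subset[OF g]) auto
    then obtain G where G: "\<And>z. z \<in> cball x l \<Longrightarrow> norm (g z) \<le> G"
      by (force simp: bounded_iff)
    have "a s \<le> G" if "s \<in> {0..1}" for s
    proof -
      have "(\<integral>y. norm (g (x + (s * l) *\<^sub>R y)) \<partial>?B) \<le> (\<integral>y. G \<partial>?B)"
      proof (rule integral_mono[OF iB])
        show "integrable ?B (\<lambda>y. G)" by (rule iconst)
        fix y assume "y \<in> space ?B"
        then have "norm y \<le> 1" by (simp add: space_restrict_space)
        then have "norm ((s * l) *\<^sub>R y) \<le> l"
          using that l mult_mono[of s 1 "l * norm y" l] by (auto simp: mult.assoc mult_left_le)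
        then show "norm (g (x + (s * l) *\<^sub>R y)) \<le> G" by (intro G) (simp add: dist_norm)
      qed
      also have "(\<integral>y. G \<partial>?B) = \<omega> * G"
        using content_cball[of 1 "0::'a"] by (simp add: \<omega>_def measure_restrict_space)
      finally show ?thesis using \<omega> by (simp add: a_def divide_le_eq mult.commute)
    qed
    then have "AE s in ?I. norm (a s) \<le> G" using a0 by (intro AE_I2) (auto simp: space_restrict_space)
    moreover have "finite_measure ?I" by (rule finite_measureI) (simp add: emeasure_restrict_space space_restrict_space)
    ultimately show ?thesis
      by (intro finite_measure.integrable_const_bound[of _ _ G]) (auto intro!: measurable_restrict_space1)
  qed
  have "ennreal \<bar>u x - ball_avg l u x\<bar> \<le> ennreal (l * (\<integral>s. a s \<partial>?I))"
  proof -
    have "(\<integral>\<^sup>+s. indicator {0..1} s * ennreal (\<omega> * a s) \<partial>lborel) = (\<integral>\<^sup>+s. \<omega> * a s \<partial>?I)"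
      by (subst nn_integral_restrict_space) (auto simp: mult.commute)
    also have "\<dots> = ennreal (\<integral>s. \<omega> * a s \<partial>?I)"
      using aI a0 \<omega> by (intro nn_integral_eq_integral) auto
    finally have "(\<integral>\<^sup>+s. indicator {0..1} s * ennreal (\<omega> * a s) \<partial>lborel) = ennreal (\<omega> * (\<integral>s. a s \<partial>?I))" by simp
    moreover have "ennreal (l / \<omega>) * ennreal (\<omega> * (\<integral>s. a s \<partial>?I)) = ennreal (l * (\<integral>s. a s \<partial>?I))"
      using \<omega> l a0 by (subst ennreal_mult[symmetric]) (auto intro!: integral_nonneg)
    ultimately show ?thesis
      using ball_avg_pointwise[OF C1 l, of x] by (simp add: a_nn \<omega>_def[symmetric])
  qed
  moreover have I0: "0 \<le> (\<integral>s. a s \<partial>?I)" using a0 by simp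
  ultimately have "\<bar>u x - ball_avg l u x\<bar> \<le> l * (\<integral>s. a s \<partial>?I)"
    using l by (simp add: ennreal_le_iff)
  then have "\<bar>u x - ball_avg l u x\<bar> powr R \<le> (l * (\<integral>s. a s \<partial>?I)) powr R"
    using PR by (intro powr_mono2) auto
  then have "ennreal (\<bar>u x - ball_avg l u x\<bar> powr R) \<le> ennreal (l powr R) * ennreal ((\<integral>s. a s \<partial>?I) powr R)"
    by (simp add: powr_mult ennreal_leI flip: ennreal_mult)
  also have "\<dots> \<le> ennreal (l powr R) * (ennreal ((1 / (1 - \<alpha>)) powr (R - 1)) *
      (\<integral>\<^sup>+s. ennreal (a s powr R * (s powr - \<alpha>) powr (1 - R)) \<partial>?I))"
    unfolding wI(2)[symmetric] using PR AE0
    by (intro mult_left_mono weighted_power_mean aI wI(1)) (auto intro!: a0 elim!: eventually_mono)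
  also have "\<dots> \<le> ennreal (l powr R) * (ennreal ((1 / (1 - \<alpha>)) powr (R - 1)) *
      (\<integral>\<^sup>+s. ennreal (d / \<omega>) * (ennreal (s powr \<beta>) * b s) \<partial>?I))"
  proof (intro mult_left_mono nn_integral_mono_AE)
    show "AE s in ?I. ennreal (a s powr R * (s powr - \<alpha>) powr (1 - R)) \<le> ennreal (d / \<omega>) * (ennreal (s powr \<beta>) * b s)"
      using AE0 AE_space by eventually_elim (rule aR, auto simp: space_restrict_space)
  qed simp_all
  also have "(\<integral>\<^sup>+s. ennreal (d / \<omega>) * (ennreal (s powr \<beta>) * b s) \<partial>?I) =
     (\<integral>\<^sup>+s. ennreal (d / \<omega>) * (indicator {0..1} s * ennreal (s powr \<beta>) * b s) \<partial>lborel)"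
    by (subst nn_integral_restrict_space) (auto simp: mult_ac)
  also have "\<dots> = ennreal (d / \<omega>) * (\<integral>\<^sup>+s. indicator {0..1} s * ennreal (s powr \<beta>) * b s \<partial>lborel)"
    unfolding b_def by (rule nn_integral_cmult) measurable
  also have "ennreal (l powr R) * (ennreal ((1 / (1 - \<alpha>)) powr (R - 1)) * (ennreal (d / \<omega>) *
       (\<integral>\<^sup>+s. indicator {0..1} s * ennreal (s powr \<beta>) * b s \<partial>lborel)))
     = ennreal c * (\<integral>\<^sup>+s. indicator {0..1} s * ennreal (s powr \<beta>) * b s \<partial>lborel)"
    using \<omega> by (simp add: c_def d_def flip: mult.assoc ennreal_mult)
  finally show ?thesis by (simp add: b_def \<beta>_def)
qed

text \<open>The pointwise bound is integrated over E. Each shift x + s l y stays in E', so the inner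
  integral is at most K for all s and y. The condition \<delta> > 0 is subcriticality: for P < N it
  says R < N P / (N - P), and the factor l^\<delta> then makes the error small for small
  radii.\<close>

lemma ball_avg_approx_Lp:
  fixes P R :: real
  defines "\<delta> \<equiv> R - real DIM('a::euclidean_space) * (R / P - 1)"
  assumes PR: "1 \<le> P" "P \<le> R" and \<delta>: "0 < \<delta>"
  obtains C where "0 \<le> C"
    "\<And>S u g l E E' K. C1_supported S (u :: 'a \<Rightarrow> real) g \<Longrightarrow> 0 < l \<Longrightarrow> E \<in> sets borel \<Longrightarrow> E' \<in> sets borel \<Longrightarrow>
       (\<And>x z. x \<in> E \<Longrightarrow> norm z \<le> l \<Longrightarrow> x + z \<in> E') \<Longrightarrow> 0 \<le> K \<Longrightarrow>
       (\<integral>\<^sup>+z. indicator E' z * ennreal (norm (g z) powr P) \<partial>lborel) \<le> ennreal K \<Longrightarrow>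
       (\<integral>\<^sup>+x. indicator E x * ennreal (\<bar>u x - ball_avg l u x\<bar> powr R) \<partial>lborel)
         \<le> ennreal (C * l powr \<delta> * K powr (R / P))"
proof -
  let ?N = "real DIM('a)"
  define \<omega> where "\<omega> = unit_ball_vol ?N"
  have \<omega>: "0 < \<omega>" by (simp add: \<omega>_def)
  \<comment> \<open>With \<alpha> = 1 - \<eta> one gets \<beta> + 1 = \<delta> - \<eta> (R - 1).
    This \<eta> keeps it positive, so s^\<beta> is integrable at 0.\<close>
  define \<eta> where "\<eta> = min (1/2) (\<delta> / (2 * R))"
  have \<eta>: "0 < \<eta>" "\<eta> \<le> 1/2" using \<delta> PR by (auto simp: \<eta>_def)
  have "\<eta> * (R - 1) \<le> \<delta> / (2 * R) * R"
    using \<delta> PR by (intro mult_mono) (auto simp: \<eta>_def)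
  also have "\<dots> < \<delta>" using \<delta> PR by simp
  finally have \<eta>R: "\<eta> * (R - 1) < \<delta>" .
  define \<alpha> where "\<alpha> = 1 - \<eta>"
  have \<alpha>: "0 < \<alpha>" "\<alpha> < 1" using \<eta> by (auto simp: \<alpha>_def)
  define \<beta> where "\<beta> = \<alpha> * (R - 1) - ?N * (R / P - 1)"
  have "\<beta> + 1 = \<delta> - \<eta> * (R - 1)" by (simp add: \<beta>_def \<alpha>_def \<delta>_def algebra_simps)
  then have \<beta>: "0 < \<beta> + 1" using \<eta>R by simp
  define C where "C = (1 / (1 - \<alpha>)) powr (R - 1) * \<omega> powr (1 - R / P) / (\<beta> + 1)"
  show ?thesis
  proof (rule that[of C])
    show "0 \<le> C" using \<beta> by (simp add: C_def)
    fix S u g l E E' and K :: real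
    assume C1: "C1_supported S (u :: 'a \<Rightarrow> real) g" and l: "0 < l" and E: "E \<in> sets borel" and E': "E' \<in> sets borel"
      and sh: "\<And>x z. x \<in> E \<Longrightarrow> norm z \<le> l \<Longrightarrow> x + z \<in> E'" and K0: "0 \<le> K"
      and K: "(\<integral>\<^sup>+z. indicator E' z * ennreal (norm (g z) powr P) \<partial>lborel) \<le> ennreal K"
    note [measurable] = C1_supported_measurable[OF C1] E E'
    define f where "f z = ennreal (norm (g z) powr P)" for z
    have f [measurable]: "f \<in> borel_measurable borel" unfolding f_def by measurable
    define w where "w s = indicator {0..1} s * ennreal (s powr \<beta>)" for s :: real
    have w [measurable]: "w \<in> borel_measurable borel" unfolding w_def by measurable
    define c where "c = l powr R * (1 / (1 - \<alpha>)) powr (R - 1) * (l powr - ?N * K / \<omega>) powr (R / P - 1) / \<omega>"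
    have c0: "0 \<le> c" using \<omega> by (simp add: c_def)
    define T where "T x = (\<integral>\<^sup>+s. w s * (\<integral>\<^sup>+y. indicator (cball 0 1) y * f (x + (s * l) *\<^sub>R y) \<partial>lborel) \<partial>lborel)" for x
    have T [measurable]: "T \<in> borel_measurable borel" unfolding T_def by measurable
    have pt: "indicator E x * ennreal (\<bar>u x - ball_avg l u x\<bar> powr R) \<le> ennreal c * (indicator E x * T x)" for x
    proof (cases "x \<in> E")
      case True
      then have "ennreal (\<bar>u x - ball_avg l u x\<bar> powr R) \<le> ennreal c * T x"
        unfolding T_def w_def c_def f_def \<beta>_def \<omega>_def
        by (intro ball_avg_pointwise_powr[OF C1 l PR sh E' K K0 \<alpha>]) auto
      then show ?thesis using True by simp
    qed simp
    have inner: "(\<integral>\<^sup>+x. indicator E x * f (x + (s * l) *\<^sub>R y) \<partial>lborel) \<le> ennreal K"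
      if "s \<in> {0..1}" "norm y \<le> 1" for s and y :: 'a
    proof -
      have n: "norm ((s * l) *\<^sub>R y) \<le> l"
        using that l mult_mono[of s 1 "l * norm y" l] by (auto simp: mult.assoc mult_left_le)
      have "(\<integral>\<^sup>+x. indicator E x * f (x + (s * l) *\<^sub>R y) \<partial>lborel) \<le>
         (\<integral>\<^sup>+x. indicator E' (x + (s * l) *\<^sub>R y) * f (x + (s * l) *\<^sub>R y) \<partial>lborel)"
        by (intro nn_integral_mono) (auto simp: indicator_def sh[OF _ n])
      also have "\<dots> = (\<integral>\<^sup>+x. indicator E' x * f x \<partial>lborel)"
        by (rule nn_integral_lborel_shift) measurable
      finally show ?thesis using K by (simp add: f_def)
    qed
    have "(\<integral>\<^sup>+x. indicator E x * T x \<partial>lborel) =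
      (\<integral>\<^sup>+x. \<integral>\<^sup>+s. indicator E x * (w s * (\<integral>\<^sup>+y. indicator (cball 0 1) y * f (x + (s * l) *\<^sub>R y) \<partial>lborel)) \<partial>lborel \<partial>lborel)"
      unfolding T_def by (intro nn_integral_cong nn_integral_cmult[symmetric]) measurable
    also have "\<dots> = (\<integral>\<^sup>+s. \<integral>\<^sup>+x. indicator E x * (w s * (\<integral>\<^sup>+y. indicator (cball 0 1) y * f (x + (s * l) *\<^sub>R y) \<partial>lborel)) \<partial>lborel \<partial>lborel)"
      by (rule lborel_pair.Fubini') measurable
    also have "\<dots> \<le> (\<integral>\<^sup>+s. w s * (ennreal K * ennreal \<omega>) \<partial>lborel)"
    proof (rule nn_integral_mono)
      fix s :: real
      have "(\<integral>\<^sup>+x. indicator E x * (w s * (\<integral>\<^sup>+y. indicator (cball 0 1) y * f (x + (s * l) *\<^sub>R y) \<partial>lborel)) \<partial>lborel)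
         = w s * (\<integral>\<^sup>+x. \<integral>\<^sup>+y. indicator E x * (indicator (cball 0 1) y * f (x + (s * l) *\<^sub>R y)) \<partial>lborel \<partial>lborel)"
        by (simp add: nn_integral_cmult mult.left_commute[of _ "w s"])
      also have "(\<integral>\<^sup>+x. \<integral>\<^sup>+y. indicator E x * (indicator (cball 0 1) y * f (x + (s * l) *\<^sub>R y)) \<partial>lborel \<partial>lborel)
        = (\<integral>\<^sup>+y. \<integral>\<^sup>+x. indicator E x * (indicator (cball 0 1) y * f (x + (s * l) *\<^sub>R y)) \<partial>lborel \<partial>lborel)"
        by (rule lborel_pair.Fubini') measurable
      also have "w s * \<dots> \<le> w s * (\<integral>\<^sup>+(y::'a). ennreal K * indicator (cball 0 1) y \<partial>lborel)"
      proof (cases "s \<in> {0..1}")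
        case True
        have "(\<integral>\<^sup>+x. indicator E x * (indicator (cball 0 1) y * f (x + (s * l) *\<^sub>R y)) \<partial>lborel) \<le> ennreal K * indicator (cball 0 1) y" for y :: 'a
          using inner[OF True, of y] by (cases "norm y \<le> 1") auto
        then show ?thesis by (intro mult_left_mono nn_integral_mono) auto
      qed (simp add: w_def)
      also have "(\<integral>\<^sup>+(y::'a). ennreal K * indicator (cball 0 1) y \<partial>lborel) = ennreal K * ennreal \<omega>"
        by (simp add: nn_integral_cmult_indicator emeasure_unit_ball \<omega>_def)
      finally show "(\<integral>\<^sup>+x. indicator E x * (w s * (\<integral>\<^sup>+y. indicator (cball 0 1) y * f (x + (s * l) *\<^sub>R y) \<partial>lborel)) \<partial>lborel)
        \<le> w s * (ennreal K * ennreal \<omega>)" .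
    qed
    also have "\<dots> = (\<integral>\<^sup>+s. w s \<partial>lborel) * (ennreal K * ennreal \<omega>)" by (simp add: nn_integral_multc)
    also have "(\<integral>\<^sup>+s. w s \<partial>lborel) = ennreal (1 / (\<beta> + 1))"
      unfolding w_def using \<beta> by (intro nn_integral_powr_0_1) simp
    finally have Tle: "(\<integral>\<^sup>+x. indicator E x * T x \<partial>lborel) \<le> ennreal (1 / (\<beta> + 1)) * (ennreal K * ennreal \<omega>)" .
    have "(\<integral>\<^sup>+x. indicator E x * ennreal (\<bar>u x - ball_avg l u x\<bar> powr R) \<partial>lborel) \<le> (\<integral>\<^sup>+x. ennreal c * (indicator E x * T x) \<partial>lborel)"
      by (intro nn_integral_mono pt)
    also have "\<dots> = ennreal c * (\<integral>\<^sup>+x. indicator E x * T x \<partial>lborel)" by (rule nn_integral_cmult) measurable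
    also have "\<dots> \<le> ennreal c * (ennreal (1 / (\<beta> + 1)) * (ennreal K * ennreal \<omega>))"
      using Tle by (rule mult_left_mono) simp
    also have "\<dots> = ennreal (c * (1 / (\<beta> + 1) * (K * \<omega>)))"
      using c0 \<beta> K0 \<omega> by (simp add: ennreal_mult del: times_divide_eq_left times_divide_eq_right)
    also have "c * (1 / (\<beta> + 1) * (K * \<omega>)) = C * l powr \<delta> * K powr (R / P)"
    proof -
      have 1: "(l powr - ?N * K / \<omega>) powr (R / P - 1) = l powr (- ?N * (R / P - 1)) * K powr (R / P - 1) * \<omega> powr (1 - R / P)"
      proof -
        have "l powr - ?N * K / \<omega> = l powr - ?N * (K * \<omega> powr - 1)" using \<omega> by (simp add: powr_neg_one)
        then show ?thesis by (simp only: powr_mult powr_powr) (simp add: mult.assoc)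
      qed
      have 2: "l powr R * l powr (- ?N * (R / P - 1)) = l powr \<delta>"
        by (simp add: \<delta>_def flip: powr_add)
      have 3: "K powr (R / P - 1) * K = K powr (R / P)"
        using powr_add[of K "R / P - 1" 1] K0 by (cases "K = 0") auto
      have "c * (1 / (\<beta> + 1) * (K * \<omega>)) = C * (l powr R * l powr (- ?N * (R / P - 1))) * (K powr (R / P - 1) * K)"
        using \<omega> unfolding c_def C_def 1 by (simp add: mult_ac)
      then show ?thesis unfolding 2 3 .
    qed
    finally show "(\<integral>\<^sup>+x. indicator E x * ennreal (\<bar>u x - ball_avg l u x\<bar> powr R) \<partial>lborel)
         \<le> ennreal (C * l powr \<delta> * K powr (R / P))" .
  qed
qed

lemma ex_small_powr:
  fixes A c \<delta> \<rho> :: real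
  assumes "0 \<le> A" "0 < c" "0 < \<delta>" "0 < \<rho>"
  obtains l where "0 < l" "l \<le> \<rho>" "A * l powr \<delta> \<le> c"
proof
  define l where "l = min \<rho> ((c / (A + 1)) powr (1 / \<delta>))"
  show "0 < l" "l \<le> \<rho>" using assms by (auto simp: l_def)
  have "l powr \<delta> \<le> ((c / (A + 1)) powr (1 / \<delta>)) powr \<delta>"
    using assms \<open>0 < l\<close> by (intro powr_mono2) (auto simp: l_def)
  also have "\<dots> = c / (A + 1)" using assms by (simp add: powr_powr)
  finally have "A * l powr \<delta> \<le> A * (c / (A + 1))" using assms by (intro mult_left_mono) auto
  also have "\<dots> \<le> c" using assms by (simp add: field_simps)
  finally show "A * l powr \<delta> \<le> c" .
qed

text \<open>On a small ball the exponents are frozen: |g|^P \<le> 1 + |g|^p, and |u|^r is compared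
  with |u|^R. Then u splits into its deviation from the averages, controlled by K and small with the
  radius l, and the averages, uniformly small by the L^1 hypothesis. The gradient is controlled on
  the ball of radius 2 \<rho> because averaging reaches out by l \<le> \<rho>.\<close>

lemma sobolev_local:
  fixes S :: "'a::euclidean_space set" and p r :: "'a \<Rightarrow> real"
  assumes S: "bounded S" "S \<in> sets borel"
    and [measurable]: "p \<in> borel_measurable borel" "r \<in> borel_measurable borel"
    and PR: "1 \<le> P" "P \<le> R" "real DIM('a) * (R / P - 1) < R" and \<rho>: "0 < \<rho>"
    and pP: "\<And>x. x \<in> S \<Longrightarrow> dist x0 x < 2 * \<rho> \<Longrightarrow> P \<le> p x"
    and rR: "\<And>x. x \<in> S \<Longrightarrow> dist x0 x < \<rho> \<Longrightarrow> 1 \<le> r x \<and> r x \<le> R"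
    and K: "0 \<le> K" and \<epsilon>: "0 < \<epsilon>"
  obtains \<eta> where "0 < \<eta>"
    "\<And>u g. C1_supported S u g \<Longrightarrow>
       (\<integral>\<^sup>+x. indicator S x * ennreal (norm (g x) powr p x) \<partial>lborel) \<le> ennreal K \<Longrightarrow>
       (\<integral>\<^sup>+x. ennreal \<bar>u x\<bar> \<partial>lborel) \<le> ennreal \<eta> \<Longrightarrow>
       (\<integral>\<^sup>+x. indicator (S \<inter> ball x0 \<rho>) x * ennreal (\<bar>u x\<bar> powr r x) \<partial>lborel) \<le> ennreal \<epsilon>"
proof -
  let ?N = "real DIM('a)"
  define \<omega> where "\<omega> = unit_ball_vol ?N"
  have \<omega>: "0 < \<omega>" by (simp add: \<omega>_def)
  define \<delta> where "\<delta> = R - ?N * (R / P - 1)"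
  have \<delta>: "0 < \<delta>" using PR by (simp add: \<delta>_def)
  obtain C where C: "0 \<le> C"
    "\<And>S u g l E E' K. C1_supported S (u :: 'a \<Rightarrow> real) g \<Longrightarrow> 0 < l \<Longrightarrow> E \<in> sets borel \<Longrightarrow> E' \<in> sets borel \<Longrightarrow>
       (\<And>x z. x \<in> E \<Longrightarrow> norm z \<le> l \<Longrightarrow> x + z \<in> E') \<Longrightarrow> 0 \<le> K \<Longrightarrow>
       (\<integral>\<^sup>+z. indicator E' z * ennreal (norm (g z) powr P) \<partial>lborel) \<le> ennreal K \<Longrightarrow>
       (\<integral>\<^sup>+x. indicator E x * ennreal (\<bar>u x - ball_avg l u x\<bar> powr R) \<partial>lborel)
         \<le> ennreal (C * l powr \<delta> * K powr (R / P))"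
    using ball_avg_approx_Lp[OF PR(1,2) \<delta>[unfolded \<delta>_def]] unfolding \<delta>_def by blast
  define m where "m = measure lborel S"
  have m: "emeasure lborel S = ennreal m" "0 \<le> m"
    using emeasure_bounded_finite[OF S(1)] by (simp_all add: m_def emeasure_eq_ennreal_measure less_top[symmetric])
  define K' where "K' = m + K"
  have K': "0 \<le> K'" using m K by (simp add: K'_def)
  \<comment> \<open>Values |u| \<le> t contribute at most t each, as r \<ge> 1, which totals at most
    \<epsilon>/2; larger values satisfy |u|^r \<le> t^(-R) |u|^R.\<close>
  define t where "t = min 1 (\<epsilon> / (2 * (m + 1)))"
  have t: "0 < t" "t \<le> 1" using \<epsilon> m by (auto simp: t_def)
  have tm: "t * m \<le> \<epsilon> / 2"
  proof -
    have "t * m \<le> \<epsilon> / (2 * (m + 1)) * (m + 1)" using m \<epsilon> by (intro mult_mono) (auto simp: t_def)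
    also have "\<dots> = \<epsilon> / 2" using m by (simp add: field_simps)
    finally show ?thesis .
  qed
  define D where "D = t powr - R * 2 powr R"
  have D: "0 \<le> D" by (simp add: D_def)
  \<comment> \<open>The radius is fixed before \<eta>: the bound for the averages carries a factor
    l^(-N), which \<eta> then has to beat.\<close>
  obtain l where l: "0 < l" "l \<le> \<rho>" "D * (C * K' powr (R / P)) * l powr \<delta> \<le> \<epsilon> / 4"
    using ex_small_powr[of "D * (C * K' powr (R / P))" "\<epsilon> / 4" \<delta> \<rho>] D C(1) \<epsilon> \<delta> \<rho> by auto
  obtain \<eta> where \<eta>: "0 < \<eta>" "\<eta> \<le> 1" "D * m * (l powr - ?N / \<omega>) powr R * \<eta> powr R \<le> \<epsilon> / 4"
    using ex_small_powr[of "D * m * (l powr - ?N / \<omega>) powr R" "\<epsilon> / 4" R 1] D m \<epsilon> PR by auto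
  show ?thesis
  proof (rule that[OF \<eta>(1)])
    fix u g assume C1: "C1_supported S u g"
      and gK: "(\<integral>\<^sup>+x. indicator S x * ennreal (norm (g x) powr p x) \<partial>lborel) \<le> ennreal K"
      and uL: "(\<integral>\<^sup>+x. ennreal \<bar>u x\<bar> \<partial>lborel) \<le> ennreal \<eta>"
    note [measurable] = C1_supported_measurable[OF C1] S(2) ball_avg_measurable[OF C1_supported_measurable(1)[OF C1], of l]
    let ?E = "S \<inter> ball x0 \<rho>" and ?E' = "ball x0 (2 * \<rho>)"
    have E [measurable]: "?E \<in> sets borel" by measurable
    have "(\<integral>\<^sup>+z. indicator ?E' z * ennreal (norm (g z) powr P) \<partial>lborel) \<le>
       (\<integral>\<^sup>+z. indicator S z + indicator S z * ennreal (norm (g z) powr p z) \<partial>lborel)"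
    proof (rule nn_integral_mono)
      fix z
      show "indicator ?E' z * ennreal (norm (g z) powr P) \<le> indicator S z + indicator S z * ennreal (norm (g z) powr p z)"
      proof (cases "z \<in> S \<and> z \<in> ?E'")
        case True
        then have "P \<le> p z" using pP by auto
        then have "norm (g z) powr P \<le> 1 + norm (g z) powr p z"
        proof (cases "norm (g z) \<le> 1")
          case True
          then have "norm (g z) powr P \<le> 1" using PR by (simp add: powr_le1)
          then show ?thesis by (simp add: add_increasing2)
        next
          case False
          with \<open>P \<le> p z\<close> have "norm (g z) powr P \<le> norm (g z) powr p z" by (intro powr_mono) auto
          then show ?thesis by simp
        qed
        then have "ennreal (norm (g z) powr P) \<le> ennreal (1 + norm (g z) powr p z)" by (rule ennreal_leI)
        then show ?thesis using True by (simp add: ennreal_plus)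
      qed (use C1 in \<open>auto simp: C1_supported_def indicator_def\<close>)
    qed
    also have "\<dots> = ennreal m + (\<integral>\<^sup>+z. indicator S z * ennreal (norm (g z) powr p z) \<partial>lborel)"
      by (subst nn_integral_add) (auto simp: m)
    also have "\<dots> \<le> ennreal m + ennreal K" by (intro add_left_mono gK)
    also have "\<dots> = ennreal K'" using m K by (simp add: K'_def)
    finally have gP: "(\<integral>\<^sup>+z. indicator ?E' z * ennreal (norm (g z) powr P) \<partial>lborel) \<le> ennreal K'" .
    have "x + z \<in> ?E'" if "x \<in> ?E" "norm z \<le> l" for x z
    proof -
      have "dist x0 (x + z) \<le> dist x0 x + dist x (x + z)" by (rule dist_triangle)
      also have "dist x (x + z) = norm z" by (simp add: dist_norm)
      finally show ?thesis using that l by auto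
    qed
    then have uA: "(\<integral>\<^sup>+x. indicator ?E x * ennreal (\<bar>u x - ball_avg l u x\<bar> powr R) \<partial>lborel) \<le> ennreal (C * l powr \<delta> * K' powr (R / P))"
      by (intro C(2)[OF C1 l(1) E _ _ K' gP]) auto
    define Q where "Q = l powr - ?N / \<omega> * \<eta>"
    have Q0: "0 \<le> Q" using \<omega> \<eta> by (simp add: Q_def)
    have AQ: "\<bar>ball_avg l u x\<bar> \<le> Q" for x
    proof -
      have "ennreal \<bar>ball_avg l u x\<bar> \<le> ennreal (l powr - ?N / \<omega>) * (\<integral>\<^sup>+z. ennreal \<bar>u z\<bar> \<partial>lborel)"
        using ball_avg_le_L1[OF C1_supported_continuous(1)[OF C1] continuous_on_const[of _ 0] l(1), of x]
        by (simp add: ball_avg_zero_fun \<omega>_def)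
      also have "\<dots> \<le> ennreal (l powr - ?N / \<omega>) * ennreal \<eta>" by (intro mult_left_mono uL) simp
      also have "\<dots> = ennreal Q" unfolding Q_def using \<omega> \<eta> by (intro ennreal_mult[symmetric]) auto
      finally show ?thesis using Q0 by (simp add: ennreal_le_iff)
    qed
    have pt: "\<bar>u x\<bar> powr r x \<le> t + D * (\<bar>u x - ball_avg l u x\<bar> powr R + Q powr R)" if x: "x \<in> ?E" for x
    proof -
      have r: "1 \<le> r x" "r x \<le> R" using rR x by auto
      have 1: "\<bar>u x\<bar> powr r x \<le> t + t powr - R * \<bar>u x\<bar> powr R"
      proof (cases "\<bar>u x\<bar> \<le> t")
        case True
        then have "\<bar>u x\<bar> powr r x \<le> t powr r x" using r by (intro powr_mono2) auto
        also have "\<dots> \<le> t powr 1" using r t by (intro powr_mono') auto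
        finally show ?thesis using t by (simp add: add_increasing2)
      next
        case False
        have "\<bar>u x\<bar> powr r x = t powr r x * (\<bar>u x\<bar> / t) powr r x"
          using t by (simp add: powr_divide)
        also have "\<dots> \<le> 1 * (\<bar>u x\<bar> / t) powr R"
          using False t r by (intro mult_mono powr_mono powr_le1) auto
        also have "\<dots> = t powr - R * \<bar>u x\<bar> powr R" using t by (simp add: powr_divide powr_minus field_simps)
        finally show ?thesis using t by simp
      qed
      have "\<bar>u x\<bar> powr R \<le> 2 powr R * (\<bar>u x - ball_avg l u x\<bar> powr R + \<bar>ball_avg l u x\<bar> powr R)"
        using norm_add_powr_le[of R "u x - ball_avg l u x" "ball_avg l u x"] PR by simp
      also have "\<dots> \<le> 2 powr R * (\<bar>u x - ball_avg l u x\<bar> powr R + Q powr R)"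
        using PR AQ by (intro mult_left_mono add_left_mono powr_mono2) auto
      finally have "t powr - R * \<bar>u x\<bar> powr R \<le> t powr - R * (2 powr R * (\<bar>u x - ball_avg l u x\<bar> powr R + Q powr R))"
        by (rule mult_left_mono) simp
      then show ?thesis using 1 by (simp add: D_def mult.assoc)
    qed
    have "(\<integral>\<^sup>+x. indicator ?E x * ennreal (\<bar>u x\<bar> powr r x) \<partial>lborel) \<le>
      (\<integral>\<^sup>+x. ennreal (t + D * Q powr R) * indicator ?E x + ennreal D * (indicator ?E x * ennreal (\<bar>u x - ball_avg l u x\<bar> powr R)) \<partial>lborel)"
    proof (rule nn_integral_mono)
      fix x
      have "ennreal (\<bar>u x\<bar> powr r x) \<le> ennreal (t + D * Q powr R) + ennreal D * ennreal (\<bar>u x - ball_avg l u x\<bar> powr R)" if "x \<in> ?E"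
        using pt[OF that] D t by (simp flip: ennreal_plus ennreal_mult add: ennreal_leI algebra_simps)
      then show "indicator ?E x * ennreal (\<bar>u x\<bar> powr r x) \<le> ennreal (t + D * Q powr R) * indicator ?E x
         + ennreal D * (indicator ?E x * ennreal (\<bar>u x - ball_avg l u x\<bar> powr R))"
        by (auto simp: indicator_def)
    qed
    also have "\<dots> = ennreal (t + D * Q powr R) * emeasure lborel ?E +
        ennreal D * (\<integral>\<^sup>+x. indicator ?E x * ennreal (\<bar>u x - ball_avg l u x\<bar> powr R) \<partial>lborel)"
      by (subst nn_integral_add) (auto simp: nn_integral_cmult nn_integral_cmult_indicator)
    also have "\<dots> \<le> ennreal (t + D * Q powr R) * ennreal m + ennreal D * ennreal (C * l powr \<delta> * K' powr (R / P))"
      unfolding m(1)[symmetric] by (intro add_mono mult_left_mono uA emeasure_mono) (auto simp: S(2))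
    also have "\<dots> = ennreal ((t + D * Q powr R) * m + D * (C * l powr \<delta> * K' powr (R / P)))"
      using t D m C(1) by (simp add: ennreal_mult ennreal_plus)
    also have "\<dots> \<le> ennreal \<epsilon>"
    proof (rule ennreal_leI)
      have "D * Q powr R * m = D * m * (l powr - ?N / \<omega>) powr R * \<eta> powr R"
        unfolding Q_def by (subst powr_mult) (simp add: mult_ac)
      moreover have "D * (C * l powr \<delta> * K' powr (R / P)) = D * (C * K' powr (R / P)) * l powr \<delta>"
        by (simp add: mult_ac)
      ultimately show "(t + D * Q powr R) * m + D * (C * l powr \<delta> * K' powr (R / P)) \<le> \<epsilon>"
        unfolding distrib_right using tm l(3) \<eta>(3) by linarith
    qed
    finally show "(\<integral>\<^sup>+x. indicator (S \<inter> ball x0 \<rho>) x * ennreal (\<bar>u x\<bar> powr r x) \<partial>lborel) \<le> ennreal \<epsilon>" .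
  qed
qed

text \<open>Scaling turns this into the embedding, and \<open>rellich_L1\<close> into its compactness.\<close>

lemma sobolev_interpolation:
  fixes S :: "'a::euclidean_space set" and p r :: "'a \<Rightarrow> real"
  assumes S: "open S" "bounded S"
    and p: "continuous_on (closure S) p" and r: "continuous_on (closure S) r"
    and p1: "\<And>x. x \<in> closure S \<Longrightarrow> 1 < p x" and pN: "\<And>x. x \<in> closure S \<Longrightarrow> p x < real DIM('a)"
    and r1: "\<And>x. x \<in> closure S \<Longrightarrow> 1 \<le> r x"
    and rp: "\<And>x. x \<in> closure S \<Longrightarrow> r x < real DIM('a) * p x / (real DIM('a) - p x)"
    and K: "0 \<le> K" and \<epsilon>: "0 < \<epsilon>"
  obtains \<eta> where "0 < \<eta>"
    "\<And>u g. C1_supported S u g \<Longrightarrow>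
       (\<integral>\<^sup>+x. indicator S x * ennreal (norm (g x) powr p x) \<partial>lborel) \<le> ennreal K \<Longrightarrow>
       (\<integral>\<^sup>+x. ennreal \<bar>u x\<bar> \<partial>lborel) \<le> ennreal \<eta> \<Longrightarrow>
       (\<integral>\<^sup>+x. indicator S x * ennreal (\<bar>u x\<bar> powr r x) \<partial>lborel) \<le> ennreal \<epsilon>"
proof -
  let ?N = "real DIM('a)"
  \<comment> \<open>Extended by 0 off the closure, the exponents become Borel functions on the whole
    space.\<close>
  define p' where "p' x = indicator (closure S) x *\<^sub>R p x" for x
  define r' where "r' x = indicator (closure S) x *\<^sub>R r x" for x
  have [measurable]: "p' \<in> borel_measurable borel" "r' \<in> borel_measurable borel"
    unfolding p'_def r'_def by (intro borel_measurable_continuous_on_indicator p r; simp)+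
  have Sb: "S \<in> sets borel" using S by simp
  have eq: "p' x = p x" "r' x = r x" if "x \<in> closure S" for x using that by (auto simp: p'_def r'_def)
  have sub: "x \<in> closure S" if "x \<in> S" for x using that closure_subset by blast
  have loc: "\<exists>\<rho>>0. \<exists>P R. 1 \<le> P \<and> P \<le> R \<and> ?N * (R / P - 1) < R \<and>
     (\<forall>x\<in>S. dist x0 x < 2 * \<rho> \<longrightarrow> P \<le> p' x) \<and> (\<forall>x\<in>S. dist x0 x < \<rho> \<longrightarrow> 1 \<le> r' x \<and> r' x \<le> R)"
    if x0: "x0 \<in> closure S" for x0
  proof -
    \<comment> \<open>Taking in p as well as r ensures P \<le> R below, and it stays subcritical
      because p x0 < N p x0 / (N - p x0).\<close>
    define q where "q = max (r x0) (p x0)"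
    have pb: "1 < p x0" "p x0 < ?N" using p1 pN x0 by auto
    have "r x0 * (?N - p x0) < ?N * p x0"
      using rp[OF x0] pb by (simp add: pos_less_divide_eq)
    moreover have "p x0 * (?N - p x0) < p x0 * ?N"
      using pb by (intro mult_strict_left_mono) auto
    ultimately have "(q + 0) * (?N - (p x0 - 0)) - ?N * (p x0 - 0) < 0"
      by (simp add: q_def max_def mult.commute)
    \<comment> \<open>The inequality is strict at h = 0 and persists for small positive h. This is
      the room for lowering the gradient exponent and raising the other one.\<close>
    moreover have "((\<lambda>h. (q + h) * (?N - (p x0 - h)) - ?N * (p x0 - h)) \<longlongrightarrow>
        (q + 0) * (?N - (p x0 - 0)) - ?N * (p x0 - 0)) (at_right 0)"
      by (intro tendsto_intros)
    ultimately have "\<forall>\<^sub>F h in at_right 0. (q + h) * (?N - (p x0 - h)) - ?N * (p x0 - h) < 0"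
      by (rule order_tendstoD(2)[rotated])
    moreover have "\<forall>\<^sub>F h in at_right 0. h < p x0 - 1"
      using pb by (intro order_tendstoD(2)[OF tendsto_ident_at]) auto
    moreover have "\<forall>\<^sub>F h in at_right (0::real). 0 < h" by (rule eventually_at_right_less)
    ultimately have "\<forall>\<^sub>F h in at_right 0. (q + h) * (?N - (p x0 - h)) - ?N * (p x0 - h) < 0 \<and> h < p x0 - 1 \<and> 0 < h"
      by eventually_elim auto
    then obtain h where h: "(q + h) * (?N - (p x0 - h)) < ?N * (p x0 - h)" "h < p x0 - 1" "0 < h"
      using eventually_happens'[OF trivial_limit_at_right_real] by (metis (no_types, lifting) diff_less_0_iff_less)
    define P where "P = p x0 - h"
    define R where "R = q + h"
    have P: "1 \<le> P" "P \<le> R" using h by (auto simp: P_def R_def q_def)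
    have "R * (?N - P) < ?N * P" using h by (simp add: P_def R_def)
    then have NR: "?N * (R / P - 1) < R" using P by (simp add: field_simps)
    obtain d1 where d1: "0 < d1" "\<And>x. x \<in> closure S \<Longrightarrow> dist x x0 < d1 \<Longrightarrow> dist (p x) (p x0) < h"
      using p x0 h(3) unfolding continuous_on_iff by blast
    obtain d2 where d2: "0 < d2" "\<And>x. x \<in> closure S \<Longrightarrow> dist x x0 < d2 \<Longrightarrow> dist (r x) (r x0) < h"
      using r x0 h(3) unfolding continuous_on_iff by blast
    define \<rho> where "\<rho> = min d1 d2 / 2"
    have "0 < \<rho>" using d1 d2 by (simp add: \<rho>_def)
    moreover have "P \<le> p' x" if "x \<in> S" "dist x0 x < 2 * \<rho>" for x
      using d1(2)[OF sub[OF that(1)]] that eq[OF sub[OF that(1)]]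
      by (auto simp: \<rho>_def P_def dist_real_def dist_commute)
    moreover have "1 \<le> r' x \<and> r' x \<le> R" if "x \<in> S" "dist x0 x < \<rho>" for x
    proof -
      have "dist x x0 < d2" using that d1 d2 by (simp add: \<rho>_def dist_commute)
      then have "dist (r x) (r x0) < h" using d2 sub that by blast
      then show ?thesis using r1[OF sub[OF that(1)]] eq[OF sub[OF that(1)]]
        by (auto simp: R_def q_def dist_real_def)
    qed
    ultimately show ?thesis using P NR by blast
  qed
  then obtain \<rho> where \<rho>: "\<And>x0. x0 \<in> closure S \<Longrightarrow> 0 < \<rho> x0" and
    PRex: "\<And>x0. x0 \<in> closure S \<Longrightarrow> \<exists>P R. 1 \<le> P \<and> P \<le> R \<and> ?N * (R / P - 1) < R \<and>
     (\<forall>x\<in>S. dist x0 x < 2 * \<rho> x0 \<longrightarrow> P \<le> p' x) \<and> (\<forall>x\<in>S. dist x0 x < \<rho> x0 \<longrightarrow> 1 \<le> r' x \<and> r' x \<le> R)"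
    by metis
  have "compact (closure S)" using S by (simp add: compact_closure)
  moreover have "closure S \<subseteq> (\<Union>x\<in>closure S. ball x (\<rho> x))" using \<rho> by force
  ultimately obtain F where F: "F \<subseteq> closure S" "finite F" "closure S \<subseteq> (\<Union>x\<in>F. ball x (\<rho> x))"
    using compactE_image[of "closure S" "closure S" "\<lambda>x. ball x (\<rho> x)"] by auto
  define \<epsilon>' where "\<epsilon>' = \<epsilon> / real (card F + 1)"
  have \<epsilon>': "0 < \<epsilon>'" using \<epsilon> by (simp add: \<epsilon>'_def)
  have "\<forall>x0\<in>F. \<exists>\<eta>. 0 < \<eta> \<and> (\<forall>u g. C1_supported S u g \<longrightarrow>
       (\<integral>\<^sup>+x. indicator S x * ennreal (norm (g x) powr p' x) \<partial>lborel) \<le> ennreal K \<longrightarrow>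
       (\<integral>\<^sup>+x. ennreal \<bar>u x\<bar> \<partial>lborel) \<le> ennreal \<eta> \<longrightarrow>
       (\<integral>\<^sup>+x. indicator (S \<inter> ball x0 (\<rho> x0)) x * ennreal (\<bar>u x\<bar> powr r' x) \<partial>lborel) \<le> ennreal \<epsilon>')"
  proof
    fix x0 assume "x0 \<in> F"
    then have x0: "x0 \<in> closure S" using F by auto
    obtain P R where PR: "1 \<le> P" "P \<le> R" "?N * (R / P - 1) < R"
     "\<And>x. x\<in>S \<Longrightarrow> dist x0 x < 2 * \<rho> x0 \<Longrightarrow> P \<le> p' x" "\<And>x. x\<in>S \<Longrightarrow> dist x0 x < \<rho> x0 \<Longrightarrow> 1 \<le> r' x \<and> r' x \<le> R"
      using PRex[OF x0] by blast
    obtain \<eta> where "0 < \<eta>"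
    "\<And>u g. C1_supported S u g \<Longrightarrow>
       (\<integral>\<^sup>+x. indicator S x * ennreal (norm (g x) powr p' x) \<partial>lborel) \<le> ennreal K \<Longrightarrow>
       (\<integral>\<^sup>+x. ennreal \<bar>u x\<bar> \<partial>lborel) \<le> ennreal \<eta> \<Longrightarrow>
       (\<integral>\<^sup>+x. indicator (S \<inter> ball x0 (\<rho> x0)) x * ennreal (\<bar>u x\<bar> powr r' x) \<partial>lborel) \<le> ennreal \<epsilon>'"
      by (rule sobolev_local[of S p' r' P R "\<rho> x0" x0 K \<epsilon>']) (use S Sb PR \<rho>[OF x0] K \<epsilon>' in auto)
    then show "\<exists>\<eta>. 0 < \<eta> \<and> (\<forall>u g. C1_supported S u g \<longrightarrow>
       (\<integral>\<^sup>+x. indicator S x * ennreal (norm (g x) powr p' x) \<partial>lborel) \<le> ennreal K \<longrightarrow>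
       (\<integral>\<^sup>+x. ennreal \<bar>u x\<bar> \<partial>lborel) \<le> ennreal \<eta> \<longrightarrow>
       (\<integral>\<^sup>+x. indicator (S \<inter> ball x0 (\<rho> x0)) x * ennreal (\<bar>u x\<bar> powr r' x) \<partial>lborel) \<le> ennreal \<epsilon>')"
      by blast
  qed
  from bchoice[OF this] obtain \<eta> where \<eta>: "\<forall>x0\<in>F. 0 < \<eta> x0 \<and> (\<forall>u g. C1_supported S u g \<longrightarrow>
       (\<integral>\<^sup>+x. indicator S x * ennreal (norm (g x) powr p' x) \<partial>lborel) \<le> ennreal K \<longrightarrow>
       (\<integral>\<^sup>+x. ennreal \<bar>u x\<bar> \<partial>lborel) \<le> ennreal (\<eta> x0) \<longrightarrow>
       (\<integral>\<^sup>+x. indicator (S \<inter> ball x0 (\<rho> x0)) x * ennreal (\<bar>u x\<bar> powr r' x) \<partial>lborel) \<le> ennreal \<epsilon>')"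
    by blast
  \<comment> \<open>The element 1 keeps the minimum defined when the cover is empty.\<close>
  define \<eta>0 where "\<eta>0 = Min (insert 1 (\<eta> ` F))"
  have \<eta>0: "0 < \<eta>0" "\<And>x. x \<in> F \<Longrightarrow> \<eta>0 \<le> \<eta> x"
    using \<eta> F(2) by (auto simp: \<eta>0_def)
  show ?thesis
  proof (rule that[OF \<eta>0(1)])
    fix u g assume C1: "C1_supported S u g"
      and gK: "(\<integral>\<^sup>+x. indicator S x * ennreal (norm (g x) powr p x) \<partial>lborel) \<le> ennreal K"
      and uL: "(\<integral>\<^sup>+x. ennreal \<bar>u x\<bar> \<partial>lborel) \<le> ennreal \<eta>0"
    note [measurable] = C1_supported_measurable[OF C1] Sb
    have [measurable]: "ball y d \<in> sets borel" for y :: 'a and d by simp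
    have gK': "(\<integral>\<^sup>+x. indicator S x * ennreal (norm (g x) powr p' x) \<partial>lborel) \<le> ennreal K"
    proof -
      have "(\<integral>\<^sup>+x. indicator S x * ennreal (norm (g x) powr p' x) \<partial>lborel) = (\<integral>\<^sup>+x. indicator S x * ennreal (norm (g x) powr p x) \<partial>lborel)"
        by (intro nn_integral_cong) (auto simp: indicator_def eq sub)
      then show ?thesis using gK by simp
    qed
    have "(\<integral>\<^sup>+x. indicator S x * ennreal (\<bar>u x\<bar> powr r x) \<partial>lborel) \<le>
       (\<integral>\<^sup>+x. (\<Sum>x0\<in>F. indicator (S \<inter> ball x0 (\<rho> x0)) x * ennreal (\<bar>u x\<bar> powr r' x)) \<partial>lborel)"
    proof (rule nn_integral_mono)
      fix x
      show "indicator S x * ennreal (\<bar>u x\<bar> powr r x) \<le> (\<Sum>x0\<in>F. indicator (S \<inter> ball x0 (\<rho> x0)) x * ennreal (\<bar>u x\<bar> powr r' x))"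
      proof (cases "x \<in> S")
        case True
        then obtain x0 where "x0 \<in> F" "x \<in> ball x0 (\<rho> x0)" using F(3) sub by blast
        then have "indicator S x * ennreal (\<bar>u x\<bar> powr r x) = indicator (S \<inter> ball x0 (\<rho> x0)) x * ennreal (\<bar>u x\<bar> powr r' x)"
          using True eq sub by simp
        also have "\<dots> \<le> (\<Sum>x0\<in>F. indicator (S \<inter> ball x0 (\<rho> x0)) x * ennreal (\<bar>u x\<bar> powr r' x))"
          using \<open>x0 \<in> F\<close> F(2) by (intro member_le_sum) auto
        finally show ?thesis .
      qed simp
    qed
    also have "\<dots> = (\<Sum>x0\<in>F. \<integral>\<^sup>+x. indicator (S \<inter> ball x0 (\<rho> x0)) x * ennreal (\<bar>u x\<bar> powr r' x) \<partial>lborel)"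
      by (rule nn_integral_sum) measurable
    also have "\<dots> \<le> (\<Sum>x0\<in>F. ennreal \<epsilon>')"
    proof (rule sum_mono)
      fix x0 assume x0: "x0 \<in> F"
      show "(\<integral>\<^sup>+x. indicator (S \<inter> ball x0 (\<rho> x0)) x * ennreal (\<bar>u x\<bar> powr r' x) \<partial>lborel) \<le> ennreal \<epsilon>'"
        using \<eta> x0 C1 gK' order_trans[OF uL ennreal_leI[OF \<eta>0(2)[OF x0]]] by blast
    qed
    also have "\<dots> = ennreal (real (card F) * \<epsilon>')"
      using \<epsilon>' by (simp add: ennreal_mult ennreal_of_nat_eq_real_of_nat)
    also have "\<dots> \<le> ennreal \<epsilon>"
      using \<epsilon> by (intro ennreal_leI) (simp add: \<epsilon>'_def field_simps)
    finally show "(\<integral>\<^sup>+x. indicator S x * ennreal (\<bar>u x\<bar> powr r x) \<partial>lborel) \<le> ennreal \<epsilon>" .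
  qed
qed

section \<open>Test functions and weak gradients\<close>

lemma Ck_fun_SucI:
  assumes "\<And>x. (f has_derivative f' x) (at x)" "\<And>v. Ck_fun k (\<lambda>x. f' x v)"
  shows "Ck_fun (Suc k) f"
proof -
  have "frechet_derivative f (at x) = f' x" for x
    using frechet_derivative_at[OF assms(1)[of x]] by simp
  then show ?thesis using assms by (auto simp: differentiable_def)
qed

lemma Ck_fun_SucD:
  assumes "Ck_fun (Suc k) f"
  shows "(f has_derivative frechet_derivative f (at x)) (at x)" "Ck_fun k (\<lambda>x. frechet_derivative f (at x) v)"
  using assms by (auto simp: frechet_derivative_works)

lemma Ck_fun_Suc_imp: "Ck_fun (Suc k) f \<Longrightarrow> Ck_fun k f"
proof (induction k arbitrary: f)
  case 0
  then show ?case
    by (auto intro!: continuous_at_imp_continuous_on differentiable_imp_continuous_within)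
next
  case (Suc k)
  show ?case
    by (rule Ck_fun_SucI[OF Ck_fun_SucD(1)[OF Suc.prems] Suc.IH[OF Ck_fun_SucD(2)[OF Suc.prems]]])
qed

lemma Ck_fun_const: "Ck_fun k (\<lambda>_. c)"
proof (induction k arbitrary: c)
  case (Suc k)
  show ?case by (rule Ck_fun_SucI[where f'="\<lambda>_ _. 0"]) (auto intro: Suc)
qed simp

lemma Ck_fun_add: "Ck_fun k f \<Longrightarrow> Ck_fun k g \<Longrightarrow> Ck_fun k (\<lambda>x. f x + g x)"
proof (induction k arbitrary: f g)
  case 0 then show ?case by (auto intro: continuous_intros)
next
  case (Suc k)
  note f = Ck_fun_SucD[OF Suc.prems(1)] and g = Ck_fun_SucD[OF Suc.prems(2)]
  show ?case by (rule Ck_fun_SucI[OF has_derivative_add[OF f(1) g(1)] Suc.IH[OF f(2) g(2)]])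
qed

text \<open>The product rule retains undifferentiated factors, hence the descent by
  \<open>Ck_fun_Suc_imp\<close>.\<close>

lemma Ck_fun_mult: "Ck_fun k f \<Longrightarrow> Ck_fun k g \<Longrightarrow> Ck_fun k (\<lambda>x. f x * g x)"
proof (induction k arbitrary: f g)
  case 0 then show ?case by (auto intro: continuous_intros)
next
  case (Suc k)
  note f = Ck_fun_SucD[OF Suc.prems(1)] and g = Ck_fun_SucD[OF Suc.prems(2)]
  show ?case
    by (rule Ck_fun_SucI[OF has_derivative_mult[OF f(1) g(1)]])
      (intro Ck_fun_add Suc.IH Ck_fun_Suc_imp[OF Suc.prems(1)] Ck_fun_Suc_imp[OF Suc.prems(2)] f(2) g(2))
qed

lemma smooth_fun_add: "smooth_fun f \<Longrightarrow> smooth_fun g \<Longrightarrow> smooth_fun (\<lambda>x. f x + g x)"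
  by (simp add: smooth_fun_def Ck_fun_add)

lemma smooth_fun_mult: "smooth_fun f \<Longrightarrow> smooth_fun g \<Longrightarrow> smooth_fun (\<lambda>x. f x * g x)"
  by (simp add: smooth_fun_def Ck_fun_mult)

lemma smooth_fun_const: "smooth_fun (\<lambda>_. c)"
  by (simp add: smooth_fun_def Ck_fun_const)

lemma smooth_fun_prod:
  "finite I \<Longrightarrow> (\<And>i. i \<in> I \<Longrightarrow> smooth_fun (f i)) \<Longrightarrow> smooth_fun (\<lambda>x. \<Prod>i\<in>I. f i x)"
  by (induction I rule: finite_induct) (auto intro: smooth_fun_mult smooth_fun_const)

text \<open>For n = 0 this is the standard smooth function that vanishes to infinite order at 0. The
  powers of 1/t are included because the family is then closed under differentiation up to linear
  combinations, so that smoothness becomes one induction.\<close>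

definition flat :: "nat \<Rightarrow> real \<Rightarrow> real" where
  "flat n t = (if 0 < t then (1 / t) ^ n * exp (- 1 / t) else 0)"

lemma flat_tendsto_0: "((\<lambda>t. flat n t) \<longlongrightarrow> 0) (at_right 0)"
proof -
  have "((\<lambda>t. (inverse t) ^ n / exp (inverse t)) \<longlongrightarrow> (0::real)) (at_right 0)"
    by (rule filterlim_compose[OF tendsto_power_div_exp_0 filterlim_inverse_at_top_right])
  moreover have "\<forall>\<^sub>F t in at_right 0. (inverse t) ^ n / exp (inverse t) = flat n t"
    using eventually_at_right_less[of 0]
  proof eventually_elim
    case (elim t)
    have "exp (- 1 / t) = 1 / exp (1 / t)" using exp_minus[of "1 / t"] by (simp add: inverse_eq_divide)
    then show ?case using elim by (simp add: flat_def inverse_eq_divide)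
  qed
  ultimately show ?thesis by (rule Lim_transform_eventually)
qed

lemma flat_has_derivative:
  "(flat n has_real_derivative (- real n * flat (Suc n) t + flat (Suc (Suc n)) t)) (at t)"
proof -
  consider "0 < t" | "t < 0" | "t = 0" by linarith
  then show ?thesis
  proof cases
    case 1
    define y where "y = 1 / t"
    have d: "((\<lambda>t. 1 / t) has_real_derivative - (y * y)) (at t)"
      using 1 by (auto intro!: derivative_eq_intros simp: y_def power2_eq_square)
    have "((\<lambda>t. (1 / t) ^ n * exp (- (1 / t))) has_real_derivative
        real n * (y ^ (n - Suc 0) * - (y * y)) * exp (- y) + exp (- y) * - (- (y * y)) * y ^ n) (at t)"
      using DERIV_mult[OF DERIV_power[OF d, of n] DERIV_chain2[OF DERIV_exp DERIV_minus[OF d]]]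
      by (simp add: y_def[symmetric] mult_ac)
    moreover have "real n * (y ^ (n - Suc 0) * - (y * y)) * exp (- y) + exp (- y) * - (- (y * y)) * y ^ n
       = - real n * flat (Suc n) t + flat (Suc (Suc n)) t"
      using 1 by (cases n) (auto simp: flat_def y_def[symmetric] algebra_simps)
    ultimately have "((\<lambda>t. (1 / t) ^ n * exp (- 1 / t)) has_real_derivative
        (- real n * flat (Suc n) t + flat (Suc (Suc n)) t)) (at t)" by simp
    then show ?thesis
      by (rule has_field_derivative_transform_within_open[where S="{0<..}"]) (use 1 in \<open>auto simp: flat_def\<close>)
  next
    case 2
    have "((\<lambda>_. 0) has_real_derivative 0) (at t)" by simp
    then have "(flat n has_real_derivative 0) (at t)"
      by (rule has_field_derivative_transform_within_open[where S="{..<0}"]) (use 2 in \<open>auto simp: flat_def\<close>)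
    then show ?thesis using 2 by (simp add: flat_def)
  next
    case 3
    have "((\<lambda>h. flat (Suc n) h) \<longlongrightarrow> 0) (at_left 0)"
      by (rule Lim_transform_eventually[OF tendsto_const])
        (auto simp: flat_def eventually_at_left_field intro!: exI[of _ "-1"])
    with flat_tendsto_0[of "Suc n"] have "((\<lambda>h. flat (Suc n) h) \<longlongrightarrow> 0) (at 0)"
      by (simp add: filterlim_at_split)
    \<comment> \<open>The difference quotient at 0 is the next member of the family, so the
      derivative there is the limit just computed.\<close>
    moreover have "flat (Suc n) h = (flat n (0 + h) - flat n 0) / h" for h
      by (simp add: flat_def)
    ultimately have "(flat n has_real_derivative 0) (at 0)"
      by (simp add: DERIV_def)
    then show ?thesis using 3 by (simp add: flat_def)
  qed
qed

text \<open>The induction treats all n at once, since differentiation raises n. The affine argument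
  is built in because each factor of a bump has that form.\<close>

lemma Ck_fun_flat: "Ck_fun k (\<lambda>x::'a::euclidean_space. flat n (c + b \<bullet> x))"
proof (induction k arbitrary: n)
  case 0
  have "continuous_on UNIV (flat n)"
    using flat_has_derivative DERIV_continuous by (blast intro: continuous_at_imp_continuous_on)
  then show ?case
    by (auto intro!: continuous_on_compose2[of UNIV "flat n"] continuous_intros)
next
  case (Suc k)
  show ?case
  proof (rule Ck_fun_SucI)
    fix x :: 'a
    have "((\<lambda>x. c + b \<bullet> x) has_derivative (\<lambda>v. b \<bullet> v)) (at x)"
      by (auto intro!: derivative_eq_intros)
    from has_derivative_compose[OF this, of "flat n" "\<lambda>s. s * (- real n * flat (Suc n) (c + b \<bullet> x) + flat (Suc (Suc n)) (c + b \<bullet> x))"]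
    show "((\<lambda>x. flat n (c + b \<bullet> x)) has_derivative
       (\<lambda>v. (b \<bullet> v) * (- real n * flat (Suc n) (c + b \<bullet> x) + flat (Suc (Suc n)) (c + b \<bullet> x)))) (at x)"
      using flat_has_derivative[of n "c + b \<bullet> x"] by (simp add: has_field_derivative_def mult_commute_abs)
  next
    fix v
    show "Ck_fun k (\<lambda>x. (b \<bullet> v) * (- real n * flat (Suc n) (c + b \<bullet> x) + flat (Suc (Suc n)) (c + b \<bullet> x)))"
      by (intro Ck_fun_mult Ck_fun_add Ck_fun_const Suc.IH)
  qed
qed

text \<open>A smooth function that is positive exactly on the open box when k > 0. The parameter k
  steepens the flanks: as k grows, the bump tends to the indicator of the box.\<close>

definition bump :: "real \<Rightarrow> 'a::euclidean_space \<Rightarrow> 'a \<Rightarrow> 'a \<Rightarrow> real" where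
  "bump k a b x = (\<Prod>i\<in>Basis. flat 0 (k * (x \<bullet> i - a \<bullet> i)) * flat 0 (k * (b \<bullet> i - x \<bullet> i)))"

lemma smooth_fun_bump: "smooth_fun (bump k a b)"
proof -
  have "smooth_fun (\<lambda>x. flat 0 (k * (x \<bullet> i - a \<bullet> i)) * flat 0 (k * (b \<bullet> i - x \<bullet> i)))" for i
  proof (rule smooth_fun_mult)
    show "smooth_fun (\<lambda>x. flat 0 (k * (x \<bullet> i - a \<bullet> i)))"
      using Ck_fun_flat[of _ 0 "- k * (a \<bullet> i)" "k *\<^sub>R i"]
      by (simp add: smooth_fun_def algebra_simps inner_commute)
    show "smooth_fun (\<lambda>x. flat 0 (k * (b \<bullet> i - x \<bullet> i)))"
      using Ck_fun_flat[of _ 0 "k * (b \<bullet> i)" "- k *\<^sub>R i"]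
      by (simp add: smooth_fun_def algebra_simps inner_commute)
  qed
  then show ?thesis unfolding bump_def by (intro smooth_fun_prod) auto
qed

lemma flat_0_bounds: "0 \<le> flat 0 t" "flat 0 t \<le> 1" "0 < t \<Longrightarrow> 0 < flat 0 t"
  by (auto simp: flat_def)

lemma bump_bounds: "0 \<le> bump k a b x" "bump k a b x \<le> 1"
  unfolding bump_def
  by (auto intro!: prod_nonneg prod_le_1 mult_nonneg_nonneg mult_le_one flat_0_bounds)

lemma bump_pos: "0 < k \<Longrightarrow> x \<in> box a b \<Longrightarrow> 0 < bump k a b x"
  unfolding bump_def by (auto intro!: prod_pos mult_pos_pos flat_0_bounds simp: mem_box)

lemma bump_outside: "0 < k \<Longrightarrow> x \<notin> box a b \<Longrightarrow> bump k a b x = 0"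
proof -
  assume k: "0 < k" and "x \<notin> box a b"
  then obtain i where i: "i \<in> Basis" "x \<bullet> i \<le> a \<bullet> i \<or> b \<bullet> i \<le> x \<bullet> i"
    by (auto simp: mem_box not_less)
  then have "flat 0 (k * (x \<bullet> i - a \<bullet> i)) * flat 0 (k * (b \<bullet> i - x \<bullet> i)) = 0"
    using k by (auto simp: flat_def zero_less_mult_iff)
  with i(1) show ?thesis unfolding bump_def by (intro prod_zero) auto
qed

lemma bump_tendsto: "(\<lambda>n. bump (real (Suc n)) a b x) \<longlonglongrightarrow> indicator (box a b) x"
proof (cases "x \<in> box a b")
  case True
  have "(\<lambda>n. flat 0 (real (Suc n) * t)) \<longlonglongrightarrow> 1" if "0 < t" for t
  proof -
    have "(\<lambda>n. exp (- (1 / t) * inverse (real (Suc n)))) \<longlonglongrightarrow> exp (- (1 / t) * 0)"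
      by (intro tendsto_intros LIMSEQ_inverse_real_of_nat)
    moreover have "exp (- (1 / t) * inverse (real (Suc n))) = flat 0 (real (Suc n) * t)" for n
      using that by (simp add: flat_def field_simps del: of_nat_Suc)
    ultimately show ?thesis by simp
  qed
  then have "(\<lambda>n. bump (real (Suc n)) a b x) \<longlonglongrightarrow> (\<Prod>i\<in>(Basis::'a set). 1 * 1)"
    unfolding bump_def using True by (intro tendsto_prod tendsto_mult) (auto simp: mem_box)
  then show ?thesis using True by simp
qed (simp add: bump_outside)

lemma bump_in_test_funs:
  assumes "0 < k" "cbox a b \<subseteq> S"
  shows "bump k a b \<in> test_funs S"
proof -
  have "{x. bump k a b x \<noteq> 0} \<subseteq> cbox a b"
    using bump_outside[OF assms(1)] box_subset_cbox by blast
  then have "closure {x. bump k a b x \<noteq> 0} \<subseteq> cbox a b"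
    by (intro closure_minimal) auto
  moreover from this have "compact (closure {x. bump k a b x \<noteq> 0})"
    by (meson bounded_cbox bounded_subset closed_closure compact_eq_bounded_closed)
  ultimately show ?thesis using assms smooth_fun_bump by (auto simp: test_funs_def)
qed

section \<open>Gradients of test functions and integration by parts\<close>

lemma gradient_eqI:
  assumes "(f has_derivative (\<lambda>h. g \<bullet> h)) (at x)"
  shows "gradient f x = g"
  using frechet_derivative_at[OF assms, symmetric]
  by (simp add: gradient_def euclidean_representation)

lemma C1_supported_gradient:
  assumes "C1_supported S u g" shows "gradient u = g"
  using assms by (intro ext gradient_eqI) (simp add: C1_supported_def)

text \<open>The complement of the closed support is open and contains every point off S, so the
  gradient vanishes at such points too.\<close>

lemma test_funs_C1:
  assumes "\<phi> \<in> test_funs S"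
  shows "C1_supported S \<phi> (gradient \<phi>)"
proof -
  have C1: "Ck_fun (Suc 0) \<phi>" and supp: "closure {x. \<phi> x \<noteq> 0} \<subseteq> S"
    using assms by (auto simp: test_funs_def smooth_fun_def)
  have "gradient \<phi> x = 0" if "x \<notin> S" for x
  proof (rule gradient_eqI)
    have "((\<lambda>_. 0) has_derivative (\<lambda>_. 0)) (at x)" by simp
    then show "(\<phi> has_derivative (\<lambda>h. 0 \<bullet> h)) (at x)"
      unfolding inner_zero_left
    proof (rule has_derivative_transform_within_open[where s="- closure {x. \<phi> x \<noteq> 0}"])
      show "x \<in> - closure {x. \<phi> x \<noteq> 0}" using that supp by auto
      show "0 = \<phi> y" if "y \<in> - closure {x. \<phi> x \<noteq> 0}" for y
        using that closure_subset[of "{x. \<phi> x \<noteq> 0}"] by auto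
    qed auto
  qed
  moreover have "\<phi> x = 0" if "x \<notin> S" for x
    using that supp closure_subset[of "{x. \<phi> x \<noteq> 0}"] by auto
  moreover have "(\<phi> has_derivative (\<lambda>h. gradient \<phi> x \<bullet> h)) (at x)" for x
    using GDERIV_gradient[of \<phi> x] C1 by (simp add: gderiv_def inner_commute)
  moreover have "continuous_on UNIV (gradient \<phi>)"
    using C1 unfolding gradient_def by (intro continuous_intros) auto
  ultimately show ?thesis by (simp add: C1_supported_def)
qed

lemma C1_supported_add:
  "C1_supported S u g \<Longrightarrow> C1_supported S v h \<Longrightarrow> C1_supported S (\<lambda>x. u x + v x) (\<lambda>x. g x + h x)"
  by (auto simp: C1_supported_def inner_add_left intro!: has_derivative_add continuous_intros)

lemma C1_supported_cmult:
  "C1_supported S u g \<Longrightarrow> C1_supported S (\<lambda>x. c * u x) (\<lambda>x. c *\<^sub>R g x)"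
  by (auto simp: C1_supported_def intro!: has_derivative_mult_right continuous_intros)

lemma C1_supported_mult:
  "C1_supported S u g \<Longrightarrow> C1_supported S v h \<Longrightarrow> C1_supported S (\<lambda>x. u x * v x) (\<lambda>x. u x *\<^sub>R h x + v x *\<^sub>R g x)"
  using C1_supported_continuous[of S u g UNIV] C1_supported_continuous[of S v h UNIV]
  by (auto simp: C1_supported_def inner_add_left mult.commute intro!: continuous_intros derivative_eq_intros)

lemma test_funs_add:
  assumes "\<phi> \<in> test_funs S" "\<psi> \<in> test_funs S" shows "(\<lambda>x. \<phi> x + \<psi> x) \<in> test_funs S"
proof -
  let ?c = "\<lambda>f. closure {x. f x \<noteq> (0::real)}"
  have "?c (\<lambda>x. \<phi> x + \<psi> x) \<subseteq> ?c \<phi> \<union> ?c \<psi>"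
    unfolding closure_Un[symmetric] by (rule closure_mono) auto
  moreover have "compact (?c \<phi> \<union> ?c \<psi>)" using assms by (auto simp: test_funs_def)
  ultimately have "compact (?c (\<lambda>x. \<phi> x + \<psi> x))"
    by (meson bounded_subset closed_closure compact_eq_bounded_closed)
  then show ?thesis
    using assms \<open>?c (\<lambda>x. \<phi> x + \<psi> x) \<subseteq> ?c \<phi> \<union> ?c \<psi>\<close> by (auto simp: test_funs_def intro: smooth_fun_add)
qed

lemma test_funs_cmult:
  assumes "\<phi> \<in> test_funs S" shows "(\<lambda>x. c * \<phi> x) \<in> test_funs S"
proof -
  let ?c = "\<lambda>f. closure {x. f x \<noteq> (0::real)}"
  have sub: "?c (\<lambda>x. c * \<phi> x) \<subseteq> ?c \<phi>" by (rule closure_mono) auto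
  moreover have "compact (?c \<phi>)" using assms by (auto simp: test_funs_def)
  ultimately have "compact (?c (\<lambda>x. c * \<phi> x))"
    by (meson bounded_subset closed_closure compact_eq_bounded_closed)
  then show ?thesis
    using assms sub by (auto simp: test_funs_def intro: smooth_fun_mult smooth_fun_const)
qed

lemma gradient_add:
  assumes "\<phi> \<in> test_funs S" "\<psi> \<in> test_funs S"
  shows "gradient (\<lambda>x. \<phi> x + \<psi> x) = (\<lambda>x. gradient \<phi> x + gradient \<psi> x)"
  by (rule C1_supported_gradient[OF C1_supported_add[OF test_funs_C1[OF assms(1)] test_funs_C1[OF assms(2)]]])

lemma gradient_cmult:
  assumes "\<phi> \<in> test_funs S"
  shows "gradient (\<lambda>x. c * \<phi> x) = (\<lambda>x. c *\<^sub>R gradient \<phi> x)"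
  by (rule C1_supported_gradient[OF C1_supported_cmult[OF test_funs_C1[OF assms]]])

lemma C1_supported_bounded:
  assumes "C1_supported S u g" "bounded S"
  obtains B where "0 \<le> B" "\<And>x. \<bar>u x\<bar> \<le> B" "\<And>x. norm (g x) \<le> B"
proof -
  have c: "compact (closure S)" using assms by (simp add: compact_closure)
  have "bounded (u ` closure S)" "bounded (g ` closure S)"
    by (intro compact_imp_bounded compact_continuous_image c C1_supported_continuous[OF assms(1)])+
  then obtain B1 B2 where B: "\<And>x. x \<in> closure S \<Longrightarrow> \<bar>u x\<bar> \<le> B1" "\<And>x. x \<in> closure S \<Longrightarrow> norm (g x) \<le> B2"
    by (force simp: bounded_iff)
  have z: "x \<notin> closure S \<Longrightarrow> u x = 0 \<and> g x = 0" for x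
    using assms(1) closure_subset by (fastforce simp: C1_supported_def)
  show ?thesis
  proof (rule that[of "max 0 (max B1 B2)"])
    show "\<bar>u x\<bar> \<le> max 0 (max B1 B2)" for x using B(1)[of x] z[of x] by (cases "x \<in> closure S") auto
    show "norm (g x) \<le> max 0 (max B1 B2)" for x using B(2)[of x] z[of x] by (cases "x \<in> closure S") auto
  qed simp
qed

text \<open>Difference quotients have integral 0 by translation invariance, and they converge to the
  partial derivatives. The mean value bound on a slightly larger ball dominates them.\<close>

lemma C1_supported_integral_gradient:
  fixes u :: "'a::euclidean_space \<Rightarrow> real"
  assumes C1: "C1_supported S u g" and S: "bounded S"
  shows "integrable lborel u" "integrable lborel g" "(\<integral>x. g x \<partial>lborel) = 0"
proof -
  note [measurable] = C1_supported_measurable[OF C1]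
  obtain B where B: "0 \<le> B" "\<And>x. \<bar>u x\<bar> \<le> B" "\<And>x. norm (g x) \<le> B"
    using C1_supported_bounded[OF C1 S] by blast
  obtain R where R: "0 < R" "S \<subseteq> ball 0 R" using bounded_subset_ballD[OF S, of 0] by auto
  \<comment> \<open>A margin of 1 accommodates all shifts, since the steps h n are at most
    1.\<close>
  define D where "D = ball (0::'a) (R + 1)"
  have [measurable]: "D \<in> sets borel" by (simp add: D_def)
  have iD: "integrable lborel (\<lambda>x. B * indicator D x :: real)"
    unfolding D_def by (intro integrable_mult_right integrable_real_indicator emeasure_bounded_finite) auto
  have out: "x \<notin> D \<Longrightarrow> norm h \<le> 1 \<Longrightarrow> u (x + h) = 0 \<and> g (x + h) = 0" for x h
  proof -
    assume "x \<notin> D" "norm h \<le> 1"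
    then have "R \<le> norm (x + h)" using norm_diff_ineq[of x h] by (simp add: D_def)
    then have "x + h \<notin> S" using R by auto
    then show ?thesis using C1 by (simp add: C1_supported_def)
  qed
  show iu: "integrable lborel u"
    by (rule Bochner_Integration.integrable_bound[OF iD]) (use B out[of _ 0] in \<open>auto simp: indicator_def\<close>)
  show ig: "integrable lborel g"
    by (rule Bochner_Integration.integrable_bound[OF iD]) (use B out[of _ 0] in \<open>auto simp: indicator_def\<close>)
  have *: "(\<integral>x. g x \<partial>lborel) \<bullet> e = 0" if e: "e \<in> Basis" for e
  proof -
    define h where "h n = inverse (real (Suc n))" for n
    have h: "0 < h n" "h n \<le> 1" for n by (simp_all add: h_def inverse_le_1_iff)
    define q where "q n x = (u (x + h n *\<^sub>R e) - u x) / h n" for n x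
    have lim: "(\<lambda>n. q n x) \<longlonglongrightarrow> g x \<bullet> e" for x
    proof -
      have ux: "(u has_derivative (\<lambda>k. g x \<bullet> k)) (at (x + 0 *\<^sub>R e))" using C1 by (simp add: C1_supported_def)
      have "((\<lambda>s. x + s *\<^sub>R e) has_derivative (\<lambda>s. s *\<^sub>R e)) (at 0)"
        by (auto intro!: derivative_eq_intros)
      from has_derivative_compose[OF this ux]
      have "((\<lambda>s. u (x + s *\<^sub>R e)) has_real_derivative g x \<bullet> e) (at 0)"
        by (simp add: has_field_derivative_def mult_commute_abs)
      then have "(\<lambda>s. (u (x + s *\<^sub>R e) - u x) / s) \<midarrow>0\<rightarrow> g x \<bullet> e" by (simp add: DERIV_def)
      moreover have "h \<longlonglongrightarrow> 0" unfolding h_def by (rule LIMSEQ_inverse_real_of_nat)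
      ultimately show ?thesis
        unfolding q_def by (rule tendsto_compose_eventually) (use h in \<open>auto simp: less_imp_neq[symmetric]\<close>)
    qed
    have bound: "norm (q n x) \<le> B * indicator D x" for n x
    proof (cases "x \<in> D")
      case True
      have "norm (u (x + h n *\<^sub>R e) - u x) \<le> B * norm ((x + h n *\<^sub>R e) - x)"
      proof (rule differentiable_bound[of UNIV u "\<lambda>y k. g y \<bullet> k"])
        show "(u has_derivative (\<lambda>k. g y \<bullet> k)) (at y within UNIV)" for y
          using C1 by (simp add: C1_supported_def)
        show "onorm (\<lambda>k. g y \<bullet> k) \<le> B" for y
        proof (rule onorm_le)
          fix k show "norm (g y \<bullet> k) \<le> B * norm k"
            using Cauchy_Schwarz_ineq2[of "g y" k] mult_right_mono[OF B(3)[of y], of "norm k"] by simp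
        qed
      qed auto
      then show ?thesis using True h[of n] e by (simp add: q_def divide_le_eq)
    next
      case False
      have "norm (h n *\<^sub>R e) \<le> 1" using h[of n] e by simp
      then show ?thesis using out[OF False, of "h n *\<^sub>R e"] out[OF False, of 0] False by (simp add: q_def)
    qed
    have "(\<lambda>n. \<integral>x. q n x \<partial>lborel) \<longlonglongrightarrow> (\<integral>x. g x \<bullet> e \<partial>lborel)"
      by (rule integral_dominated_convergence[OF _ _ iD]) (use lim bound in \<open>auto simp: q_def\<close>)
    moreover have "(\<integral>x. q n x \<partial>lborel) = 0" for n
    proof -
      have d: "distr lborel borel ((+) (h n *\<^sub>R e)) = (lborel :: 'a measure)" by (rule lborel_distr_plus)
      have "integrable (distr lborel borel ((+) (h n *\<^sub>R e))) u" unfolding d by (rule iu)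
      then have i: "integrable lborel (\<lambda>x. u (h n *\<^sub>R e + x))" by (simp add: integrable_distr_eq)
      have "(\<integral>x. u x \<partial>lborel) = (\<integral>x. u x \<partial>distr lborel borel ((+) (h n *\<^sub>R e)))" unfolding d ..
      also have "\<dots> = (\<integral>x. u (h n *\<^sub>R e + x) \<partial>lborel)" by (rule integral_distr) auto
      finally show ?thesis using i iu unfolding q_def
        by (simp add: add.commute[of _ "h n *\<^sub>R e"])
    qed
    ultimately have "(\<integral>x. g x \<bullet> e \<partial>lborel) = 0" by (simp add: LIMSEQ_const_iff)
    then show ?thesis using ig by simp
  qed
  show "(\<integral>x. g x \<partial>lborel) = 0" by (rule euclidean_eqI) (simp add: *)
qed

lemma integral_lebesgue_on_eq_lborel:
  fixes f :: "'a::euclidean_space \<Rightarrow> 'b::{banach, second_countable_topology}"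
  assumes S: "S \<in> sets lebesgue" and f: "f \<in> borel_measurable borel" and z: "\<And>x. x \<notin> S \<Longrightarrow> f x = 0"
  shows "(\<integral>x. f x \<partial>lebesgue_on S) = (\<integral>x. f x \<partial>lborel)"
proof -
  have "(\<integral>x. f x \<partial>lebesgue_on S) = (\<integral>x. indicator S x *\<^sub>R f x \<partial>lebesgue)"
    using S by (intro integral_restrict_space) simp
  also have "(\<lambda>x. indicator S x *\<^sub>R f x) = f" using z by (auto simp: indicator_def fun_eq_iff)
  also have "(\<integral>x. f x \<partial>lebesgue) = (\<integral>x. f x \<partial>lborel)" using f by (intro integral_completion) simp
  finally show ?thesis .
qed

text \<open>The vanishing integral of a gradient, applied to the product of the two
  functions.\<close>

lemma test_funs_by_parts:
  fixes S :: "'a::euclidean_space set"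
  assumes S: "open S" "bounded S" and \<phi>: "\<phi> \<in> test_funs S" and \<psi>: "\<psi> \<in> test_funs S"
  shows "(\<integral>x. \<psi> x *\<^sub>R gradient \<phi> x \<partial>lebesgue_on S) = - (\<integral>x. \<phi> x *\<^sub>R gradient \<psi> x \<partial>lebesgue_on S)"
proof -
  note C1 = test_funs_C1[OF \<phi>] test_funs_C1[OF \<psi>]
  note [measurable] = C1_supported_measurable[OF C1(1)] C1_supported_measurable[OF C1(2)]
  have Sl: "S \<in> sets lebesgue" using S by simp
  have z: "\<phi> x = 0 \<and> gradient \<phi> x = 0 \<and> \<psi> x = 0 \<and> gradient \<psi> x = 0" if "x \<notin> S" for x
    using C1 that by (simp add: C1_supported_def)
  have int: "integrable lborel (\<lambda>x. \<eta> x *\<^sub>R gradient \<zeta> x)" if "\<eta> \<in> test_funs S" "\<zeta> \<in> test_funs S" for \<eta> \<zeta>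
  proof -
    note D1 = test_funs_C1[OF that(1)] and D2 = test_funs_C1[OF that(2)]
    note [measurable] = C1_supported_measurable[OF D1] C1_supported_measurable[OF D2]
    obtain B where B: "0 \<le> B" "\<And>x. \<bar>\<eta> x\<bar> \<le> B" "\<And>x. norm (gradient \<eta> x) \<le> B"
      using C1_supported_bounded[OF D1 S(2)] by blast
    have "integrable lborel (\<lambda>x. B *\<^sub>R gradient \<zeta> x)"
      using C1_supported_integral_gradient(2)[OF D2 S(2)] by simp
    then show ?thesis
      by (rule Bochner_Integration.integrable_bound) (use B in \<open>auto intro!: mult_right_mono\<close>)
  qed
  have "(\<integral>x. \<phi> x *\<^sub>R gradient \<psi> x + \<psi> x *\<^sub>R gradient \<phi> x \<partial>lborel) = 0"
    by (rule C1_supported_integral_gradient(3)[OF C1_supported_mult[OF C1] S(2)])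
  then have "(\<integral>x. \<phi> x *\<^sub>R gradient \<psi> x \<partial>lborel) + (\<integral>x. \<psi> x *\<^sub>R gradient \<phi> x \<partial>lborel) = 0"
    using int[OF \<phi> \<psi>] int[OF \<psi> \<phi>] by simp
  moreover have "(\<integral>x. \<phi> x *\<^sub>R gradient \<psi> x \<partial>lebesgue_on S) = (\<integral>x. \<phi> x *\<^sub>R gradient \<psi> x \<partial>lborel)"
    by (rule integral_lebesgue_on_eq_lborel[OF Sl]) (use z in auto)
  moreover have "(\<integral>x. \<psi> x *\<^sub>R gradient \<phi> x \<partial>lebesgue_on S) = (\<integral>x. \<psi> x *\<^sub>R gradient \<phi> x \<partial>lborel)"
    by (rule integral_lebesgue_on_eq_lborel[OF Sl]) (use z in auto)
  ultimately show ?thesis by (simp add: add_eq_0_iff)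
qed

text \<open>A weak gradient is only known to be integrable on compact subsets of S, so measurability
  is assembled from a countable cover by closed boxes.\<close>

lemma has_weak_gradient_measurable:
  assumes S: "open S" and G: "has_weak_gradient S u G"
  shows "G \<in> borel_measurable (lebesgue_on S)"
proof -
  obtain \<D> where \<D>: "countable \<D>" "\<D> \<subseteq> Pow S" "\<And>X. X \<in> \<D> \<Longrightarrow> \<exists>a b. X = cbox a b" "\<Union>\<D> = S"
    using open_countable_Union_open_cbox[OF S] by metis
  show ?thesis
  proof (rule measurable_piecewise_restrict[OF \<D>(1)])
    show "space (lebesgue_on S) \<subseteq> \<Union>\<D>" using \<D>(4) by simp
    fix X assume X: "X \<in> \<D>"
    then obtain a b where ab: "X = cbox a b" using \<D>(3) by blast
    have XS: "X \<subseteq> S" using X \<D>(2) by auto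
    show "X \<inter> space (lebesgue_on S) \<in> sets (lebesgue_on S)"
      using ab XS S by (auto simp: sets_restrict_space)
    have "G absolutely_integrable_on X" using G XS ab by (auto simp: has_weak_gradient_def)
    then have "G \<in> borel_measurable (lebesgue_on X)"
      by (simp add: absolutely_integrable_imp_borel_measurable ab)
    moreover have "restrict_space (lebesgue_on S) X = lebesgue_on X"
      using XS S ab by (simp add: restrict_restrict_space Int_absorb1)
    ultimately show "G \<in> borel_measurable (restrict_space (lebesgue_on S) X)" by simp
  qed
qed

text \<open>The test function is bounded and cuts G down to a compact subset of S, where
  integrability is available.\<close>

lemma test_fun_times_integrable:
  fixes S :: "'a::euclidean_space set" and G :: "'a \<Rightarrow> 'b::euclidean_space"
  assumes \<phi>: "\<phi> \<in> test_funs S" and G: "\<And>K. compact K \<Longrightarrow> K \<subseteq> S \<Longrightarrow> G absolutely_integrable_on K"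
  shows "integrable lebesgue (\<lambda>x. \<phi> x *\<^sub>R G x)"
proof -
  define K where "K = closure {x. \<phi> x \<noteq> 0}"
  have K: "compact K" "K \<subseteq> S" using \<phi> by (auto simp: K_def test_funs_def)
  have "C1_supported K \<phi> (gradient \<phi>)"
    using \<phi> by (intro test_funs_C1) (auto simp: test_funs_def K_def)
  then obtain B where B: "\<And>x. \<bar>\<phi> x\<bar> \<le> B" and m: "\<phi> \<in> borel_measurable borel"
    using C1_supported_bounded compact_imp_bounded[OF K(1)] C1_supported_measurable(1) by metis
  have [measurable]: "\<phi> \<in> borel_measurable lebesgue" using m by (intro measurable_completion) simp
  have "integrable lebesgue (\<lambda>x. indicator K x *\<^sub>R G x)"
    using G[OF K] by (simp add: set_integrable_def)
  from this have i: "integrable lebesgue (\<lambda>x. B *\<^sub>R (indicator K x *\<^sub>R G x))" by (rule integrable_scaleR_right)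
  have "integrable lebesgue (\<lambda>x. \<phi> x *\<^sub>R (indicator K x *\<^sub>R G x))"
  proof (rule Bochner_Integration.integrable_bound[OF i])
    show "(\<lambda>x. \<phi> x *\<^sub>R (indicator K x *\<^sub>R G x)) \<in> borel_measurable lebesgue"
      using borel_measurable_integrable[OF \<open>integrable lebesgue (\<lambda>x. indicator K x *\<^sub>R G x)\<close>] by measurable
    show "AE x in lebesgue. norm (\<phi> x *\<^sub>R (indicator K x *\<^sub>R G x)) \<le> norm (B *\<^sub>R (indicator K x *\<^sub>R G x))"
    proof (rule AE_I2)
      fix x show "norm (\<phi> x *\<^sub>R (indicator K x *\<^sub>R G x)) \<le> norm (B *\<^sub>R (indicator K x *\<^sub>R G x))"
        using B[of x] by (auto simp: indicator_def intro!: mult_right_mono)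
    qed
  qed
  moreover have "(\<lambda>x. \<phi> x *\<^sub>R (indicator K x *\<^sub>R G x)) = (\<lambda>x. \<phi> x *\<^sub>R G x)"
    using closure_subset[of "{x. \<phi> x \<noteq> 0}"] by (auto simp: K_def indicator_def fun_eq_iff)
  ultimately show ?thesis by simp
qed

text \<open>Smooth bumps converge to indicators of boxes, and boxes are an intersection-stable generator of
  the Borel sets.\<close>

lemma fundamental_lemma_cbox:
  fixes D :: "'a::euclidean_space \<Rightarrow> 'b::euclidean_space"
  assumes D: "D absolutely_integrable_on cbox c d"
    and zero: "\<And>a b n. cbox a b \<subseteq> cbox c d \<Longrightarrow> (\<integral>x. bump (real (Suc n)) a b x *\<^sub>R D x \<partial>lebesgue) = 0"
  shows "AE x in lebesgue. x \<in> cbox c d \<longrightarrow> D x = 0"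
proof -
  define Dc where "Dc x = indicator (cbox c d) x *\<^sub>R D x" for x
  have Dc: "integrable lebesgue Dc" using D by (simp add: Dc_def[abs_def] set_integrable_def)
  note [measurable] = borel_measurable_integrable[OF Dc]
  have box0: "(\<integral>x. indicator (box a b) x *\<^sub>R Dc x \<partial>lebesgue) = 0" if "cbox a b \<subseteq> cbox c d" for a b
  proof -
    have m: "bump k a b \<in> borel_measurable lebesgue" for k
      using smooth_fun_bump[of k a b]
      by (intro measurable_completion) (auto simp: smooth_fun_def intro!: borel_measurable_continuous_onI dest: spec[of _ 0])
    have "(\<lambda>n. \<integral>x. bump (real (Suc n)) a b x *\<^sub>R Dc x \<partial>lebesgue) \<longlonglongrightarrow> (\<integral>x. indicator (box a b) x *\<^sub>R Dc x \<partial>lebesgue)"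
    proof (rule integral_dominated_convergence[OF _ _ integrable_norm[OF Dc]])
      show "(\<lambda>x. indicator (box a b) x *\<^sub>R Dc x) \<in> borel_measurable lebesgue"
        by (intro borel_measurable_scaleR borel_measurable_indicator borel_measurable_integrable[OF Dc]) simp
      show "(\<lambda>x. bump (real (Suc n)) a b x *\<^sub>R Dc x) \<in> borel_measurable lebesgue" for n using m by measurable
      show "AE x in lebesgue. (\<lambda>n. bump (real (Suc n)) a b x *\<^sub>R Dc x) \<longlonglongrightarrow> indicator (box a b) x *\<^sub>R Dc x"
        by (intro AE_I2 tendsto_intros bump_tendsto)
      show "AE x in lebesgue. norm (bump (real (Suc n)) a b x *\<^sub>R Dc x) \<le> norm (Dc x)" for n
        using bump_bounds[of "real (Suc n)" a b] by (intro AE_I2) (auto intro!: mult_left_le_one_le)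
    qed
    moreover have eq: "bump (real (Suc n)) a b x *\<^sub>R Dc x = bump (real (Suc n)) a b x *\<^sub>R D x" for n x
      using that box_subset_cbox[of a b] bump_outside[of "real (Suc n)" x a b] by (cases "x \<in> box a b") (auto simp: Dc_def)
    ultimately have "(\<lambda>n::nat. 0) \<longlonglongrightarrow> (\<integral>x. indicator (box a b) x *\<^sub>R Dc x \<partial>lebesgue)"
      by (simp only: eq zero[OF that])
    then show ?thesis by (simp only: LIMSEQ_const_iff)
  qed
  \<comment> \<open>On the open box the argument is stable under intersection: an open box cut with
    \<open>box c d\<close> is again an open box, and its closure lies in \<open>cbox c d\<close>,
    where \<open>box0\<close> applies.\<close>
  define f where "f x = indicator (box c d) x *\<^sub>R Dc x" for x
  have f: "integrable lebesgue f" unfolding f_def by (intro integrable_mult_indicator Dc) auto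
  note [measurable] = borel_measurable_integrable[OF f]
  have f0: "(\<integral>x. f x \<partial>lebesgue) = 0" using box0[of c d] by (simp add: f_def)
  have borel: "(\<integral>x. indicator A x *\<^sub>R f x \<partial>lebesgue) = 0" if A: "A \<in> sets borel" for A
  proof -
    let ?G = "range (\<lambda>(a, b). box a b :: 'a set)"
    have "Int_stable ?G" by (auto simp: Int_stable_def box_Int_box)
    moreover have "?G \<subseteq> Pow UNIV" by simp
    moreover have AG: "A \<in> sigma_sets UNIV ?G" using A unfolding borel_eq_box by simp
    ultimately show ?thesis
    proof (induction rule: sigma_sets_induct_disjoint)
      case (basic A)
      then obtain a b where ab: "A = box a b" by auto
      obtain a' b' where ab': "box a b \<inter> box c d = box a' b'" using box_Int_box by blast
      have "indicator A x *\<^sub>R f x = indicator (box a' b') x *\<^sub>R Dc x" for x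
        unfolding f_def ab'[symmetric] ab by (simp add: indicator_inter_arith)
      moreover have "(\<integral>x. indicator (box a' b') x *\<^sub>R Dc x \<partial>lebesgue) = 0"
      proof (cases "box a' b' = {}")
        case False
        then have "cbox a' b' = closure (box a' b')" by (simp add: closure_box)
        also have "\<dots> \<subseteq> closure (box c d)" using ab' by (intro closure_mono) auto
        also have "\<dots> \<subseteq> cbox c d" by (intro closure_minimal box_subset_cbox) auto
        finally show ?thesis by (rule box0)
      qed simp
      ultimately show ?case by simp
    next
      case empty show ?case by simp
    next
      case (compl A)
      then have Ab: "A \<in> sets borel" by (simp add: borel_eq_box)
      have "indicator (UNIV - A) x *\<^sub>R f x = f x - indicator A x *\<^sub>R f x" for x by (simp add: indicator_def)
      moreover have "integrable lebesgue (\<lambda>x. indicator A x *\<^sub>R f x)" using Ab by (intro integrable_mult_indicator f) auto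
      ultimately show ?case using compl f f0 by simp
    next
      case (union A)
      then have Ab: "A i \<in> sets borel" for i by (auto simp: borel_eq_box)
      have "integrable lebesgue (\<lambda>x. indicator (\<Union>i. A i) x *\<^sub>R f x)" using Ab by (intro integrable_mult_indicator f) auto
      then have "(LINT x:(\<Union>i. A i)|lebesgue. f x) = (\<Sum>i. LINT x:(A i)|lebesgue. f x)"
        using Ab union(1) by (intro lebesgue_integral_countable_add) (auto simp: set_integrable_def disjoint_family_on_def)
      then show ?case using union by (simp add: set_lebesgue_integral_def)
    qed
  qed
  have leb: "(\<integral>x. indicator A x *\<^sub>R f x \<partial>lebesgue) = 0" if A: "A \<in> sets lebesgue" for A
  proof -
    obtain B N N' where B: "A = B \<union> N" "N \<subseteq> N'" "N' \<in> null_sets lborel" "B \<in> sets lborel"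
      using A by (rule sets_completionE)
    have "AE x in lebesgue. x \<notin> N'" using B(3) by (intro AE_not_in null_sets_completionI)
    then have "(\<integral>x. indicator A x *\<^sub>R f x \<partial>lebesgue) = (\<integral>x. indicator B x *\<^sub>R f x \<partial>lebesgue)"
    proof (intro integral_cong_AE borel_measurable_scaleR borel_measurable_indicator borel_measurable_integrable[OF f])
      assume "AE x in lebesgue. x \<notin> N'"
      then show "AE x in lebesgue. indicator A x *\<^sub>R f x = indicator B x *\<^sub>R f x"
        by eventually_elim (use B in \<open>auto simp: indicator_def\<close>)
    qed (use A B in auto)
    then show ?thesis using borel B by simp
  qed
  let ?M = "lebesgue_on (cbox c d)"
  have sm: "finite_measure ?M" using emeasure_lborel_cbox_finite[of c d]
    by (intro finite_measureI) (auto simp: emeasure_restrict_space)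
  have "AE x in ?M. f x = 0"
  proof (rule sigma_finite_measure.density_zero)
    show "sigma_finite_measure ?M" using sm by (simp add: finite_measure_def)
    show "integrable ?M f" using f
      by (subst integrable_restrict_space) (auto intro!: integrable_mult_indicator)
    fix A assume "A \<in> sets ?M"
    then have A: "A \<in> sets lebesgue" by (auto simp: sets_restrict_space)
    have "set_lebesgue_integral ?M A f = (\<integral>x. indicator (cbox c d) x *\<^sub>R indicator A x *\<^sub>R f x \<partial>lebesgue)"
      unfolding set_lebesgue_integral_def by (rule integral_restrict_space) simp
    also have "(\<lambda>x. indicator (cbox c d) x *\<^sub>R indicator A x *\<^sub>R f x) = (\<lambda>x. indicator A x *\<^sub>R f x)"
      by (auto simp: f_def Dc_def indicator_def fun_eq_iff)
    finally show "set_lebesgue_integral ?M A f = 0" using leb[OF A] by simp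
  qed
  then have "AE x in lebesgue. x \<in> cbox c d \<longrightarrow> f x = 0" by (simp add: AE_restrict_space_iff)
  \<comment> \<open>The faces of the box, on which f was set to 0, form a null set.\<close>
  moreover have "AE x in lebesgue. x \<notin> cbox c d - box c d"
    by (intro AE_not_in) (simp add: negligible_iff_null_sets[symmetric] negligible_frontier_interval)
  ultimately show ?thesis
    by eventually_elim (auto simp: f_def Dc_def)
qed

text \<open>Bumps on boxes inside S are test functions, so the difference of the two gradients is
  orthogonal to them and vanishes a.e. on each box of a countable cover.\<close>

lemma weak_gradient_unique:
  fixes S :: "'a::euclidean_space set"
  assumes S: "open S" and G: "has_weak_gradient S u G" and H: "has_weak_gradient S u H"
  shows "AE x in lebesgue_on S. G x = H x"
proof -
  obtain \<D> where \<D>: "countable \<D>" "\<D> \<subseteq> Pow S" "\<And>X. X \<in> \<D> \<Longrightarrow> \<exists>a b. X = cbox a b" "\<Union>\<D> = S"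
    using open_countable_Union_open_cbox[OF S] by metis
  have Gi: "\<And>K. compact K \<Longrightarrow> K \<subseteq> S \<Longrightarrow> G absolutely_integrable_on K"
    and Hi: "\<And>K. compact K \<Longrightarrow> K \<subseteq> S \<Longrightarrow> H absolutely_integrable_on K"
    using G H by (auto simp: has_weak_gradient_def)
  have "AE x in lebesgue. x \<in> X \<longrightarrow> G x - H x = 0" if X: "X \<in> \<D>" for X
  proof -
    obtain c d where cd: "X = cbox c d" using X \<D>(3) by blast
    have XS: "cbox c d \<subseteq> S" using X \<D>(2) cd by auto
    have "AE x in lebesgue. x \<in> cbox c d \<longrightarrow> G x - H x = 0"
    proof (rule fundamental_lemma_cbox)
      show "(\<lambda>x. G x - H x) absolutely_integrable_on cbox c d"
        using Gi[of "cbox c d"] Hi[of "cbox c d"] XS by (intro set_integral_diff(1)) auto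
      fix a b n assume ab: "cbox a b \<subseteq> cbox c d"
      let ?\<phi> = "bump (real (Suc n)) a b"
      have \<phi>: "?\<phi> \<in> test_funs S" using ab XS by (intro bump_in_test_funs) auto
      have z: "x \<notin> S \<Longrightarrow> ?\<phi> x = 0" for x using test_funs_C1[OF \<phi>] by (simp add: C1_supported_def)
      have eq: "(\<integral>x. ?\<phi> x *\<^sub>R F x \<partial>lebesgue_on S) = (\<integral>x. ?\<phi> x *\<^sub>R F x \<partial>lebesgue)" for F :: "'a \<Rightarrow> 'a"
      proof -
        have "(\<integral>x. ?\<phi> x *\<^sub>R F x \<partial>lebesgue_on S) = (\<integral>x. indicator S x *\<^sub>R ?\<phi> x *\<^sub>R F x \<partial>lebesgue)"
          using S by (intro integral_restrict_space) simp
        also have "(\<lambda>x. indicator S x *\<^sub>R ?\<phi> x *\<^sub>R F x) = (\<lambda>x. ?\<phi> x *\<^sub>R F x)"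
          using z by (auto simp: indicator_def fun_eq_iff)
        finally show ?thesis .
      qed
      have "- (\<integral>x. ?\<phi> x *\<^sub>R G x \<partial>lebesgue_on S) = - (\<integral>x. ?\<phi> x *\<^sub>R H x \<partial>lebesgue_on S)"
        using G H \<phi> unfolding has_weak_gradient_def by metis
      then show "(\<integral>x. ?\<phi> x *\<^sub>R (G x - H x) \<partial>lebesgue) = 0"
        using test_fun_times_integrable[OF \<phi> Gi] test_fun_times_integrable[OF \<phi> Hi]
        by (simp add: eq scaleR_diff_right del: of_nat_Suc)
    qed
    then show ?thesis using cd by simp
  qed
  then have "AE x in lebesgue. \<forall>X\<in>\<D>. x \<in> X \<longrightarrow> G x - H x = 0"
    by (intro AE_ball_countable[OF \<D>(1), THEN iffD2] ballI)
  then have "AE x in lebesgue. x \<in> S \<longrightarrow> G x = H x"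
    by eventually_elim (use \<D>(4) in force)
  then show ?thesis using S by (simp add: AE_restrict_space_iff)
qed

section \<open>Embeddings for variable exponents\<close>

text \<open>The \<epsilon>-\<delta> form of \<open>energy_tendsto\<close>. It serves the midpoints
  of a minimizing sequence, which carry two indices and do not form a sequence.\<close>

lemma (in variable_exponent) energy_continuous:
  fixes G :: "'a \<Rightarrow> 'b::euclidean_space"
  assumes G: "Lvar G" and \<epsilon>: "0 < \<epsilon>"
  obtains \<delta> where "0 < \<delta>" "\<And>F. Lvar F \<Longrightarrow> rho (\<lambda>x. F x - G x) < \<delta> \<Longrightarrow> \<bar>energy F - energy G\<bar> < \<epsilon>"
proof (rule ccontr)
  assume "\<not> thesis"
  then have "\<forall>n. \<exists>F::'a \<Rightarrow> 'b. Lvar F \<and> rho (\<lambda>x. F x - G x) < inverse (real (Suc n)) \<and> \<not> \<bar>energy F - energy G\<bar> < \<epsilon>"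
    using that by (metis inverse_positive_iff_positive of_nat_0_less_iff zero_less_Suc)
  then obtain F :: "nat \<Rightarrow> 'a \<Rightarrow> 'b" where F: "\<And>n. Lvar (F n)"
    "\<And>n. rho (\<lambda>x. F n x - G x) < inverse (real (Suc n))" "\<And>n. \<not> \<bar>energy (F n) - energy G\<bar> < \<epsilon>"
    by metis
  have "(\<lambda>n. rho (\<lambda>x. F n x - G x)) \<longlonglongrightarrow> 0"
    by (rule tendsto_sandwich[OF _ _ tendsto_const LIMSEQ_inverse_real_of_nat])
      (intro always_eventually allI rho_nonneg less_imp_le F(2))+
  then have "(\<lambda>n. energy (F n)) \<longlonglongrightarrow> energy G" by (rule energy_tendsto[OF F(1) G])
  then have "\<forall>\<^sub>F n in sequentially. dist (energy (F n)) (energy G) < \<epsilon>" using \<epsilon> by (rule tendstoD)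
  then show False using F(3) by (auto simp: dist_real_def eventually_sequentially)
qed

lemma (in variable_exponent) rho_cong_AE:
  assumes "AE x in M. norm (F x) = norm (G x)" "F \<in> borel_measurable M" "G \<in> borel_measurable M"
  shows "rho F = rho G"
  unfolding rho_def
proof (rule integral_cong_AE)
  show "AE x in M. norm (F x) powr e x = norm (G x) powr e x" using assms(1) by eventually_elim simp
qed (use assms(2,3) in measurable)

locale lebesgue_variable_exponent = variable_exponent "lebesgue_on S" e lo hi
  for S :: "'a::euclidean_space set" and e lo hi
begin

section \<open>Luxemburg norms expressed by modulars\<close>

lemma modular_eq:
  assumes "Lvar u" shows "modular S e u = ennreal (rho u)"
proof -
  have "(\<integral>\<^sup>+x. ennreal (norm (u x) powr e x) \<partial>lebesgue_on S) = ennreal (rho u)"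
    unfolding rho_def by (rule nn_integral_eq_integral[OF Lvar_integrable[OF assms]]) simp
  then show ?thesis by (simp add: modular_def)
qed

lemma Lp_var_iff: "u \<in> Lp_var S e \<longleftrightarrow> Lvar u"
proof
  assume u: "u \<in> Lp_var S e"
  then have [measurable]: "u \<in> borel_measurable (lebesgue_on S)" by (simp add: Lp_var_def)
  have "(\<lambda>x. norm (u x) powr e x) \<in> borel_measurable (lebesgue_on S)" by measurable
  then show "Lvar u"
    using u by (auto simp: Lp_var_def Lvar_def modular_def intro!: integrableI_bounded)
qed (simp add: Lp_var_def Lvar_measurable modular_eq)

text \<open>The set over which the infimum is taken contains max 1 (rho u): dividing by \<mu> \<ge>
  1 shrinks the modular at least by the factor 1/\<mu>. The infimum would carry no information if
  the set were empty.\<close>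

lemma luxemburg_set:
  assumes u: "Lvar u"
  shows "{\<mu>. \<mu> > 0 \<and> modular S e (\<lambda>x. u x / \<mu>) \<le> 1} = {\<mu>. \<mu> > 0 \<and> rho (\<lambda>x. (1 / \<mu>) *\<^sub>R u x) \<le> 1}"
    and "{\<mu>. \<mu> > 0 \<and> modular S e (\<lambda>x. u x / \<mu>) \<le> 1} \<noteq> {}"
proof -
  show eq: "{\<mu>. \<mu> > 0 \<and> modular S e (\<lambda>x. u x / \<mu>) \<le> 1} = {\<mu>. \<mu> > 0 \<and> rho (\<lambda>x. (1 / \<mu>) *\<^sub>R u x) \<le> 1}"
  proof -
    have "modular S e (\<lambda>x. u x / \<mu>) = ennreal (rho (\<lambda>x. (1 / \<mu>) *\<^sub>R u x))" for \<mu>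
      using modular_eq[OF Lvar_scaleR[OF u, of "1 / \<mu>"]] by simp
    then show ?thesis by (simp only: ennreal_le_1)
  qed
  define \<mu> where "\<mu> = max 1 (rho u)"
  have \<mu>: "1 \<le> \<mu>" "rho u \<le> \<mu>" by (auto simp: \<mu>_def)
  have "rho (\<lambda>x. (1 / \<mu>) *\<^sub>R u x) \<le> \<bar>1 / \<mu>\<bar> powr lo * rho u"
    using \<mu> by (intro rho_scaleR_le_small u) auto
  also have "\<dots> \<le> \<bar>1 / \<mu>\<bar> powr 1 * rho u"
    using \<mu> lo_gt_1 rho_nonneg by (intro mult_right_mono powr_mono') auto
  also have "\<dots> \<le> 1" using \<mu> by (simp add: divide_le_eq)
  finally have "\<mu> \<in> {\<mu>. \<mu> > 0 \<and> rho (\<lambda>x. (1 / \<mu>) *\<^sub>R u x) \<le> 1}" using \<mu> by simp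
  then show "{\<mu>. \<mu> > 0 \<and> modular S e (\<lambda>x. u x / \<mu>) \<le> 1} \<noteq> {}" unfolding eq by blast
qed

lemma luxemburg_nonneg: "Lvar u \<Longrightarrow> 0 \<le> luxemburg S e u"
  unfolding luxemburg_def by (rule cInf_greatest[OF luxemburg_set(2)]) auto

lemma luxemburg_le:
  assumes "Lvar u" "0 < \<mu>" "rho (\<lambda>x. (1 / \<mu>) *\<^sub>R u x) \<le> 1"
  shows "luxemburg S e u \<le> \<mu>"
  unfolding luxemburg_def luxemburg_set(1)[OF assms(1)]
  by (rule cInf_lower) (use assms in \<open>auto intro!: bdd_belowI[of _ 0]\<close>)

text \<open>Write u = \<mu> v with rho v \<le> 1 and \<mu> < \<epsilon> \<le> 1; the factor \<mu>
  scales the modular by at most \<mu>^lo \<le> \<mu>.\<close>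

lemma luxemburg_lessD:
  assumes u: "Lvar u" and lt: "luxemburg S e u < \<epsilon>" and \<epsilon>: "\<epsilon> \<le> 1"
  shows "rho u < \<epsilon>"
proof -
  obtain \<mu> where \<mu>: "0 < \<mu>" "rho (\<lambda>x. (1 / \<mu>) *\<^sub>R u x) \<le> 1" "\<mu> < \<epsilon>"
    using cInf_lessD[OF luxemburg_set(2)[OF u] lt[unfolded luxemburg_def]]
    unfolding luxemburg_set(1)[OF u] by auto
  have "rho u = rho (\<lambda>x. \<mu> *\<^sub>R ((1 / \<mu>) *\<^sub>R u x))" using \<mu> by simp
  also have "\<dots> \<le> \<bar>\<mu>\<bar> powr lo * rho (\<lambda>x. (1 / \<mu>) *\<^sub>R u x)"
    using \<mu> \<epsilon> by (intro rho_scaleR_le_small Lvar_scaleR u) auto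
  also have "\<dots> \<le> \<bar>\<mu>\<bar> powr 1 * 1"
    using \<mu> \<epsilon> lo_gt_1 by (intro mult_mono powr_mono') (auto simp: rho_nonneg)
  finally show ?thesis using \<mu> by simp
qed

text \<open>The bridge between the norms in which the problem is posed and the modulars of the
  proof. In the direction towards the norm, division by a fixed \<mu> costs only the constant
  (1/\<mu>)^hi.\<close>

lemma luxemburg_tendsto_0_iff:
  assumes u: "\<And>n. Lvar (u n)"
  shows "(\<lambda>n. luxemburg S e (u n)) \<longlonglongrightarrow> 0 \<longleftrightarrow> (\<lambda>n. rho (u n)) \<longlonglongrightarrow> 0"
proof
  assume L: "(\<lambda>n. luxemburg S e (u n)) \<longlonglongrightarrow> 0"
  show "(\<lambda>n. rho (u n)) \<longlonglongrightarrow> 0"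
  proof (rule tendstoI)
    fix \<epsilon> :: real assume "0 < \<epsilon>"
    then have "0 < min 1 \<epsilon>" by simp
    with L have "\<forall>\<^sub>F n in sequentially. luxemburg S e (u n) < min 1 \<epsilon>" by (rule order_tendstoD(2))
    then show "\<forall>\<^sub>F n in sequentially. dist (rho (u n)) 0 < \<epsilon>"
    proof eventually_elim
      case (elim n)
      have "rho (u n) < min 1 \<epsilon>" by (rule luxemburg_lessD[OF u elim]) simp
      then show ?case by (simp add: rho_nonneg)
    qed
  qed
next
  assume R: "(\<lambda>n. rho (u n)) \<longlonglongrightarrow> 0"
  show "(\<lambda>n. luxemburg S e (u n)) \<longlonglongrightarrow> 0"
  proof (rule tendstoI)
    fix \<epsilon> :: real assume \<epsilon>: "0 < \<epsilon>"
    define \<mu> where "\<mu> = min 1 (\<epsilon> / 2)"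
    have \<mu>: "0 < \<mu>" "\<mu> \<le> 1" "\<mu> < \<epsilon>" using \<epsilon> by (auto simp: \<mu>_def)
    have "(\<lambda>n. (1 / \<mu>) powr hi * rho (u n)) \<longlonglongrightarrow> (1 / \<mu>) powr hi * 0" by (intro tendsto_intros R)
    then have "\<forall>\<^sub>F n in sequentially. (1 / \<mu>) powr hi * rho (u n) < 1"
      by (intro order_tendstoD(2)) auto
    then show "\<forall>\<^sub>F n in sequentially. dist (luxemburg S e (u n)) 0 < \<epsilon>"
    proof eventually_elim
      case (elim n)
      have "rho (\<lambda>x. (1 / \<mu>) *\<^sub>R u n x) \<le> (1 / \<mu>) powr hi * rho (u n)"
        using \<mu> by (intro rho_scaleR_le u) auto
      then have "luxemburg S e (u n) \<le> \<mu>" using elim \<mu> u by (intro luxemburg_le) auto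
      then show ?case using \<mu> luxemburg_nonneg[OF u[of n]] by simp
    qed
  qed
qed

end

text \<open>p is the exponent of the gradient, r that of the function. The locale is used twice,
  with r = p to control u in L^p itself and with r = q for the right-hand side of the
  equation.\<close>

locale subcritical =
  P: lebesgue_variable_exponent S p lo hi + R: lebesgue_variable_exponent S r lo' hi'
  for S :: "'a::euclidean_space set" and p r and lo hi lo' hi' +
  assumes S_open: "open S" and S_bounded: "bounded S"
    and p_cont: "continuous_on (closure S) p" and r_cont: "continuous_on (closure S) r"
    and p_gt_1: "x \<in> closure S \<Longrightarrow> 1 < p x" and p_less_DIM: "x \<in> closure S \<Longrightarrow> p x < real DIM('a)"
    and r_ge_1: "x \<in> closure S \<Longrightarrow> 1 \<le> r x"
    and r_less: "x \<in> closure S \<Longrightarrow> r x < real DIM('a) * p x / (real DIM('a) - p x)"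
begin

section \<open>Sobolev, Poincare and Rellich estimates for test functions\<close>

abbreviation "T \<equiv> test_funs S"

lemma S_sets: "S \<in> sets lebesgue" "S \<in> sets borel"
  using S_open by auto

lemma test_measurable:
  assumes "\<phi> \<in> T"
  shows "\<phi> \<in> borel_measurable (lebesgue_on S)" "gradient \<phi> \<in> borel_measurable (lebesgue_on S)"
  using C1_supported_measurable[OF test_funs_C1[OF assms]]
  by (auto intro!: measurable_restrict_space1 measurable_completion)

lemma test_Lvar:
  assumes "\<phi> \<in> T"
  shows "P.Lvar \<phi>" "P.Lvar (gradient \<phi>)" "R.Lvar \<phi>"
proof -
  obtain B where "0 \<le> B" "\<And>x. \<bar>\<phi> x\<bar> \<le> B" "\<And>x. norm (gradient \<phi> x) \<le> B"
    using C1_supported_bounded[OF test_funs_C1[OF assms] S_bounded] by blast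
  then show "P.Lvar \<phi>" "P.Lvar (gradient \<phi>)" "R.Lvar \<phi>"
    by (auto intro!: P.Lvar_bounded R.Lvar_bounded test_measurable assms)
qed

lemma nn_integral_lebesgue_on_S:
  "(\<integral>\<^sup>+x. f x \<partial>lebesgue_on S) = (\<integral>\<^sup>+x. indicator S x * f x \<partial>lborel)"
  using S_sets by (subst nn_integral_restrict_space) (auto simp: nn_integral_completion mult.commute)

lemma rho_nn_integral:
  shows "P.Lvar F \<Longrightarrow> (\<integral>\<^sup>+x. indicator S x * ennreal (norm (F x) powr p x) \<partial>lborel) = ennreal (P.rho F)"
    and "R.Lvar F \<Longrightarrow> (\<integral>\<^sup>+x. indicator S x * ennreal (norm (F x) powr r x) \<partial>lborel) = ennreal (R.rho F)"
  by (auto simp: P.rho_def R.rho_def P.Lvar_integrable R.Lvar_integrable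
      simp flip: nn_integral_lebesgue_on_S intro!: nn_integral_eq_integral)

lemma L1_nn_integral:
  fixes F :: "'a \<Rightarrow> 'b::euclidean_space"
  assumes "integrable (lebesgue_on S) F" "\<And>x. x \<notin> S \<Longrightarrow> F x = 0"
  shows "(\<integral>\<^sup>+x. ennreal (norm (F x)) \<partial>lborel) = ennreal (\<integral>x. norm (F x) \<partial>lebesgue_on S)"
proof -
  have "(\<integral>\<^sup>+x. ennreal (norm (F x)) \<partial>lborel) = (\<integral>\<^sup>+x. indicator S x * ennreal (norm (F x)) \<partial>lborel)"
    using assms(2) by (intro nn_integral_cong) (auto simp: indicator_def)
  also have "\<dots> = ennreal (\<integral>x. norm (F x) \<partial>lebesgue_on S)"
    unfolding nn_integral_lebesgue_on_S[symmetric]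
    by (rule nn_integral_eq_integral) (use assms(1) in auto)
  finally show ?thesis .
qed

lemma test_L1:
  assumes "\<phi> \<in> T"
  shows "(\<integral>\<^sup>+x. ennreal \<bar>\<phi> x\<bar> \<partial>lborel) = ennreal (\<integral>x. \<bar>\<phi> x\<bar> \<partial>lebesgue_on S)"
    and "(\<integral>\<^sup>+x. ennreal (norm (gradient \<phi> x)) \<partial>lborel) = ennreal (\<integral>x. norm (gradient \<phi> x) \<partial>lebesgue_on S)"
  using L1_nn_integral[of \<phi>] L1_nn_integral[of "gradient \<phi>"] test_funs_C1[OF assms]
    P.Lvar_imp_integrable[OF test_Lvar(1)[OF assms]] P.Lvar_imp_integrable[OF test_Lvar(2)[OF assms]]
  by (simp_all add: C1_supported_def)

lemma test_diff:
  assumes "\<phi> \<in> T" "\<psi> \<in> T"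
  shows "(\<lambda>x. \<phi> x - \<psi> x) \<in> T" "gradient (\<lambda>x. \<phi> x - \<psi> x) = (\<lambda>x. gradient \<phi> x - gradient \<psi> x)"
  using test_funs_add[OF assms(1) test_funs_cmult[OF assms(2), of "-1"]]
    gradient_add[OF assms(1) test_funs_cmult[OF assms(2), of "-1"]] gradient_cmult[OF assms(2), of "-1"]
  by simp_all

lemma test_interpolation:
  assumes "0 \<le> K" "0 < \<epsilon>"
  obtains \<eta> where "0 < \<eta>"
    "\<And>\<phi>. \<phi> \<in> T \<Longrightarrow> P.rho (gradient \<phi>) \<le> K \<Longrightarrow> (\<integral>x. \<bar>\<phi> x\<bar> \<partial>lebesgue_on S) \<le> \<eta> \<Longrightarrow> R.rho \<phi> \<le> \<epsilon>"
proof -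
  obtain \<eta> where \<eta>: "0 < \<eta>"
    "\<And>u g. C1_supported S u g \<Longrightarrow>
       (\<integral>\<^sup>+x. indicator S x * ennreal (norm (g x) powr p x) \<partial>lborel) \<le> ennreal K \<Longrightarrow>
       (\<integral>\<^sup>+x. ennreal \<bar>u x\<bar> \<partial>lborel) \<le> ennreal \<eta> \<Longrightarrow>
       (\<integral>\<^sup>+x. indicator S x * ennreal (\<bar>u x\<bar> powr r x) \<partial>lborel) \<le> ennreal \<epsilon>"
    using sobolev_interpolation[OF S_open S_bounded p_cont r_cont p_gt_1 p_less_DIM r_ge_1 r_less assms] by blast
  show ?thesis
  proof (rule that[OF \<eta>(1)])
    fix \<phi> assume \<phi>: "\<phi> \<in> T" and K: "P.rho (gradient \<phi>) \<le> K" and L: "(\<integral>x. \<bar>\<phi> x\<bar> \<partial>lebesgue_on S) \<le> \<eta>"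
    have "ennreal (R.rho \<phi>) \<le> ennreal \<epsilon>"
      using \<eta>(2)[OF test_funs_C1[OF \<phi>]] K L \<phi>
      by (simp add: rho_nn_integral test_Lvar test_L1 ennreal_leI flip: rho_nn_integral(2)[OF test_Lvar(3)[OF \<phi>], unfolded real_norm_def])
    then show "R.rho \<phi> \<le> \<epsilon>" using assms by (simp add: ennreal_le_iff)
  qed
qed

lemma test_poincare:
  obtains C where "0 < C"
    "\<And>\<phi>. \<phi> \<in> T \<Longrightarrow> (\<integral>x. \<bar>\<phi> x\<bar> \<partial>lebesgue_on S) \<le> C * (\<integral>x. norm (gradient \<phi> x) \<partial>lebesgue_on S)"
proof -
  obtain C where C: "0 < C" "\<And>u g. C1_supported S u g \<Longrightarrow>
    (\<integral>\<^sup>+z. ennreal \<bar>u z\<bar> \<partial>lborel) \<le> ennreal C * (\<integral>\<^sup>+z. ennreal (norm (g z)) \<partial>lborel)"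
    using poincare_L1[OF S_bounded] by blast
  show ?thesis
  proof (rule that[OF C(1)])
    fix \<phi> assume \<phi>: "\<phi> \<in> T"
    have "ennreal (\<integral>x. \<bar>\<phi> x\<bar> \<partial>lebesgue_on S) \<le> ennreal (C * (\<integral>x. norm (gradient \<phi> x) \<partial>lebesgue_on S))"
      using C(2)[OF test_funs_C1[OF \<phi>]] C(1) by (simp add: test_L1[OF \<phi>] ennreal_mult)
    then show "(\<integral>x. \<bar>\<phi> x\<bar> \<partial>lebesgue_on S) \<le> C * (\<integral>x. norm (gradient \<phi> x) \<partial>lebesgue_on S)"
      using C(1) by (subst (asm) ennreal_le_iff) auto
  qed
qed

text \<open>Poincare bounds the L^1 norm. A fixed factor s brings it below the threshold of the
  interpolation without increasing the gradient modular, and undoing the scaling costs the constant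
  (1/s)^hi'.\<close>

lemma test_embedding:
  assumes K: "0 \<le> K"
  obtains C where "0 \<le> C" "\<And>\<phi>. \<phi> \<in> T \<Longrightarrow> P.rho (gradient \<phi>) \<le> K \<Longrightarrow> R.rho \<phi> \<le> C"
proof -
  obtain \<eta> where \<eta>: "0 < \<eta>"
    "\<And>\<phi>. \<phi> \<in> T \<Longrightarrow> P.rho (gradient \<phi>) \<le> K \<Longrightarrow> (\<integral>x. \<bar>\<phi> x\<bar> \<partial>lebesgue_on S) \<le> \<eta> \<Longrightarrow> R.rho \<phi> \<le> 1"
    using test_interpolation[OF K zero_less_one] by blast
  obtain C where C: "0 < C"
    "\<And>\<phi>. \<phi> \<in> T \<Longrightarrow> (\<integral>x. \<bar>\<phi> x\<bar> \<partial>lebesgue_on S) \<le> C * (\<integral>x. norm (gradient \<phi> x) \<partial>lebesgue_on S)"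
    using test_poincare by blast
  define A where "A = C * (measure (lebesgue_on S) (space (lebesgue_on S)) + K)"
  have A: "0 \<le> A" using C K by (simp add: A_def)
  define s where "s = min 1 (\<eta> / (A + 1))"
  have s: "0 < s" "s \<le> 1" using A \<eta> by (auto simp: s_def)
  have "s * A \<le> \<eta> / (A + 1) * (A + 1)" using A \<eta> by (intro mult_mono) (auto simp: s_def)
  then have sA: "s * A \<le> \<eta>" using A by simp
  show ?thesis
  proof (rule that[of "(1 / s) powr hi'"])
    fix \<phi> assume \<phi>: "\<phi> \<in> T" and \<phi>K: "P.rho (gradient \<phi>) \<le> K"
    let ?\<psi> = "\<lambda>x. s * \<phi> x"
    have \<psi>: "?\<psi> \<in> T" "gradient ?\<psi> = (\<lambda>x. s *\<^sub>R gradient \<phi> x)"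
      using test_funs_cmult[OF \<phi>] gradient_cmult[OF \<phi>] by auto
    have "P.rho (gradient ?\<psi>) \<le> 1 powr hi * P.rho (gradient \<phi>)"
      unfolding \<psi> using s by (intro P.rho_scaleR_le test_Lvar \<phi>) auto
    then have 1: "P.rho (gradient ?\<psi>) \<le> K" using \<phi>K by simp
    have "(\<integral>x. norm (gradient \<phi> x) \<partial>lebesgue_on S) \<le> 1 * measure (lebesgue_on S) (space (lebesgue_on S)) + 1 powr (1 - hi) * P.rho (gradient \<phi>)"
      by (intro P.integral_norm_le_rho test_Lvar \<phi>) auto
    then have "C * (\<integral>x. norm (gradient \<phi> x) \<partial>lebesgue_on S) \<le> A"
      unfolding A_def using \<phi>K C by (intro mult_left_mono) auto
    then have "(\<integral>x. \<bar>\<phi> x\<bar> \<partial>lebesgue_on S) \<le> A" using C(2)[OF \<phi>] by simp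
    then have "s * (\<integral>x. \<bar>\<phi> x\<bar> \<partial>lebesgue_on S) \<le> s * A" using s by (intro mult_left_mono) auto
    moreover have "(\<integral>x. \<bar>?\<psi> x\<bar> \<partial>lebesgue_on S) = s * (\<integral>x. \<bar>\<phi> x\<bar> \<partial>lebesgue_on S)"
      using s by (simp add: abs_mult)
    ultimately have 2: "(\<integral>x. \<bar>?\<psi> x\<bar> \<partial>lebesgue_on S) \<le> \<eta>" using sA by linarith
    have "R.rho \<phi> = R.rho (\<lambda>x. (1 / s) *\<^sub>R ?\<psi> x)" using s by simp
    also have "\<dots> \<le> (1 / s) powr hi' * R.rho ?\<psi>"
      using s by (intro R.rho_scaleR_le test_Lvar \<psi>) auto
    also have "\<dots> \<le> (1 / s) powr hi' * 1" by (intro mult_left_mono \<eta>(2)[OF \<psi>(1) 1 2]) auto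
    finally show "R.rho \<phi> \<le> (1 / s) powr hi'" by simp
  qed simp
qed

text \<open>Continuity of the embedding at 0: a small gradient modular makes the gradient, and by
  Poincare the function, small in L^1, where the interpolation takes over. Through it every element
  of W_0^{1,p(x)} inherits convergence in the q-modular.\<close>

lemma test_rho_small:
  assumes "0 < \<epsilon>"
  obtains \<delta> where "0 < \<delta>" "\<And>\<phi>. \<phi> \<in> T \<Longrightarrow> P.rho (gradient \<phi>) \<le> \<delta> \<Longrightarrow> R.rho \<phi> \<le> \<epsilon>"
proof -
  obtain \<eta> where \<eta>: "0 < \<eta>"
    "\<And>\<phi>. \<phi> \<in> T \<Longrightarrow> P.rho (gradient \<phi>) \<le> 1 \<Longrightarrow> (\<integral>x. \<bar>\<phi> x\<bar> \<partial>lebesgue_on S) \<le> \<eta> \<Longrightarrow> R.rho \<phi> \<le> \<epsilon>"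
    using test_interpolation[OF zero_le_one assms] by blast
  obtain C where C: "0 < C"
    "\<And>\<phi>. \<phi> \<in> T \<Longrightarrow> (\<integral>x. \<bar>\<phi> x\<bar> \<partial>lebesgue_on S) \<le> C * (\<integral>x. norm (gradient \<phi> x) \<partial>lebesgue_on S)"
    using test_poincare by blast
  obtain \<delta> where \<delta>: "0 < \<delta>"
    "\<And>F :: 'a \<Rightarrow> 'a. P.Lvar F \<Longrightarrow> P.rho F \<le> \<delta> \<Longrightarrow> (\<integral>x. norm (F x) \<partial>lebesgue_on S) < \<eta> / C"
    using P.rho_small_imp_L1_small[of "\<eta> / C"] \<eta>(1) C(1) divide_pos_pos by blast
  show ?thesis
  proof (rule that[of "min 1 \<delta>"])
    show "0 < min 1 \<delta>" using \<delta> by simp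
    fix \<phi> assume \<phi>: "\<phi> \<in> T" and le: "P.rho (gradient \<phi>) \<le> min 1 \<delta>"
    have "(\<integral>x. norm (gradient \<phi> x) \<partial>lebesgue_on S) < \<eta> / C"
      using \<delta>(2)[OF test_Lvar(2)[OF \<phi>]] le by simp
    then have "C * (\<integral>x. norm (gradient \<phi> x) \<partial>lebesgue_on S) \<le> \<eta>"
      using C(1) by (simp add: pos_less_divide_eq mult.commute)
    then show "R.rho \<phi> \<le> \<epsilon>" using \<eta>(2)[OF \<phi>] C(2)[OF \<phi>] le by simp
  qed
qed

lemma test_rellich:
  assumes \<phi>: "\<And>n. \<phi> n \<in> T" and K: "\<And>n. P.rho (gradient (\<phi> n)) \<le> K"
  obtains s where "strict_mono (s :: nat \<Rightarrow> nat)"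
    "\<And>\<epsilon>. 0 < \<epsilon> \<Longrightarrow> \<exists>N. \<forall>m\<ge>N. \<forall>n\<ge>N. (\<integral>x. norm (\<phi> (s m) x - \<phi> (s n) x) \<partial>lebesgue_on S) < \<epsilon>"
proof -
  define K' where "K' = measure (lebesgue_on S) (space (lebesgue_on S)) + max 0 K"
  have K'0: "0 \<le> K'" by (simp add: K'_def)
  have K': "(\<integral>\<^sup>+z. ennreal (norm (gradient (\<phi> n) z)) \<partial>lborel) \<le> ennreal K'" for n
  proof -
    have "(\<integral>x. norm (gradient (\<phi> n) x) \<partial>lebesgue_on S) \<le> 1 * measure (lebesgue_on S) (space (lebesgue_on S)) + 1 powr (1 - hi) * P.rho (gradient (\<phi> n))"
      by (intro P.integral_norm_le_rho test_Lvar \<phi>) auto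
    then show ?thesis unfolding test_L1[OF \<phi>] using K[of n] by (intro ennreal_leI) (simp add: K'_def)
  qed
  obtain s where s: "strict_mono (s :: nat \<Rightarrow> nat)"
    "\<forall>\<epsilon>>0. \<exists>N. \<forall>m\<ge>N. \<forall>n\<ge>N. (\<integral>\<^sup>+x. ennreal \<bar>\<phi> (s m) x - \<phi> (s n) x\<bar> \<partial>lborel) \<le> ennreal \<epsilon>"
    using rellich_L1[of S \<phi> "\<lambda>n. gradient (\<phi> n)" K', OF S_bounded S_sets(2) test_funs_C1[OF \<phi>] K' K'0] by blast
  show ?thesis
  proof (rule that[OF s(1)])
    fix \<epsilon> :: real assume "0 < \<epsilon>"
    then have "0 < \<epsilon> / 2" by simp
    with s(2) obtain N where N: "\<And>m n. m \<ge> N \<Longrightarrow> n \<ge> N \<Longrightarrow> (\<integral>\<^sup>+x. ennreal \<bar>\<phi> (s m) x - \<phi> (s n) x\<bar> \<partial>lborel) \<le> ennreal (\<epsilon> / 2)"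
      by blast
    have "(\<integral>x. norm (\<phi> (s m) x - \<phi> (s n) x) \<partial>lebesgue_on S) < \<epsilon>" if "m \<ge> N" "n \<ge> N" for m n
    proof -
      have "ennreal (\<integral>x. \<bar>\<phi> (s m) x - \<phi> (s n) x\<bar> \<partial>lebesgue_on S) \<le> ennreal (\<epsilon> / 2)"
        using N[OF that] unfolding test_L1(1)[OF test_diff(1)[OF \<phi> \<phi>]] .
      then have "(\<integral>x. \<bar>\<phi> (s m) x - \<phi> (s n) x\<bar> \<partial>lebesgue_on S) \<le> \<epsilon> / 2"
        using \<open>0 < \<epsilon>\<close> by (subst (asm) ennreal_le_iff) auto
      then show ?thesis using \<open>0 < \<epsilon>\<close> by simp
    qed
    then show "\<exists>N. \<forall>m\<ge>N. \<forall>n\<ge>N. (\<integral>x. norm (\<phi> (s m) x - \<phi> (s n) x) \<partial>lebesgue_on S) < \<epsilon>" by blast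
  qed
qed

text \<open>The interpolation is applied to differences: their gradient modulars stay below 2^hi (K
  + K), so smallness in L^1 carries over to the r-modular.\<close>

lemma test_L1_Cauchy_imp_rho_Cauchy:
  fixes \<phi> :: "nat \<Rightarrow> 'a \<Rightarrow> real"
  assumes \<phi>: "\<And>n. \<phi> n \<in> T" and K: "\<And>n. P.rho (gradient (\<phi> n)) \<le> K" and
    C: "\<And>\<epsilon>. 0 < \<epsilon> \<Longrightarrow> \<exists>N. \<forall>m\<ge>N. \<forall>n\<ge>N. (\<integral>x. norm (\<phi> m x - \<phi> n x) \<partial>lebesgue_on S) < \<epsilon>" and \<epsilon>: "0 < \<epsilon>"
  shows "\<exists>N. \<forall>m\<ge>N. \<forall>n\<ge>N. R.rho (\<lambda>x. \<phi> m x - \<phi> n x) < \<epsilon>"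
proof -
  have K0: "0 \<le> 2 powr hi * (K + K)" using order_trans[OF P.rho_nonneg K[of 0]] by simp
  obtain \<eta> where \<eta>: "0 < \<eta>"
    "\<And>\<phi>. \<phi> \<in> T \<Longrightarrow> P.rho (gradient \<phi>) \<le> 2 powr hi * (K + K) \<Longrightarrow> (\<integral>x. \<bar>\<phi> x\<bar> \<partial>lebesgue_on S) \<le> \<eta> \<Longrightarrow> R.rho \<phi> \<le> \<epsilon> / 2"
    using test_interpolation[OF K0 half_gt_zero[OF \<epsilon>]] by blast
  obtain N where N: "\<And>m n. m \<ge> N \<Longrightarrow> n \<ge> N \<Longrightarrow> (\<integral>x. norm (\<phi> m x - \<phi> n x) \<partial>lebesgue_on S) < \<eta>"
    using C[OF \<eta>(1)] by blast
  have "R.rho (\<lambda>x. \<phi> m x - \<phi> n x) < \<epsilon>" if "m \<ge> N" "n \<ge> N" for m n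
  proof -
    have "P.rho (gradient (\<lambda>x. \<phi> m x - \<phi> n x)) \<le> 2 powr hi * (P.rho (gradient (\<phi> m)) + P.rho (gradient (\<phi> n)))"
      unfolding test_diff(2)[OF \<phi> \<phi>] by (intro P.rho_diff_le test_Lvar \<phi>)
    also have "\<dots> \<le> 2 powr hi * (K + K)" by (intro mult_left_mono add_mono K) auto
    finally show ?thesis
      using \<eta>(2)[OF test_diff(1)[OF \<phi> \<phi>], of m n] N[OF that] \<epsilon> by simp
  qed
  then show ?thesis by blast
qed

end

section \<open>Minimization\<close>

locale eigenvalue_problem =
  PP: subcritical S p p lo hi lo hi + PQ: subcritical S p q lo hi lo' hi'
  for S :: "'a::euclidean_space set" and p q and lo hi lo' hi'
begin

abbreviation "T \<equiv> test_funs S"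
abbreviation "M \<equiv> lebesgue_on S"
abbreviation "Phi \<equiv> PP.P.energy"
abbreviation "Psi \<equiv> PQ.R.energy"
abbreviation "rhop \<equiv> PP.P.rho"
abbreviation "rhoq \<equiv> PQ.R.rho"
abbreviation "Lp \<equiv> PP.P.Lvar"
abbreviation "Lq \<equiv> PQ.R.Lvar"

text \<open>A description of W_0^{1,p(x)}, as \<open>admissible_W01p\<close> and
  \<open>W01p_admissible\<close> show, with the gradient carried along as G. This keeps the choice
  made in \<open>weak_grad\<close> out of the minimization, and convergence in the q-modular is
  recorded as well.\<close>

definition admissible :: "('a \<Rightarrow> real) \<Rightarrow> ('a \<Rightarrow> 'a) \<Rightarrow> bool" where
  "admissible u G \<longleftrightarrow> Lp u \<and> Lq u \<and> Lp G \<and> (\<exists>\<phi>. (\<forall>k. \<phi> k \<in> T) \<and>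
     (\<lambda>k. rhop (\<lambda>x. gradient (\<phi> k) x - G x)) \<longlonglongrightarrow> 0 \<and>
     (\<lambda>k. rhop (\<lambda>x. \<phi> k x - u x)) \<longlonglongrightarrow> 0 \<and> (\<lambda>k. rhoq (\<lambda>x. \<phi> k x - u x)) \<longlonglongrightarrow> 0)"

text \<open>The bilinear map is a parameter because integration by parts passes to the limit in two
  products: in one the varying factor is the scalar, in the other the vector.\<close>

lemma integral_mult_tendsto:
  fixes F :: "nat \<Rightarrow> 'a \<Rightarrow> 'b::euclidean_space" and W :: "'a \<Rightarrow> 'c::euclidean_space"
    and f :: "'b \<Rightarrow> 'c \<Rightarrow> 'a"
  assumes f: "bounded_bilinear f"
    and F: "\<And>n. integrable M (F n)" "integrable M G" and W: "W \<in> borel_measurable M" "\<And>x. norm (W x) \<le> B"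
    and lim: "(\<lambda>n. \<integral>x. norm (F n x - G x) \<partial>M) \<longlonglongrightarrow> 0"
  shows "(\<lambda>n. \<integral>x. f (F n x) (W x) \<partial>M) \<longlonglongrightarrow> (\<integral>x. f (G x) (W x) \<partial>M)"
proof -
  interpret bounded_bilinear f by fact
  obtain K where K: "0 < K" "\<And>a b. norm (f a b) \<le> norm a * norm b * K" using pos_bounded by blast
  have bound: "norm (f a (W x)) \<le> norm a * (B * K)" for a x
  proof -
    have "norm (f a (W x)) \<le> norm a * norm (W x) * K" by (rule K)
    also have "\<dots> \<le> norm a * B * K" using W(2) K by (intro mult_right_mono mult_left_mono) auto
    finally show ?thesis by (simp add: mult.assoc)
  qed
  have B: "0 \<le> B" using W(2)[of undefined] norm_ge_zero order_trans by blast
  have int: "integrable M (\<lambda>x. f (H x) (W x))" if H: "integrable M H" for H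
  proof (rule Bochner_Integration.integrable_bound)
    show "integrable M (\<lambda>x. norm (H x) * (B * K))" using H by simp
    have "continuous_on UNIV (\<lambda>z. f (fst z) (snd z))" by (intro continuous_on continuous_intros)
    with borel_measurable_integrable[OF H] W(1) show "(\<lambda>x. f (H x) (W x)) \<in> borel_measurable M"
      by (rule borel_measurable_continuous_Pair)
    show "AE x in M. norm (f (H x) (W x)) \<le> norm (norm (H x) * (B * K))"
      using bound B K by (intro AE_I2) (auto simp: abs_mult)
  qed
  have "(\<lambda>n. (\<integral>x. f (F n x) (W x) \<partial>M) - (\<integral>x. f (G x) (W x) \<partial>M)) \<longlonglongrightarrow> 0"
  proof (rule Lim_null_comparison)
    show "(\<lambda>n. (\<integral>x. norm (F n x - G x) \<partial>M) * (B * K)) \<longlonglongrightarrow> 0"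
      using tendsto_mult_left_zero[OF lim] by simp
    show "\<forall>\<^sub>F n in sequentially. norm ((\<integral>x. f (F n x) (W x) \<partial>M) - (\<integral>x. f (G x) (W x) \<partial>M))
       \<le> (\<integral>x. norm (F n x - G x) \<partial>M) * (B * K)"
    proof (intro always_eventually allI)
      fix n
      have d: "integrable M (\<lambda>x. F n x - G x)" using F by simp
      have "(\<integral>x. f (F n x) (W x) \<partial>M) - (\<integral>x. f (G x) (W x) \<partial>M) = (\<integral>x. f (F n x - G x) (W x) \<partial>M)"
        using int[OF F(1)] int[OF F(2)] by (simp add: diff_left)
      also have "norm \<dots> \<le> (\<integral>x. norm (f (F n x - G x) (W x)) \<partial>M)" by (rule integral_norm_bound)
      also have "\<dots> \<le> (\<integral>x. norm (F n x - G x) * (B * K) \<partial>M)"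
        by (rule integral_mono) (use d int[OF d] bound in auto)
      also have "\<dots> = (\<integral>x. norm (F n x - G x) \<partial>M) * (B * K)" by simp
      finally show "norm ((\<integral>x. f (F n x) (W x) \<partial>M) - (\<integral>x. f (G x) (W x) \<partial>M))
       \<le> (\<integral>x. norm (F n x - G x) \<partial>M) * (B * K)" .
    qed
  qed
  then show ?thesis by (rule LIM_zero_cancel)
qed

lemma integrable_imp_absolutely_integrable_on_compact:
  fixes F :: "'a \<Rightarrow> 'b::euclidean_space"
  assumes F: "integrable M F" and K: "compact K" "K \<subseteq> S"
  shows "F absolutely_integrable_on K"
proof -
  have "integrable lebesgue (\<lambda>x. indicator S x *\<^sub>R F x)"
    using F PP.S_sets by (subst (asm) integrable_restrict_space) auto
  moreover have "K \<in> sets lebesgue" using K by (auto simp: lmeasurable_compact fmeasurableD)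
  ultimately have "integrable lebesgue (\<lambda>x. indicator K x *\<^sub>R (indicator S x *\<^sub>R F x))"
    by (rule integrable_mult_indicator[rotated])
  moreover have "(\<lambda>x. indicator K x *\<^sub>R (indicator S x *\<^sub>R F x)) = (\<lambda>x. indicator K x *\<^sub>R F x)"
    using K by (auto simp: indicator_def fun_eq_iff)
  ultimately show ?thesis by (simp add: set_integrable_def)
qed

text \<open>Integration by parts holds for the approximating test functions, and both sides converge
  because modular convergence implies convergence in L^1.\<close>

lemma admissible_has_weak_gradient:
  assumes "admissible u G" shows "has_weak_gradient S u G"
proof -
  obtain \<phi> where L: "Lp u" "Lq u" "Lp G" and \<phi>: "\<And>k. \<phi> k \<in> T"
     "(\<lambda>k. rhop (\<lambda>x. gradient (\<phi> k) x - G x)) \<longlonglongrightarrow> 0" "(\<lambda>k. rhop (\<lambda>x. \<phi> k x - u x)) \<longlonglongrightarrow> 0"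
    using assms unfolding admissible_def by blast
  have i: "integrable M u" "integrable M G" using L by (auto intro: PP.P.Lvar_imp_integrable)
  have "(\<integral>x. u x *\<^sub>R gradient \<psi> x \<partial>M) = - (\<integral>x. \<psi> x *\<^sub>R G x \<partial>M)" if \<psi>: "\<psi> \<in> T" for \<psi>
  proof -
    obtain B where "0 \<le> B" and B: "\<And>x. \<bar>\<psi> x\<bar> \<le> B" "\<And>x. norm (gradient \<psi> x) \<le> B"
      using C1_supported_bounded[OF test_funs_C1[OF \<psi>] PP.S_bounded] by blast
    have "(\<lambda>k. \<integral>x. \<phi> k x *\<^sub>R gradient \<psi> x \<partial>M) \<longlonglongrightarrow> (\<integral>x. u x *\<^sub>R gradient \<psi> x \<partial>M)"
    proof (rule integral_mult_tendsto[OF bounded_bilinear_scaleR])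
      show "(\<lambda>k. \<integral>x. norm (\<phi> k x - u x) \<partial>M) \<longlonglongrightarrow> 0"
        by (intro PP.P.rho_tendsto_0_imp_L1 \<phi> PP.P.Lvar_diff PP.test_Lvar L)
    qed (use i B \<psi> \<phi> in \<open>auto intro!: PP.test_measurable PP.P.Lvar_imp_integrable PP.test_Lvar\<close>)
    moreover have lim: "(\<lambda>k. \<integral>x. \<psi> x *\<^sub>R gradient (\<phi> k) x \<partial>M) \<longlonglongrightarrow> (\<integral>x. \<psi> x *\<^sub>R G x \<partial>M)"
    proof (rule integral_mult_tendsto[OF bounded_bilinear.flip[OF bounded_bilinear_scaleR]])
      show "(\<lambda>k. \<integral>x. norm (gradient (\<phi> k) x - G x) \<partial>M) \<longlonglongrightarrow> 0"
        by (intro PP.P.rho_tendsto_0_imp_L1 \<phi> PP.P.Lvar_diff PP.test_Lvar L)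
    qed (use i B \<psi> \<phi> in \<open>auto intro!: PP.test_measurable PP.P.Lvar_imp_integrable PP.test_Lvar\<close>)
    moreover have "(\<integral>x. \<phi> k x *\<^sub>R gradient \<psi> x \<partial>M) = - (\<integral>x. \<psi> x *\<^sub>R gradient (\<phi> k) x \<partial>M)" for k
      by (rule test_funs_by_parts[OF PP.S_open PP.S_bounded \<psi> \<phi>(1)])
    ultimately have "(\<lambda>k. - (\<integral>x. \<psi> x *\<^sub>R gradient (\<phi> k) x \<partial>M)) \<longlonglongrightarrow> (\<integral>x. u x *\<^sub>R gradient \<psi> x \<partial>M)"
      by simp
    then show ?thesis using tendsto_minus[OF lim] by (rule LIMSEQ_unique)
  qed
  moreover have "u absolutely_integrable_on K \<and> G absolutely_integrable_on K" if "compact K" "K \<subseteq> S" for K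
    by (intro conjI integrable_imp_absolutely_integrable_on_compact[OF _ that] i)
  ultimately show ?thesis unfolding has_weak_gradient_def by blast
qed

lemma weak_grad_eq:
  assumes "has_weak_gradient S u G"
  shows "has_weak_gradient S u (weak_grad S u)" "AE x in M. weak_grad S u x = G x"
    "weak_grad S u \<in> borel_measurable M"
proof -
  show w: "has_weak_gradient S u (weak_grad S u)" unfolding weak_grad_def by (rule someI[of "has_weak_gradient S u", OF assms])
  show "AE x in M. weak_grad S u x = G x" by (rule weak_gradient_unique[OF PP.S_open w assms])
  show "weak_grad S u \<in> borel_measurable M" by (rule has_weak_gradient_measurable[OF PP.S_open w])
qed

lemma Lp_norm_iff: "F \<in> borel_measurable M \<Longrightarrow> Lp (\<lambda>x. norm (F x)) \<longleftrightarrow> Lp F" for F :: "'a \<Rightarrow> 'b::euclidean_space"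
  by (auto simp: PP.P.Lvar_def)

lemma rhop_norm: "rhop (\<lambda>x. norm (F x)) = rhop F" for F :: "'a \<Rightarrow> 'b::euclidean_space"
  by (simp add: PP.P.rho_def)

lemma admissible_W01p:
  assumes "admissible u G" shows "u \<in> W01p_var S p"
proof -
  obtain \<phi> where L: "Lp u" "Lq u" "Lp G" and \<phi>: "\<And>k. \<phi> k \<in> T"
     "(\<lambda>k. rhop (\<lambda>x. gradient (\<phi> k) x - G x)) \<longlonglongrightarrow> 0" "(\<lambda>k. rhop (\<lambda>x. \<phi> k x - u x)) \<longlonglongrightarrow> 0"
    using assms unfolding admissible_def by blast
  note hG = admissible_has_weak_gradient[OF assms]
  note W = weak_grad_eq[OF hG]
  have LW: "Lp (weak_grad S u)"
    by (rule PP.P.LvarI[OF W(3) PP.P.Lvar_integrable[OF L(3)]]) (use W(2) in \<open>auto elim!: eventually_mono\<close>)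
  have LD: "Lp (\<lambda>x. gradient (\<phi> k) x - weak_grad S u x)" for k
    by (intro PP.P.Lvar_diff PP.test_Lvar \<phi> LW)
  have "rhop (\<lambda>x. gradient (\<phi> k) x - weak_grad S u x) = rhop (\<lambda>x. gradient (\<phi> k) x - G x)" for k
  proof (rule PP.P.rho_cong_AE)
    show "AE x in M. norm (gradient (\<phi> k) x - weak_grad S u x) = norm (gradient (\<phi> k) x - G x)"
      using W(2) by eventually_elim simp
  qed (use LD[of k] PP.P.Lvar_diff[OF PP.test_Lvar(2)[OF \<phi>(1)] L(3)] in \<open>auto simp: PP.P.Lvar_def\<close>)
  then have "(\<lambda>k. rhop (\<lambda>x. norm (gradient (\<phi> k) x - weak_grad S u x))) \<longlonglongrightarrow> 0"
    using \<phi>(2) by (simp add: rhop_norm)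
  moreover have "Lp (\<lambda>x. norm (gradient (\<phi> k) x - weak_grad S u x))" for k
    using LD[of k] Lp_norm_iff[of "\<lambda>x. gradient (\<phi> k) x - weak_grad S u x"] by (auto simp: PP.P.Lvar_def)
  ultimately have 1: "(\<lambda>k. luxemburg S p (\<lambda>x. norm (gradient (\<phi> k) x - weak_grad S u x))) \<longlonglongrightarrow> 0"
    by (subst PP.P.luxemburg_tendsto_0_iff) auto
  have 2: "(\<lambda>k. luxemburg S p (\<lambda>x. \<phi> k x - u x)) \<longlonglongrightarrow> 0"
    using \<phi>(3) PP.P.Lvar_diff[OF PP.test_Lvar(1)[OF \<phi>(1)] L(1)] by (subst PP.P.luxemburg_tendsto_0_iff) auto
  have "u \<in> W1p_var S p"
    unfolding W1p_var_def using L LW W(3) hG by (auto simp: PP.P.Lp_var_iff Lp_norm_iff)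
  then show ?thesis unfolding W01p_var_def using \<phi>(1) 1 2 by blast
qed

text \<open>Convergence in the q-modular has to be produced. Convergent gradients make the
  approximants Cauchy there by \<open>test_rho_small\<close>, and v, being their L^1 limit, is
  identified as the limit.\<close>

lemma W01p_admissible:
  assumes v: "v \<in> W01p_var S p" shows "admissible v (weak_grad S v)"
proof -
  let ?G = "weak_grad S v"
  obtain \<phi> where vp: "v \<in> Lp_var S p" and ex: "\<exists>G. has_weak_gradient S v G" and Gp: "(\<lambda>x. norm (?G x)) \<in> Lp_var S p"
    and \<phi>: "\<And>k. \<phi> k \<in> T"
     "(\<lambda>k. luxemburg S p (\<lambda>x. norm (gradient (\<phi> k) x - ?G x))) \<longlonglongrightarrow> 0"
     "(\<lambda>k. luxemburg S p (\<lambda>x. \<phi> k x - v x)) \<longlonglongrightarrow> 0"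
    using v unfolding W01p_var_def W1p_var_def by blast
  have Gm: "?G \<in> borel_measurable M" using ex weak_grad_eq by blast
  have Lv: "Lp v" using vp by (simp add: PP.P.Lp_var_iff)
  have LG: "Lp ?G" using Gp Gm by (simp add: PP.P.Lp_var_iff Lp_norm_iff)
  have LD: "Lp (\<lambda>x. gradient (\<phi> k) x - ?G x)" for k by (intro PP.P.Lvar_diff PP.test_Lvar \<phi> LG)
  have "Lp (\<lambda>x. norm (gradient (\<phi> k) x - ?G x))" for k
    using LD[of k] Lp_norm_iff[of "\<lambda>x. gradient (\<phi> k) x - ?G x"] by (auto simp: PP.P.Lvar_def)
  then have 1: "(\<lambda>k. rhop (\<lambda>x. gradient (\<phi> k) x - ?G x)) \<longlonglongrightarrow> 0"
    using \<phi>(2) by (subst (asm) PP.P.luxemburg_tendsto_0_iff) (auto simp: rhop_norm)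
  have Ld: "Lp (\<lambda>x. \<phi> k x - v x)" for k by (intro PP.P.Lvar_diff PP.test_Lvar \<phi> Lv)
  have 2: "(\<lambda>k. rhop (\<lambda>x. \<phi> k x - v x)) \<longlonglongrightarrow> 0"
    using \<phi>(3) by (subst (asm) PP.P.luxemburg_tendsto_0_iff) (auto intro: Ld)
  have C: "\<exists>N. \<forall>m\<ge>N. \<forall>n\<ge>N. rhoq (\<lambda>x. \<phi> m x - \<phi> n x) < \<epsilon>" if \<epsilon>: "0 < \<epsilon>" for \<epsilon>
  proof -
    obtain \<delta> where \<delta>: "0 < \<delta>" "\<And>\<phi>. \<phi> \<in> T \<Longrightarrow> rhop (gradient \<phi>) \<le> \<delta> \<Longrightarrow> rhoq \<phi> \<le> \<epsilon> / 2"
      using PQ.test_rho_small[OF half_gt_zero[OF \<epsilon>]] by blast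
    have d: "0 < \<delta> / (2 powr hi * 2)" using \<delta> by simp
    from order_tendstoD(2)[OF 1 d] obtain N where N: "\<And>n. n \<ge> N \<Longrightarrow> rhop (\<lambda>x. gradient (\<phi> n) x - ?G x) < \<delta> / (2 powr hi * 2)"
      by (auto simp: eventually_sequentially)
    have "rhoq (\<lambda>x. \<phi> m x - \<phi> n x) < \<epsilon>" if mn: "m \<ge> N" "n \<ge> N" for m n
    proof -
      have "gradient (\<lambda>x. \<phi> m x - \<phi> n x) = (\<lambda>x. (gradient (\<phi> m) x - ?G x) - (gradient (\<phi> n) x - ?G x))"
        using PP.test_diff(2)[OF \<phi>(1) \<phi>(1), of m n] by simp
      then have "rhop (gradient (\<lambda>x. \<phi> m x - \<phi> n x)) \<le> 2 powr hi * (rhop (\<lambda>x. gradient (\<phi> m) x - ?G x) + rhop (\<lambda>x. gradient (\<phi> n) x - ?G x))"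
        using PP.P.rho_diff_le[OF LD LD, of m n] by simp
      also have "\<dots> \<le> 2 powr hi * (\<delta> / (2 powr hi * 2) + \<delta> / (2 powr hi * 2))"
        using N[OF mn(1)] N[OF mn(2)] by (intro mult_left_mono add_mono) auto
      also have "\<dots> = \<delta>" by simp
      finally show ?thesis using \<delta>(2)[OF PP.test_diff(1)[OF \<phi>(1) \<phi>(1)]] \<epsilon> by force
    qed
    then show ?thesis by blast
  qed
  have iv: "integrable M v" by (rule PP.P.Lvar_imp_integrable[OF Lv])
  have lim: "(\<lambda>k. \<integral>x. norm (\<phi> k x - v x) \<partial>M) \<longlonglongrightarrow> 0" by (rule PP.P.rho_tendsto_0_imp_L1[OF Ld 2])
  note Q = PQ.R.Lvar_Cauchy_limit[OF PQ.test_Lvar(3)[OF \<phi>(1)] C iv lim]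
  show ?thesis
    unfolding admissible_def using Lv LG Q 1 2 \<phi>(1) by blast
qed

end

lemma (in variable_exponent) rho_tendsto_add_scaleR:
  fixes F F' :: "nat \<Rightarrow> 'a \<Rightarrow> 'b::euclidean_space"
  assumes L: "\<And>k. Lvar (F k)" "\<And>k. Lvar (F' k)" "Lvar G" "Lvar G'"
    and lim: "(\<lambda>k. rho (\<lambda>x. F k x - G x)) \<longlonglongrightarrow> 0" "(\<lambda>k. rho (\<lambda>x. F' k x - G' x)) \<longlonglongrightarrow> 0"
  shows "(\<lambda>k. rho (\<lambda>x. (F k x + t *\<^sub>R F' k x) - (G x + t *\<^sub>R G' x))) \<longlonglongrightarrow> 0"
proof -
  define C where "C = max 1 \<bar>t\<bar> powr hi"
  have "(\<lambda>k. 2 powr hi * (rho (\<lambda>x. F k x - G x) + C * rho (\<lambda>x. F' k x - G' x))) \<longlonglongrightarrow> 2 powr hi * (0 + C * 0)"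
    by (intro tendsto_intros lim)
  then have *: "(\<lambda>k. 2 powr hi * (rho (\<lambda>x. F k x - G x) + C * rho (\<lambda>x. F' k x - G' x))) \<longlonglongrightarrow> 0" by simp
  show ?thesis
  proof (rule tendsto_sandwich[OF _ _ tendsto_const *]; intro always_eventually allI)
    fix k
    have "rho (\<lambda>x. (F k x + t *\<^sub>R F' k x) - (G x + t *\<^sub>R G' x)) = rho (\<lambda>x. (F k x - G x) + t *\<^sub>R (F' k x - G' x))"
      by (simp add: algebra_simps)
    also have "\<dots> \<le> 2 powr hi * (rho (\<lambda>x. F k x - G x) + rho (\<lambda>x. t *\<^sub>R (F' k x - G' x)))"
      by (intro rho_add_le Lvar_diff Lvar_scaleR L)
    also have "\<dots> \<le> 2 powr hi * (rho (\<lambda>x. F k x - G x) + C * rho (\<lambda>x. F' k x - G' x))"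
      unfolding C_def by (intro mult_left_mono add_left_mono rho_scaleR_le Lvar_diff L) auto
    finally show "rho (\<lambda>x. (F k x + t *\<^sub>R F' k x) - (G x + t *\<^sub>R G' x)) \<le> 2 powr hi * (rho (\<lambda>x. F k x - G x) + C * rho (\<lambda>x. F' k x - G' x))" .
  qed (rule rho_nonneg)
qed

context eigenvalue_problem
begin

lemma admissible_add_scaleR:
  assumes "admissible u G" "admissible v H"
  shows "admissible (\<lambda>x. u x + t *\<^sub>R v x) (\<lambda>x. G x + t *\<^sub>R H x)"
proof -
  obtain \<phi> where L: "Lp u" "Lq u" "Lp G" and \<phi>: "\<And>k. \<phi> k \<in> T"
     "(\<lambda>k. rhop (\<lambda>x. gradient (\<phi> k) x - G x)) \<longlonglongrightarrow> 0" "(\<lambda>k. rhop (\<lambda>x. \<phi> k x - u x)) \<longlonglongrightarrow> 0"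
     "(\<lambda>k. rhoq (\<lambda>x. \<phi> k x - u x)) \<longlonglongrightarrow> 0"
    using assms(1) unfolding admissible_def by blast
  obtain \<psi> where L': "Lp v" "Lq v" "Lp H" and \<psi>: "\<And>k. \<psi> k \<in> T"
     "(\<lambda>k. rhop (\<lambda>x. gradient (\<psi> k) x - H x)) \<longlonglongrightarrow> 0" "(\<lambda>k. rhop (\<lambda>x. \<psi> k x - v x)) \<longlonglongrightarrow> 0"
     "(\<lambda>k. rhoq (\<lambda>x. \<psi> k x - v x)) \<longlonglongrightarrow> 0"
    using assms(2) unfolding admissible_def by blast
  define \<theta> where "\<theta> k x = \<phi> k x + t * \<psi> k x" for k x
  have \<theta>: "\<theta> k \<in> T" "gradient (\<theta> k) = (\<lambda>x. gradient (\<phi> k) x + t *\<^sub>R gradient (\<psi> k) x)" for k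
    using test_funs_add[OF \<phi>(1) test_funs_cmult[OF \<psi>(1)]] gradient_add[OF \<phi>(1) test_funs_cmult[OF \<psi>(1)]] gradient_cmult[OF \<psi>(1)]
    by (auto simp: \<theta>_def[abs_def])
  have "(\<lambda>k. rhop (\<lambda>x. gradient (\<theta> k) x - (G x + t *\<^sub>R H x))) \<longlonglongrightarrow> 0"
    unfolding \<theta>(2) by (intro PP.P.rho_tendsto_add_scaleR PP.test_Lvar L L' \<phi> \<psi>)
  moreover have "(\<lambda>k. rhop (\<lambda>x. \<theta> k x - (u x + t *\<^sub>R v x))) \<longlonglongrightarrow> 0"
    unfolding \<theta>_def real_scaleR_def[symmetric] by (intro PP.P.rho_tendsto_add_scaleR PP.test_Lvar L L' \<phi> \<psi>)
  moreover have "(\<lambda>k. rhoq (\<lambda>x. \<theta> k x - (u x + t *\<^sub>R v x))) \<longlonglongrightarrow> 0"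
    unfolding \<theta>_def real_scaleR_def[symmetric] by (intro PQ.R.rho_tendsto_add_scaleR PQ.test_Lvar L L' \<phi> \<psi>)
  moreover have "Lp (\<lambda>x. u x + t *\<^sub>R v x)" "Lq (\<lambda>x. u x + t *\<^sub>R v x)" "Lp (\<lambda>x. G x + t *\<^sub>R H x)"
    by (intro PP.P.Lvar_add PP.P.Lvar_scaleR PQ.R.Lvar_add PQ.R.Lvar_scaleR L L')+
  ultimately show ?thesis
    unfolding admissible_def using \<theta>(1) by blast
qed

text \<open>The constraint bounds the gradient modular by \<open>hi\<close>, and the embedding does
  the rest. The constant found here determines the range of \<open>lam\<close> in
  \<open>eigenvalue_exists\<close>.\<close>

lemma energy_bound:
  obtains C where "0 \<le> C" "\<And>\<phi>. \<phi> \<in> T \<Longrightarrow> Phi (gradient \<phi>) \<le> 1 \<Longrightarrow> Psi \<phi> \<le> C"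
proof -
  have hi: "0 \<le> hi" using PP.P.lo_gt_1 PP.P.lo_le_hi by simp
  obtain C where C: "0 \<le> C" "\<And>\<phi>. \<phi> \<in> T \<Longrightarrow> rhop (gradient \<phi>) \<le> hi \<Longrightarrow> rhoq \<phi> \<le> C"
    using PQ.test_embedding[OF hi] by blast
  show ?thesis
  proof (rule that[OF C(1)])
    fix \<phi> assume \<phi>: "\<phi> \<in> T" "Phi (gradient \<phi>) \<le> 1"
    have "rhop (gradient \<phi>) \<le> hi * Phi (gradient \<phi>)" by (intro PP.P.rho_le_energy PP.test_Lvar \<phi>)
    also have "\<dots> \<le> hi" using \<phi>(2) hi by (simp add: mult_left_le)
    finally show "Psi \<phi> \<le> C"
      using C(2)[OF \<phi>(1)] PQ.R.energy_le_rho[OF PQ.test_Lvar(3)[OF \<phi>(1)]] by simp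
  qed
qed

text \<open>Minimality is known among test functions. The strict inequality for G makes the
  approximating test functions satisfy the constraint eventually, so the bound survives in the
  limit.\<close>

lemma admissible_energy_ge:
  assumes "admissible u G" and lt: "Phi G < 1"
    and m: "\<And>\<phi>. \<phi> \<in> T \<Longrightarrow> Phi (gradient \<phi>) \<le> 1 \<Longrightarrow> m \<le> Phi (gradient \<phi>) - lam * Psi \<phi>"
  shows "m \<le> Phi G - lam * Psi u"
proof -
  obtain \<phi> where L: "Lp u" "Lq u" "Lp G" and \<phi>: "\<And>k. \<phi> k \<in> T"
     "(\<lambda>k. rhop (\<lambda>x. gradient (\<phi> k) x - G x)) \<longlonglongrightarrow> 0" "(\<lambda>k. rhoq (\<lambda>x. \<phi> k x - u x)) \<longlonglongrightarrow> 0"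
    using assms(1) unfolding admissible_def by blast
  have 1: "(\<lambda>k. Phi (gradient (\<phi> k))) \<longlonglongrightarrow> Phi G" by (intro PP.P.energy_tendsto PP.test_Lvar L \<phi>)
  have 2: "(\<lambda>k. Psi (\<phi> k)) \<longlonglongrightarrow> Psi u" by (intro PQ.R.energy_tendsto PQ.test_Lvar L \<phi>)
  have "(\<lambda>k. Phi (gradient (\<phi> k)) - lam * Psi (\<phi> k)) \<longlonglongrightarrow> Phi G - lam * Psi u"
    by (intro tendsto_intros 1 2)
  moreover have "\<forall>\<^sub>F k in sequentially. m \<le> Phi (gradient (\<phi> k)) - lam * Psi (\<phi> k)"
    using order_tendstoD(2)[OF 1 lt] by eventually_elim (intro m \<phi>, simp)
  ultimately show ?thesis by (rule tendsto_lowerbound) simp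
qed

text \<open>The minimizing sequence converges strongly: its midpoints are competitors as well, so the
  convexity defect of the gradient energy is controlled by the convergence of \<open>Psi\<close>.\<close>

lemma minimizer_exists:
  assumes lam: "0 < lam"
  obtains u G m where "admissible u G" "Phi G \<le> 1" "m = Phi G - lam * Psi u"
    "\<And>\<phi>. \<phi> \<in> T \<Longrightarrow> Phi (gradient \<phi>) \<le> 1 \<Longrightarrow> m \<le> Phi (gradient \<phi>) - lam * Psi \<phi>"
    "\<And>C. (\<And>\<phi>. \<phi> \<in> T \<Longrightarrow> Phi (gradient \<phi>) \<le> 1 \<Longrightarrow> Psi \<phi> \<le> C) \<Longrightarrow> Psi u \<le> C"
proof -
  define J where "J \<phi> = Phi (gradient \<phi>) - lam * Psi \<phi>" for \<phi>
  define A where "A = {\<phi> \<in> T. Phi (gradient \<phi>) \<le> 1}"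
  obtain C where C: "0 \<le> C" "\<And>\<phi>. \<phi> \<in> T \<Longrightarrow> Phi (gradient \<phi>) \<le> 1 \<Longrightarrow> Psi \<phi> \<le> C"
    using energy_bound by blast
  have "A \<noteq> {}"
  proof -
    have z: "(\<lambda>_. 0) \<in> T" by (simp add: test_funs_def smooth_fun_const)
    have g: "gradient (\<lambda>_. 0 :: real) = (\<lambda>_. 0 :: 'a)" by (intro ext gradient_eqI) simp
    have "Phi (\<lambda>_. 0 :: 'a) = 0" by (simp add: PP.P.energy_def)
    then have "(\<lambda>_. 0) \<in> A" using z by (simp add: A_def g)
    then show ?thesis by blast
  qed
  have bdd: "bdd_below (J ` A)"
  proof (rule bdd_belowI2)
    fix \<phi> assume "\<phi> \<in> A"
    then have "lam * Psi \<phi> \<le> lam * C" using lam C by (intro mult_left_mono) (auto simp: A_def)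
    then show "- (lam * C) \<le> J \<phi>" using PP.P.energy_nonneg[of "gradient \<phi>"] by (simp add: J_def)
  qed
  define m where "m = (INF \<phi>\<in>A. J \<phi>)"
  have m: "m \<le> J \<phi>" if "\<phi> \<in> A" for \<phi> unfolding m_def using bdd that by (rule cINF_lower)
  have "\<exists>\<phi>\<in>A. J \<phi> < m + inverse (real (Suc n))" for n
    using cINF_less_iff[OF \<open>A \<noteq> {}\<close> bdd, of "m + inverse (real (Suc n))"] by (simp add: m_def)
  then obtain \<phi>0 where \<phi>0: "\<And>n. \<phi>0 n \<in> A" "\<And>n. J (\<phi>0 n) < m + inverse (real (Suc n))" by metis
  have hi: "0 \<le> hi" using PP.P.lo_gt_1 PP.P.lo_le_hi by simp
  have rho_hi: "rhop (gradient \<phi>) \<le> hi" if "\<phi> \<in> A" for \<phi>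
  proof -
    have "rhop (gradient \<phi>) \<le> hi * Phi (gradient \<phi>)" using that by (intro PP.P.rho_le_energy PP.test_Lvar) (simp add: A_def)
    also have "\<dots> \<le> hi" using that hi by (simp add: mult_left_le A_def)
    finally show ?thesis .
  qed
  obtain s where s: "strict_mono (s :: nat \<Rightarrow> nat)"
    "\<And>\<epsilon>. 0 < \<epsilon> \<Longrightarrow> \<exists>N. \<forall>m\<ge>N. \<forall>n\<ge>N. (\<integral>x. norm (\<phi>0 (s m) x - \<phi>0 (s n) x) \<partial>M) < \<epsilon>"
    using PP.test_rellich[of \<phi>0 hi] \<phi>0(1) rho_hi by (auto simp: A_def)
  define \<phi> where "\<phi> n = \<phi>0 (s n)" for n
  have \<phi>A: "\<phi> n \<in> A" for n by (simp add: \<phi>_def \<phi>0)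
  then have \<phi>T: "\<phi> n \<in> T" for n by (simp add: A_def)
  \<comment> \<open>The rate survives the passage to a subsequence because s n \<ge> n.\<close>
  have \<phi>J: "J (\<phi> n) < m + inverse (real (Suc n))" for n
  proof -
    have "inverse (real (Suc (s n))) \<le> inverse (real (Suc n))"
      using seq_suble[OF s(1), of n] by (intro le_imp_inverse_le) auto
    then show ?thesis using \<phi>0(2)[of "s n"] unfolding \<phi>_def by linarith
  qed
  note \<phi>C = s(2)[folded \<phi>_def]
  note Cp = PP.test_L1_Cauchy_imp_rho_Cauchy[OF \<phi>T rho_hi[OF \<phi>A] \<phi>C]
  note Cq = PQ.test_L1_Cauchy_imp_rho_Cauchy[OF \<phi>T rho_hi[OF \<phi>A] \<phi>C]
  obtain u where u: "integrable M u" "(\<lambda>n. \<integral>x. norm (\<phi> n x - u x) \<partial>M) \<longlonglongrightarrow> 0"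
    using PP.P.L1_limit[OF PP.P.Lvar_imp_integrable[OF PP.test_Lvar(1)[OF \<phi>T]] \<phi>C] by blast
  note up = PP.P.Lvar_Cauchy_limit[OF PP.test_Lvar(1)[OF \<phi>T] Cp u]
  note uq = PQ.R.Lvar_Cauchy_limit[OF PQ.test_Lvar(3)[OF \<phi>T] Cq u]
  have Psi_lim: "(\<lambda>n. Psi (\<phi> n)) \<longlonglongrightarrow> Psi u" by (intro PQ.R.energy_tendsto PQ.test_Lvar \<phi>T uq)
  define mid where "mid i j x = (1/2) * (\<phi> i x + \<phi> j x)" for i j x
  have mid: "mid i j \<in> T" for i j
    unfolding mid_def[abs_def] by (rule test_funs_cmult[OF test_funs_add[OF \<phi>T \<phi>T]])
  have gradient_mid: "gradient (mid i j) = (\<lambda>x. (1/2) *\<^sub>R (gradient (\<phi> i) x + gradient (\<phi> j) x))" for i j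
    unfolding mid_def[abs_def] gradient_cmult[OF test_funs_add[OF \<phi>T \<phi>T]] gradient_add[OF \<phi>T \<phi>T] ..
  have midA: "mid i j \<in> A" for i j
  proof -
    have "Phi (gradient (mid i j)) \<le> (Phi (gradient (\<phi> i)) + Phi (gradient (\<phi> j))) / 2"
      unfolding gradient_mid by (intro PP.P.energy_midpoint_le PP.test_Lvar \<phi>T)
    then show ?thesis using \<phi>A[of i] \<phi>A[of j] mid by (simp add: A_def)
  qed
  have gradC: "\<exists>N. \<forall>i\<ge>N. \<forall>j\<ge>N. rhop (\<lambda>x. gradient (\<phi> i) x - gradient (\<phi> j) x) < \<epsilon>" if \<epsilon>: "0 < \<epsilon>" for \<epsilon>
  proof -
    \<comment> \<open>The tolerances are chosen backwards: \<epsilon>1 pays for the gradient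
      modulars, which are at most \<open>hi\<close>, and determines the convexity constant
      \<open>B\<close>; \<epsilon>2 is the defect of \<open>Phi\<close> that \<open>B\<close>
      permits; \<epsilon>3 is the variation of \<open>Psi\<close> that keeps within it.\<close>
    define \<epsilon>1 where "\<epsilon>1 = \<epsilon> / (4 * (hi + 1))"
    have \<epsilon>1: "0 < \<epsilon>1" using \<epsilon> hi by (simp add: \<epsilon>1_def)
    have \<epsilon>1h: "\<epsilon>1 * (hi + hi) \<le> \<epsilon> / 2" using \<epsilon> hi by (simp add: \<epsilon>1_def field_simps)
    obtain B where B: "0 \<le> B" "\<And>F G :: 'a \<Rightarrow> 'a. Lp F \<Longrightarrow> Lp G \<Longrightarrow> rhop (\<lambda>x. F x - G x) \<le>
       \<epsilon>1 * (rhop F + rhop G) + B * ((Phi F + Phi G) / 2 - Phi (\<lambda>x. (1/2) *\<^sub>R (F x + G x)))"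
      using PP.P.energy_uniformly_convex[OF \<epsilon>1] by blast
    define \<epsilon>2 where "\<epsilon>2 = \<epsilon> / (2 * (B + 1))"
    have \<epsilon>2: "0 < \<epsilon>2" "B * \<epsilon>2 < \<epsilon> / 2" using \<epsilon> B by (auto simp: \<epsilon>2_def field_simps)
    define \<epsilon>3 where "\<epsilon>3 = \<epsilon>2 / (4 * (lam + 1))"
    have \<epsilon>3: "0 < \<epsilon>3" "lam * (2 * \<epsilon>3) \<le> \<epsilon>2 / 2" using \<epsilon>2 lam by (auto simp: \<epsilon>3_def field_simps)
    obtain \<delta> where \<delta>: "0 < \<delta>" "\<And>F. Lq F \<Longrightarrow> rhoq (\<lambda>x. F x - u x) < \<delta> \<Longrightarrow> \<bar>Psi F - Psi u\<bar> < \<epsilon>3"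
      using PQ.R.energy_continuous[OF uq(1) \<epsilon>3(1)] by blast
    have d: "0 < \<delta> / (2 powr hi' * 2)" using \<delta> by simp
    have "\<forall>\<^sub>F n in sequentially. rhoq (\<lambda>x. \<phi> n x - u x) < \<delta> / (2 powr hi' * 2)"
      by (rule order_tendstoD(2)[OF uq(2) d])
    moreover have "\<forall>\<^sub>F n in sequentially. dist (Psi (\<phi> n)) (Psi u) < \<epsilon>3" by (rule tendstoD[OF Psi_lim \<epsilon>3(1)])
    moreover have "\<forall>\<^sub>F n in sequentially. inverse (real (Suc n)) < \<epsilon>2 / 2"
      using \<epsilon>2 by (intro order_tendstoD(2)[OF LIMSEQ_inverse_real_of_nat]) auto
    ultimately have "\<forall>\<^sub>F n in sequentially. rhoq (\<lambda>x. \<phi> n x - u x) < \<delta> / (2 powr hi' * 2) \<and>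
        dist (Psi (\<phi> n)) (Psi u) < \<epsilon>3 \<and> inverse (real (Suc n)) < \<epsilon>2 / 2"
      by eventually_elim blast
    then obtain N where N: "\<And>n. n \<ge> N \<Longrightarrow> rhoq (\<lambda>x. \<phi> n x - u x) < \<delta> / (2 powr hi' * 2)"
        "\<And>n. n \<ge> N \<Longrightarrow> dist (Psi (\<phi> n)) (Psi u) < \<epsilon>3" "\<And>n. n \<ge> N \<Longrightarrow> inverse (real (Suc n)) < \<epsilon>2 / 2"
      unfolding eventually_sequentially by blast
    have "rhop (\<lambda>x. gradient (\<phi> i) x - gradient (\<phi> j) x) < \<epsilon>" if ij: "i \<ge> N" "j \<ge> N" for i j
    proof -
      have Lqd: "Lq (\<lambda>x. \<phi> n x - u x)" for n by (intro PQ.R.Lvar_diff PQ.test_Lvar \<phi>T uq)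
      have "(\<lambda>x. mid i j x - u x) = (\<lambda>x. (1/2) *\<^sub>R ((\<phi> i x - u x) + (\<phi> j x - u x)))"
        by (auto simp: mid_def field_simps)
      then have "rhoq (\<lambda>x. mid i j x - u x) \<le> 1 powr hi' * rhoq (\<lambda>x. (\<phi> i x - u x) + (\<phi> j x - u x))"
        using PQ.R.rho_scaleR_le[OF PQ.R.Lvar_add[OF Lqd[of i] Lqd[of j]], of "1/2" 1] by simp
      also have "\<dots> \<le> 2 powr hi' * (rhoq (\<lambda>x. \<phi> i x - u x) + rhoq (\<lambda>x. \<phi> j x - u x))"
        using PQ.R.rho_add_le[OF Lqd[of i] Lqd[of j]] by simp
      also have "\<dots> < 2 powr hi' * (\<delta> / (2 powr hi' * 2) + \<delta> / (2 powr hi' * 2))"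
        using N(1)[OF ij(1)] N(1)[OF ij(2)] by (intro mult_strict_left_mono add_strict_mono) auto
      also have "\<dots> = \<delta>" by simp
      finally have "\<bar>Psi (mid i j) - Psi u\<bar> < \<epsilon>3" by (intro \<delta>(2) PQ.test_Lvar mid)
      moreover have "\<bar>Psi (\<phi> i) - Psi u\<bar> < \<epsilon>3" "\<bar>Psi (\<phi> j) - Psi u\<bar> < \<epsilon>3"
        using N(2)[OF ij(1)] N(2)[OF ij(2)] by (simp_all add: dist_real_def)
      moreover have "(a + b) / 2 - c \<le> 2 * e" if "\<bar>c - d\<bar> < e" "\<bar>a - d\<bar> < e" "\<bar>b - d\<bar> < e" for a b c d e :: real
        using that by (simp add: abs_less_iff field_simps)
      ultimately have "(Psi (\<phi> i) + Psi (\<phi> j)) / 2 - Psi (mid i j) \<le> 2 * \<epsilon>3" by blast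
      then have "lam * ((Psi (\<phi> i) + Psi (\<phi> j)) / 2 - Psi (mid i j)) \<le> lam * (2 * \<epsilon>3)"
        using lam by (intro mult_left_mono) auto
      then have P: "lam * ((Psi (\<phi> i) + Psi (\<phi> j)) / 2 - Psi (mid i j)) \<le> \<epsilon>2 / 2" using \<epsilon>3(2) by linarith
      let ?D = "(Phi (gradient (\<phi> i)) + Phi (gradient (\<phi> j))) / 2 - Phi (gradient (mid i j))"
      \<comment> \<open>J is at least m at the midpoint and nearly m along the sequence. Hence the
        defect of \<open>Phi\<close> is at most the distance to the infimum plus \<open>lam\<close>
        times the defect of \<open>Psi\<close>, which strong convergence makes small.\<close>
      have "?D = (J (\<phi> i) + J (\<phi> j)) / 2 - J (mid i j) + lam * ((Psi (\<phi> i) + Psi (\<phi> j)) / 2 - Psi (mid i j))"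
        by (simp add: J_def field_simps)
      also have "\<dots> \<le> \<epsilon>2"
      proof -
        have "(a + b) / 2 - c + d \<le> e" if "a < m + x" "b < m + y" "x < e / 2" "y < e / 2" "m \<le> c" "d \<le> e / 2" for a b c d e x y :: real
          using that by (simp add: field_simps)
        from this[OF \<phi>J[of i] \<phi>J[of j] N(3)[OF ij(1)] N(3)[OF ij(2)] m[OF midA[of i j]] P] show ?thesis .
      qed
      finally have "B * ?D \<le> B * \<epsilon>2" using B(1) by (rule mult_left_mono)
      moreover have "\<epsilon>1 * (rhop (gradient (\<phi> i)) + rhop (gradient (\<phi> j))) \<le> \<epsilon>1 * (hi + hi)"
        using \<epsilon>1 by (intro mult_left_mono add_mono rho_hi \<phi>A) auto
      ultimately show ?thesis
        using B(2)[OF PP.test_Lvar(2)[OF \<phi>T[of i]] PP.test_Lvar(2)[OF \<phi>T[of j]]] \<epsilon>1h \<epsilon>2(2) unfolding gradient_mid by linarith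
    qed
    then show ?thesis by blast
  qed
  \<comment> \<open>The Cauchy property in L^1 provides a function G, and
    \<open>Lvar_Cauchy_limit\<close> then upgrades the convergence to the modular.\<close>
  have gradC1: "\<exists>N. \<forall>i\<ge>N. \<forall>j\<ge>N. (\<integral>x. norm (gradient (\<phi> i) x - gradient (\<phi> j) x) \<partial>M) < \<epsilon>" if \<epsilon>: "0 < \<epsilon>" for \<epsilon>
  proof -
    obtain \<delta> where \<delta>: "0 < \<delta>" "\<And>F :: 'a \<Rightarrow> 'a. Lp F \<Longrightarrow> rhop F \<le> \<delta> \<Longrightarrow> (\<integral>x. norm (F x) \<partial>M) < \<epsilon>"
      using PP.P.rho_small_imp_L1_small[OF \<epsilon>] by blast
    obtain N where "\<And>i j. i \<ge> N \<Longrightarrow> j \<ge> N \<Longrightarrow> rhop (\<lambda>x. gradient (\<phi> i) x - gradient (\<phi> j) x) < \<delta>"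
      using gradC[OF \<delta>(1)] by blast
    then have "(\<integral>x. norm (gradient (\<phi> i) x - gradient (\<phi> j) x) \<partial>M) < \<epsilon>" if "i \<ge> N" "j \<ge> N" for i j
      using that by (intro \<delta>(2) PP.P.Lvar_diff PP.test_Lvar \<phi>T less_imp_le)
    then show ?thesis by blast
  qed
  obtain G where G: "integrable M G" "(\<lambda>n. \<integral>x. norm (gradient (\<phi> n) x - G x) \<partial>M) \<longlonglongrightarrow> 0"
    using PP.P.L1_limit[OF PP.P.Lvar_imp_integrable[OF PP.test_Lvar(2)[OF \<phi>T]] gradC1] by blast
  note Gp = PP.P.Lvar_Cauchy_limit[OF PP.test_Lvar(2)[OF \<phi>T] gradC G]
  have Phi_lim: "(\<lambda>n. Phi (gradient (\<phi> n))) \<longlonglongrightarrow> Phi G" by (intro PP.P.energy_tendsto PP.test_Lvar \<phi>T Gp)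
  show ?thesis
  proof (rule that[of u G m])
    show "admissible u G"
      unfolding admissible_def using up uq Gp \<phi>T by blast
    show "Phi G \<le> 1"
      by (rule LIMSEQ_le_const2[OF Phi_lim]) (use \<phi>A in \<open>auto simp: A_def\<close>)
    show "m = Phi G - lam * Psi u"
    proof (rule LIMSEQ_unique)
      show "(\<lambda>n. J (\<phi> n)) \<longlonglongrightarrow> Phi G - lam * Psi u"
        unfolding J_def by (intro tendsto_intros Phi_lim Psi_lim)
      have *: "(\<lambda>n. m + inverse (real (Suc n))) \<longlonglongrightarrow> m"
        using tendsto_add[OF tendsto_const[of m] LIMSEQ_inverse_real_of_nat] by simp
      show "(\<lambda>n. J (\<phi> n)) \<longlonglongrightarrow> m"
        by (rule tendsto_sandwich[OF _ _ tendsto_const *]) (intro always_eventually allI m \<phi>A less_imp_le \<phi>J)+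
    qed
    show "m \<le> Phi (gradient \<phi>) - lam * Psi \<phi>" if "\<phi> \<in> T" "Phi (gradient \<phi>) \<le> 1" for \<phi>
      using m[of \<phi>] that by (simp add: A_def J_def)
    show "Psi u \<le> C" if "\<And>\<phi>. \<phi> \<in> T \<Longrightarrow> Phi (gradient \<phi>) \<le> 1 \<Longrightarrow> Psi \<phi> \<le> C" for C
      by (rule LIMSEQ_le_const2[OF Psi_lim]) (use \<phi>A that in \<open>auto simp: A_def\<close>)
  qed
qed

text \<open>First variation along steps c/(n+1) with c = 1 and c = -1: minimality makes c times the
  derivative nonnegative for both signs. For small steps the perturbed pair still satisfies the
  constraint strictly, so \<open>admissible_energy_ge\<close> applies to it.\<close>

lemma euler_lagrange:
  assumes adm: "admissible u G" "admissible v H" and lt: "Phi G < 1"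
    and m: "m = Phi G - lam * Psi u"
    "\<And>\<phi>. \<phi> \<in> T \<Longrightarrow> Phi (gradient \<phi>) \<le> 1 \<Longrightarrow> m \<le> Phi (gradient \<phi>) - lam * Psi \<phi>"
  shows "integrable M (\<lambda>x. norm (G x) powr (p x - 2) * (G x \<bullet> H x))"
    and "integrable M (\<lambda>x. norm (u x) powr (q x - 2) * (u x \<bullet> v x))"
    and "(\<integral>x. norm (G x) powr (p x - 2) * (G x \<bullet> H x) \<partial>M)
       - lam * (\<integral>x. norm (u x) powr (q x - 2) * (u x \<bullet> v x) \<partial>M) = 0"
proof -
  have L: "Lp G" "Lp H" "Lq u" "Lq v" using adm by (auto simp: admissible_def)
  let ?D = "(\<integral>x. norm (G x) powr (p x - 2) * (G x \<bullet> H x) \<partial>M)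
       - lam * (\<integral>x. norm (u x) powr (q x - 2) * (u x \<bullet> v x) \<partial>M)"
  define h where "h c n = c * inverse (real (Suc n))" for c :: real and n
  have h: "h c \<longlonglongrightarrow> 0" "\<And>n. h c n \<noteq> 0" "\<And>n. \<bar>h c n\<bar> \<le> 1" if "\<bar>c\<bar> = 1" for c
  proof -
    show "h c \<longlonglongrightarrow> 0"
      unfolding h_def using tendsto_mult[OF tendsto_const[of c] LIMSEQ_inverse_real_of_nat] by simp
    show "h c n \<noteq> 0" for n using that by (auto simp: h_def)
    show "\<bar>h c n\<bar> \<le> 1" for n using that by (simp add: h_def abs_mult inverse_le_1_iff)
  qed
  have one: "\<bar>1::real\<bar> = 1" by simp
  show "integrable M (\<lambda>x. norm (G x) powr (p x - 2) * (G x \<bullet> H x))"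
    by (rule PP.P.energy_quotient_tendsto(1)[OF L(1,2) h[OF one]])
  show "integrable M (\<lambda>x. norm (u x) powr (q x - 2) * (u x \<bullet> v x))"
    by (rule PQ.R.energy_quotient_tendsto(1)[OF L(3,4) h[OF one]])
  have key: "0 \<le> c * ?D" if c: "\<bar>c\<bar> = 1" for c
  proof -
    define E where "E n = (Phi (\<lambda>x. G x + h c n *\<^sub>R H x) - Phi G) / h c n - lam * ((Psi (\<lambda>x. u x + h c n *\<^sub>R v x) - Psi u) / h c n)" for n
    have "E \<longlonglongrightarrow> ?D"
      unfolding E_def
      by (intro tendsto_diff tendsto_mult tendsto_const PP.P.energy_quotient_tendsto(2)[OF L(1,2) h[OF c]]
          PQ.R.energy_quotient_tendsto(2)[OF L(3,4) h[OF c]])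
    then have lim: "(\<lambda>n. c * E n) \<longlonglongrightarrow> c * ?D" by (intro tendsto_intros)
    have "(\<lambda>n. rhop (\<lambda>x. (G x + h c n *\<^sub>R H x) - G x)) \<longlonglongrightarrow> 0"
    proof -
      have "(\<lambda>n. \<bar>h c n\<bar> powr lo * rhop H) \<longlonglongrightarrow> 0 * rhop H"
        using h[OF c] PP.P.lo_gt_1
        by (intro tendsto_mult tendsto_const tendsto_zero_powrI[of _ _ _ lo] tendsto_rabs_zero) auto
      then have *: "(\<lambda>n. \<bar>h c n\<bar> powr lo * rhop H) \<longlonglongrightarrow> 0" by simp
      show ?thesis
        by (rule tendsto_sandwich[OF _ _ tendsto_const *]; intro always_eventually allI)
          (use PP.P.rho_scaleR_le_small[OF L(2) h(3)[OF c]] in \<open>auto simp: PP.P.rho_nonneg\<close>)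
    qed
    then have "(\<lambda>n. Phi (\<lambda>x. G x + h c n *\<^sub>R H x)) \<longlonglongrightarrow> Phi G"
      by (intro PP.P.energy_tendsto PP.P.Lvar_add PP.P.Lvar_scaleR L)
    then have "\<forall>\<^sub>F n in sequentially. Phi (\<lambda>x. G x + h c n *\<^sub>R H x) < 1" using lt by (rule order_tendstoD(2))
    then have "\<forall>\<^sub>F n in sequentially. 0 \<le> c * E n"
    proof eventually_elim
      case (elim n)
      have "m \<le> Phi (\<lambda>x. G x + h c n *\<^sub>R H x) - lam * Psi (\<lambda>x. u x + h c n *\<^sub>R v x)"
        by (rule admissible_energy_ge[OF admissible_add_scaleR[OF adm] elim m(2)])
      then have "0 \<le> (Phi (\<lambda>x. G x + h c n *\<^sub>R H x) - Phi G) - lam * (Psi (\<lambda>x. u x + h c n *\<^sub>R v x) - Psi u)"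
        unfolding m(1) by (simp add: algebra_simps)
      moreover have "c \<noteq> 0" using c by auto
      \<comment> \<open>The step contains the sign c, so multiplying the quotient by c leaves a
        positive factor.\<close>
      then have "c / h c n = real (Suc n)" by (simp add: h_def field_simps del: of_nat_Suc)
      moreover have "c * (a / k - lam * (b / k)) = c / k * (a - lam * b)" for a b k :: real
        by (simp add: divide_inverse algebra_simps)
      then have "c * E n = c / h c n * ((Phi (\<lambda>x. G x + h c n *\<^sub>R H x) - Phi G) - lam * (Psi (\<lambda>x. u x + h c n *\<^sub>R v x) - Psi u))"
        unfolding E_def .
      ultimately show ?case by simp
    qed
    then show ?thesis by (intro tendsto_lowerbound[OF lim]) auto
  qed
  show "?D = 0" using key[of 1] key[of "-1"] by simp
qed

text \<open>Scaling by t \<le> 1 brings the gradient energy below a constant times t^lo, while on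
  the support of the bump, where q < s < lo, \<open>Psi\<close> keeps at least the factor t^s. For
  small t the second term wins.\<close>

lemma negative_energy:
  assumes x0: "x0 \<in> closure S" "q x0 < lo" and lam: "0 < lam"
  obtains \<phi> where "\<phi> \<in> T" "Phi (gradient \<phi>) \<le> 1" "Phi (gradient \<phi>) - lam * Psi \<phi> < 0"
proof -
  \<comment> \<open>A number strictly between, so that q < s still holds near x0.\<close>
  define s where "s = (q x0 + lo) / 2"
  have s: "q x0 < s" "s < lo" "0 < s" using x0 PQ.r_ge_1[OF x0(1)] by (auto simp: s_def)
  obtain d where d: "0 < d" "\<And>x. x \<in> closure S \<Longrightarrow> dist x x0 < d \<Longrightarrow> dist (q x) (q x0) < s - q x0"
    using PQ.r_cont x0(1) s(1) unfolding continuous_on_iff by (metis diff_gt_0_iff_gt)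
  \<comment> \<open>x0 may lie on the boundary, so the box is placed around a nearby point of
    S.\<close>
  have "\<exists>y\<in>S. dist y x0 < d" using x0(1) d(1) by (simp add: closure_approachable)
  then obtain y where y: "y \<in> S" "dist y x0 < d" by blast
  have "open (S \<inter> ball x0 d)" using PP.S_open by auto
  moreover have "y \<in> S \<inter> ball x0 d" using y by (simp add: dist_commute)
  ultimately obtain a b where ab: "y \<in> box a b" "cbox a b \<subseteq> S \<inter> ball x0 d"
    using open_contains_cbox[of "S \<inter> ball x0 d" y] by metis
  define \<phi> where "\<phi> = bump 1 a b"
  have \<phi>: "\<phi> \<in> T" unfolding \<phi>_def using ab by (intro bump_in_test_funs) auto
  have qs: "q x < s" if "x \<in> box a b" for x
  proof -
    have "x \<in> S" "dist x x0 < d" using that ab(2) box_subset_cbox[of a b] by (auto simp: dist_commute)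
    then have "dist (q x) (q x0) < s - q x0" using d(2) closure_subset by blast
    then show ?thesis by (simp add: dist_real_def)
  qed
  have B: "0 < Psi \<phi>"
  proof (rule ccontr)
    assume "\<not> 0 < Psi \<phi>"
    then have "Psi \<phi> = 0" using PQ.R.energy_nonneg[of \<phi>] by simp
    moreover have "AE x in M. 0 \<le> norm (\<phi> x) powr q x / q x"
    proof (rule AE_I2)
      show "0 \<le> norm (\<phi> x) powr q x / q x" if "x \<in> space M" for x
        by (rule PQ.R.divide_exponent_bounds(1)[OF that]) simp
    qed
    ultimately have "AE x in M. norm (\<phi> x) powr q x / q x = 0"
      using integral_nonneg_eq_0_iff_AE[OF PQ.R.energy_integrable[OF PQ.test_Lvar(3)[OF \<phi>]]]
      by (simp add: PQ.R.energy_def)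
    then have "AE x in M. x \<notin> box a b"
      using AE_space
    proof eventually_elim
      case (elim x)
      have "1 < q x" using PQ.R.exponent_bounds(1)[OF elim(2)] PQ.R.lo_gt_1 by simp
      then have "\<phi> x = 0" using elim(1) by simp
      then show ?case using bump_pos[of 1 x a b] by (auto simp: \<phi>_def)
    qed
    then have "AE x in lebesgue. x \<in> S \<longrightarrow> x \<notin> box a b"
      using PP.S_sets by (simp add: AE_restrict_space_iff)
    then have "AE x in lebesgue. x \<notin> box a b"
      by eventually_elim (use ab(2) box_subset_cbox[of a b] in auto)
    then have "box a b \<in> null_sets lebesgue"
      by (subst (asm) completion.AE_iff_null_sets) simp
    then have "negligible (box a b)" by (simp add: negligible_iff_null_sets)
    then show False using ab(1) open_not_negligible[OF open_box, of a b] by blast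
  qed
  define A where "A = rhop (gradient \<phi>)"
  have A: "0 \<le> A" by (simp add: A_def PP.P.rho_nonneg)
  \<comment> \<open>The bound 1 secures the constraint, the bound lam * Psi \<phi> / 2 the negative
    sign.\<close>
  obtain t where t: "0 < t" "t \<le> 1" "A * t powr (lo - s) \<le> min 1 (lam * Psi \<phi> / 2)"
    using ex_small_powr[of A "min 1 (lam * Psi \<phi> / 2)" "lo - s" 1] A lam B s by auto
  let ?\<psi> = "\<lambda>x. t * \<phi> x"
  have \<psi>: "?\<psi> \<in> T" "gradient ?\<psi> = (\<lambda>x. t *\<^sub>R gradient \<phi> x)"
    using test_funs_cmult[OF \<phi>] gradient_cmult[OF \<phi>] by auto
  have "Phi (gradient ?\<psi>) \<le> rhop (gradient ?\<psi>)" by (intro PP.P.energy_le_rho PP.test_Lvar \<psi>)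
  also have "\<dots> \<le> \<bar>t\<bar> powr lo * A" unfolding \<psi> A_def using t by (intro PP.P.rho_scaleR_le_small PP.test_Lvar \<phi>) auto
  also have "\<dots> = t powr s * (A * t powr (lo - s))" using t by (simp flip: powr_add)
  finally have P: "Phi (gradient ?\<psi>) \<le> t powr s * (A * t powr (lo - s))" .
  have ts: "t powr s \<le> 1" using t s by (intro powr_le1) auto
  have "t powr s * (A * t powr (lo - s)) \<le> 1 * 1"
    using ts t A by (intro mult_mono) auto
  then have 1: "Phi (gradient ?\<psi>) \<le> 1" using P by simp
  have Q: "t powr s * Psi \<phi> \<le> Psi ?\<psi>"
  proof -
    have "t powr s * Psi \<phi> = (\<integral>x. t powr s * (norm (\<phi> x) powr q x / q x) \<partial>M)"
      unfolding PQ.R.energy_def by (simp only: integral_mult_right_zero)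
    also have "\<dots> \<le> Psi ?\<psi>"
      unfolding PQ.R.energy_def
    proof (rule integral_mono)
      show "integrable M (\<lambda>x. t powr s * (norm (\<phi> x) powr q x / q x))"
        by (intro integrable_mult_right PQ.R.energy_integrable PQ.test_Lvar \<phi>)
      show "integrable M (\<lambda>x. norm (t * \<phi> x) powr q x / q x)"
        by (intro PQ.R.energy_integrable PQ.test_Lvar \<psi>)
      fix x assume x: "x \<in> space M"
      show "t powr s * (norm (\<phi> x) powr q x / q x) \<le> norm (t * \<phi> x) powr q x / q x"
      proof (cases "x \<in> box a b")
        case True
        have "t powr s \<le> t powr q x" using qs[OF True] t by (intro powr_mono') auto
        then have "t powr s * (norm (\<phi> x) powr q x / q x) \<le> t powr q x * (norm (\<phi> x) powr q x / q x)"
          by (intro mult_right_mono PQ.R.divide_exponent_bounds(1)[OF x]) auto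
        also have "\<dots> = norm (t * \<phi> x) powr q x / q x" using t by (simp add: abs_mult powr_mult)
        finally show ?thesis .
      next
        case False
        then show ?thesis using bump_outside[of 1 x a b] by (simp add: \<phi>_def)
      qed
    qed
    finally show ?thesis .
  qed
  have "Phi (gradient ?\<psi>) \<le> t powr s * (lam * Psi \<phi> / 2)"
    using P t by (smt (verit) mult_left_mono powr_ge_zero)
  also have "\<dots> < lam * (t powr s * Psi \<phi>)" using t lam B by simp
  also have "\<dots> \<le> lam * Psi ?\<psi>" using Q lam by (intro mult_left_mono) auto
  finally have "Phi (gradient ?\<psi>) - lam * Psi ?\<psi> < 0" by simp
  with \<psi>(1) 1 show ?thesis by (rule that)
qed

lemma eigenvalue_exists:
  assumes x0: "x0 \<in> closure S" "q x0 < lo"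
  shows "\<exists>lam_star>0. \<forall>lam. 0 < lam \<and> lam < lam_star \<longrightarrow> is_eigenvalue S p q lam"
proof -
  obtain C where C: "0 \<le> C" "\<And>\<phi>. \<phi> \<in> T \<Longrightarrow> Phi (gradient \<phi>) \<le> 1 \<Longrightarrow> Psi \<phi> \<le> C"
    using energy_bound by blast
  show ?thesis
  \<comment> \<open>C bounds \<open>Psi\<close> under the constraint, and adding 1 keeps the
    threshold positive when C = 0.\<close>
  proof (intro exI[of _ "1 / (C + 1)"] conjI allI impI)
    show "0 < 1 / (C + 1)" using C by simp
    fix lam assume "0 < lam \<and> lam < 1 / (C + 1)"
    then have lam: "0 < lam" "lam * (C + 1) < 1" using C by (auto simp: pos_less_divide_eq)
    obtain u G m where u: "admissible u G" "Phi G \<le> 1" "m = Phi G - lam * Psi u"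
      "\<And>\<phi>. \<phi> \<in> T \<Longrightarrow> Phi (gradient \<phi>) \<le> 1 \<Longrightarrow> m \<le> Phi (gradient \<phi>) - lam * Psi \<phi>"
      "\<And>C. (\<And>\<phi>. \<phi> \<in> T \<Longrightarrow> Phi (gradient \<phi>) \<le> 1 \<Longrightarrow> Psi \<phi> \<le> C) \<Longrightarrow> Psi u \<le> C"
      by (rule minimizer_exists[OF lam(1)]) blast
    obtain \<phi> where \<phi>: "\<phi> \<in> T" "Phi (gradient \<phi>) \<le> 1" "Phi (gradient \<phi>) - lam * Psi \<phi> < 0"
      using negative_energy[OF x0 lam(1)] by blast
    have m0: "m < 0" using u(4)[OF \<phi>(1,2)] \<phi>(3) by simp
    have "lam * Psi u \<le> lam * (C + 1)" using u(5)[OF C(2)] lam by (intro mult_left_mono) auto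
    \<comment> \<open>\<open>Phi G\<close> equals m + lam * Psi u, where m < 0 and the second term
      is below 1.\<close>
    then have lt: "Phi G < 1" using u(3) m0 lam(2) u(2) by linarith
    note hG = admissible_has_weak_gradient[OF u(1)]
    note W = weak_grad_eq[OF hG]
    have Gm: "G \<in> borel_measurable M" using u(1) by (auto simp: admissible_def PP.P.Lvar_def)
    have "weak_solution S p q lam u"
      unfolding weak_solution_def Let_def
    proof (intro conjI ballI)
      show "u \<in> W01p_var S p" by (rule admissible_W01p[OF u(1)])
      fix v assume "v \<in> W01p_var S p"
      then have v: "admissible v (weak_grad S v)" by (rule W01p_admissible)
      have vm: "weak_grad S v \<in> borel_measurable M" using v by (auto simp: admissible_def PP.P.Lvar_def)
      note EL = euler_lagrange[OF u(1) v lt u(3,4)]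
      let ?A = "\<lambda>x. norm (weak_grad S u x) powr (p x - 2) * (weak_grad S u x \<bullet> weak_grad S v x)"
      let ?A' = "\<lambda>x. norm (G x) powr (p x - 2) * (G x \<bullet> weak_grad S v x)"
      \<comment> \<open>The equation is obtained for G, with which \<open>weak_grad\<close> agrees
        only almost everywhere.\<close>
      have ae: "AE x in M. ?A x = ?A' x" using W(2) by eventually_elim simp
      have [measurable]: "p \<in> borel_measurable M" by (rule PP.P.exponent_measurable)
      note [measurable] = Gm vm W(3)
      have Am: "?A \<in> borel_measurable M" "?A' \<in> borel_measurable M" by measurable
      have "integrable M ?A \<longleftrightarrow> integrable M ?A'" by (rule integrable_cong_AE[OF Am ae])
      then show "integrable M ?A" using EL(1) by simp
      have B: "(\<lambda>x. norm (u x) powr (q x - 2) * (u x \<bullet> v x)) = (\<lambda>x. \<bar>u x\<bar> powr (q x - 2) * u x * v x)"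
        by (simp add: mult.assoc)
      show "integrable M (\<lambda>x. \<bar>u x\<bar> powr (q x - 2) * u x * v x)" using EL(2) unfolding B .
      have "(\<integral>x. ?A x \<partial>M) = (\<integral>x. ?A' x \<partial>M)" by (rule integral_cong_AE[OF Am ae])
      then show "(\<integral>x. ?A x \<partial>M) - lam * (\<integral>x. \<bar>u x\<bar> powr (q x - 2) * u x * v x \<partial>M) = 0"
        using EL(3) unfolding B by simp
    qed
    \<comment> \<open>For u = 0 a.e. the minimum would equal \<open>Phi G\<close>, which is
      nonnegative, whereas m < 0.\<close>
    moreover have "\<not> (AE x in M. u x = 0)"
    proof
      assume "AE x in M. u x = 0"
      then have "AE x in M. norm (u x) powr q x / q x = 0" by eventually_elim simp
      then have "Psi u = 0" unfolding PQ.R.energy_def by (rule integral_eq_zero_AE)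
      then show False using u(3) m0 PP.P.energy_nonneg[of G] by simp
    qed
    ultimately show "is_eigenvalue S p q lam" unfolding is_eigenvalue_def by blast
  qed
qed

end

theorem theorem1:
  fixes \<Omega> :: "(real ^ 'n) set" and p q :: "real ^ 'n \<Rightarrow> real"
  assumes "CARD('n) \<ge> 3"
    and "open \<Omega>" and "connected \<Omega>" and "\<Omega> \<noteq> {}" and "bounded \<Omega>" and "smooth_boundary \<Omega>"
    and "continuous_on (closure \<Omega>) p" and "continuous_on (closure \<Omega>) q"
    and "1 < (INF x\<in>closure \<Omega>. q x)"
    and "(INF x\<in>closure \<Omega>. q x) < (INF x\<in>closure \<Omega>. p x)"
    and "(INF x\<in>closure \<Omega>. p x) < (SUP x\<in>closure \<Omega>. q x)"
    and "(SUP x\<in>closure \<Omega>. p x) < real CARD('n)"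
    and "\<forall>x\<in>closure \<Omega>. q x < real CARD('n) * p x / (real CARD('n) - p x)"
  shows "\<exists>lam_star>0. \<forall>lam. 0 < lam \<and> lam < lam_star \<longrightarrow> is_eigenvalue \<Omega> p q lam"
proof -
  note \<open>open \<Omega>\<close>[simp]
  have c: "compact (closure \<Omega>)" "closure \<Omega> \<noteq> {}" using assms by (auto simp: compact_closure)
  have bdd: "bdd_below (f ` closure \<Omega>)" "bdd_above (f ` closure \<Omega>)" if "continuous_on (closure \<Omega>) f" for f :: "real ^ 'n \<Rightarrow> real"
    using compact_imp_bounded[OF compact_continuous_image[OF that c(1)]]
    by (auto intro: bounded_imp_bdd_below bounded_imp_bdd_above)
  define lo where "lo = (INF x\<in>closure \<Omega>. p x)"
  define hi where "hi = (SUP x\<in>closure \<Omega>. p x)"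
  define lo' where "lo' = (INF x\<in>closure \<Omega>. q x)"
  define hi' where "hi' = (SUP x\<in>closure \<Omega>. q x)"
  have pb: "lo \<le> p x" "p x \<le> hi" and qb: "lo' \<le> q x" "q x \<le> hi'" if "x \<in> closure \<Omega>" for x
    using that bdd[OF assms(7)] bdd[OF assms(8)]
    by (auto simp: lo_def hi_def lo'_def hi'_def intro!: cINF_lower cSUP_upper)
  obtain z where z: "z \<in> closure \<Omega>" using c(2) by (meson all_not_in_conv)
  have lohi: "lo \<le> hi" "lo' \<le> hi'" using pb[OF z] qb[OF z] by auto
  have lo: "1 < lo" "1 < lo'" "hi < real DIM(real ^ 'n)" using assms by (auto simp: lo_def lo'_def hi_def)
  have sub: "x \<in> closure \<Omega>" if "x \<in> \<Omega>" for x using that closure_subset by blast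
  have meas: "f \<in> borel_measurable (lebesgue_on \<Omega>)" if "continuous_on (closure \<Omega>) f" for f :: "real ^ 'n \<Rightarrow> real"
    using continuous_on_subset[OF that closure_subset] by (intro continuous_imp_measurable_on_sets_lebesgue) auto
  have fin: "finite_measure (lebesgue_on \<Omega>)"
    using emeasure_bounded_finite[OF \<open>bounded \<Omega>\<close>]
    by (intro finite_measureI) (auto simp: emeasure_restrict_space)
  interpret PP: lebesgue_variable_exponent \<Omega> p lo hi
    unfolding lebesgue_variable_exponent_def
    by (intro variable_exponent.intro variable_exponent_axioms.intro fin meas)
      (use assms lo lohi pb sub in auto)
  interpret QQ: lebesgue_variable_exponent \<Omega> q lo' hi'
    unfolding lebesgue_variable_exponent_def
    by (intro variable_exponent.intro variable_exponent_axioms.intro fin meas)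
      (use assms lo lohi qb sub in auto)
  have p1: "1 < p x" "p x < real DIM(real ^ 'n)" if "x \<in> closure \<Omega>" for x
    using pb[OF that] lo by auto
  \<comment> \<open>p is subcritical with respect to itself, as the instance r = p of
    \<open>subcritical\<close> requires.\<close>
  have pstar: "p x < real DIM(real ^ 'n) * p x / (real DIM(real ^ 'n) - p x)" if "x \<in> closure \<Omega>" for x
  proof -
    have "p x * (real DIM(real ^ 'n) - p x) < p x * real DIM(real ^ 'n)"
      using p1[OF that] by (intro mult_strict_left_mono) auto
    then show ?thesis using p1[OF that] by (simp add: pos_less_divide_eq mult.commute)
  qed
  interpret eigenvalue_problem \<Omega> p q lo hi lo' hi'
  proof
    show "1 \<le> p x" if "x \<in> closure \<Omega>" for x using p1[OF that] by simp
    show "1 \<le> q x" if "x \<in> closure \<Omega>" for x using qb[OF that] lo by simp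
    show "q x < real DIM(real ^ 'n) * p x / (real DIM(real ^ 'n) - p x)" if "x \<in> closure \<Omega>" for x
      using assms(13) that by simp
  qed (use assms p1 pstar in auto)
  \<comment> \<open>The infimum of q lies below that of p, so q falls below \<open>lo\<close>
    somewhere on the closure.\<close>
  obtain x0 where "x0 \<in> closure \<Omega>" "q x0 < lo"
    using assms(10) cINF_less_iff[OF c(2) bdd(1)[OF assms(8)], of lo] by (auto simp: lo_def)
  then show ?thesis by (rule eigenvalue_exists)
qed

end
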